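(* Let $N\ge 2$, $T>0$, let $\Omega=\mathbb{T}^N$ be the flat torus obtained from $[-1,1]^N$ by identifying opposite faces, and let $\mathbf{u}_0\in L^2(\Omega;\mathbb{R}^N)$. Consider the incompressible Euler system $$\partial_t\mathbf{u}+\operatorname{div}_x(\mathbf{u}\otimes\mathbf{u})+\nabla_x p=0,\qquad \operatorname{div}_x\mathbf{u}=0\qquad\text{in }[0,T)\times\Omega.$$ Let $\mathbf{u}$ be an admissible weak solution of this system with initial data $\mathbf{u}_0$, and let $\mathbf{v}$ be another weak solution of this system with the same initial data $\mathbf{u}_0$ such that $$\mathbf{v}\in L^2([0,T);B^{\alpha}_{p,\infty}(\Omega))\quad\text{for some }\alpha\in(0,1)\text{ with }\alpha>\tfrac12\text{ and some }p\ge 2.$$ Assume that there is a non-negative function $\mathcal{C}\in L^1([0,T))$ such that $$\int_{\Omega}\left[-\big(\zeta\cdot\mathbf{v}(\tau,x)\big)\,(\zeta\cdot\nabla_x)\phi(x)+\mathcal{C}(\tau)|\zeta|^2\phi(x)\right]dx\ge 0$$ for all $\zeta\in\mathbb{R}^N$, all $\tau\in[0,T)$, and every $\phi\in C_c^\infty(\Omega)$ with $\phi\ge 0$. Then $\mathbf{u}\equiv\mathbf{v}$ in $[0,T)\times\Omega$.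
   Context: Weak solution: $\mathbf{u}\in C([0,T),L^2(\Omega;\mathbb{R}^N))$ is a weak solution of the incompressible Euler system with initial data $\mathbf{u}_0$ if $\mathbf{u}(0,\cdot)=\mathbf{u}_0$ and, for all $0\le\tau_1<\tau_2<T$: (i) $\displaystyle\int_{\tau_1}^{\tau_2}\!\int_\Omega\left[\mathbf{u}\cdot\partial_t\psi+\mathbf{u}\otimes\mathbf{u}:\nabla_x\psi\right]dx\,dt=\int_\Omega\mathbf{u}\cdot\psi(\tau_2,x)\,dx-\int_\Omega\mathbf{u}\cdot\psi(\tau_1,x)\,dx$ for every $\psi\in C_c^1([0,T)\times\Omega;\mathbb{R}^N)$ with $\operatorname{div}_x\psi=0$; (ii) $\displaystyle\int_{\tau_1}^{\tau_2}\!\int_\Omega\mathbf{u}\cdot\nabla_x\phi\,dx\,dt=0$ for every $\phi\in C_c^1([0,T)\times\Omega)$. Here $\mathbf{u}\otimes\mathbf{u}:\nabla_x\psi=\sum_{i,j}u_iu_j\partial_{x_j}\psi_i$. The pressure $p$ does not enter the weak formulation (the $p$ in the Euler system is unrelated to the integrability exponent $p$). Admissible: a weak solution $\mathbf{u}$ is admissible if $\mathbf{u}\in L^\infty([0,T),L^2(\Omega))$ and $$\int_\Omega|\mathbf{u}|^2(\tau_2,x)\,dx\le\int_\Omega|\mathbf{u}|^2(\tau_1,x)\,dx\quad\text{for all }0\le\tau_1<\tau_2<T.$$ Besov space: for $p\ge1$ and $\alpha\in(0,1)$, $$B^{\alpha}_{p,\infty}(\Omega)=\Big\{h\in L^p(\Omega):\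 |h|_{B^\alpha_{p,\infty}}:=\sup_{\overline{\Omega_1}\subset\Omega}\ \sup_{\xi\in\mathbb{R}^N\setminus\{0\},\ \xi+\Omega_1\subset\Omega}\frac{\|h(\cdot+\xi)-h(\cdot)\|_{L^p(\Omega_1)}}{|\xi|^\alpha}<\infty\Big\},$$ normed by $\|h\|_{L^p}+|h|_{B^\alpha_{p,\infty}}$; on the torus all translations $\xi$ are allowed and one may take $\Omega_1=\Omega$. For vector-valued functions the condition is imposed componentwise. *)

theory Defs
  imports "HOL-Analysis.Analysis"
begin

text \<open>
  Functions on the flat torus (the cube $[-1,1]^N$ with opposite faces identified) are
  functions on \<open>real ^ 'n\<close> of period 2 in every coordinate, and integrals over the torus
  are integrals over the cube. Every class of almost-everywhere equal measurable functions on
  the torus has such a representative, and equality in a Lebesgue space is equality almost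
  everywhere on the cube.
\<close>

definition torus_periodic :: "(real ^ 'n \<Rightarrow> 'b) \<Rightarrow> bool" where
  "torus_periodic f \<longleftrightarrow> (\<forall>x i. f (x + 2 *\<^sub>R axis i 1) = f x)"

definition torus :: "(real ^ 'n) measure" where
  "torus = lebesgue_on (cbox (\<chi> i. - 1) (\<chi> i. 1))"

definition time_measure :: "real \<Rightarrow> real measure" where
  "time_measure T = lebesgue_on {0..<T}"


definition torus_Lp :: "real \<Rightarrow> (real ^ 'n \<Rightarrow> 'b::euclidean_space) \<Rightarrow> bool" where
  "torus_Lp p f \<longleftrightarrow> torus_periodic f \<and> f \<in> borel_measurable torus \<and>
     integrable torus (\<lambda>x. norm (f x) powr p)"

definition torus_Lp_norm :: "real \<Rightarrow> (real ^ 'n \<Rightarrow> 'b::euclidean_space) \<Rightarrow> real" where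
  "torus_Lp_norm p f = (\<integral>x. norm (f x) powr p \<partial>torus) powr (1 / p)"


definition besov_seminorm :: "real \<Rightarrow> real \<Rightarrow> (real ^ 'n \<Rightarrow> real) \<Rightarrow> ennreal" where
  "besov_seminorm p \<alpha> h =
     (SUP \<xi>\<in>- {0}. ennreal (torus_Lp_norm p (\<lambda>x. h (x + \<xi>) - h x) / norm \<xi> powr \<alpha>))"

definition besov_space :: "real \<Rightarrow> real \<Rightarrow> (real ^ 'n \<Rightarrow> real) set" where
  "besov_space p \<alpha> = {h. torus_Lp p h \<and> besov_seminorm p \<alpha> h < \<infinity>}"

definition besov_norm :: "real \<Rightarrow> real \<Rightarrow> (real ^ 'n \<Rightarrow> real) \<Rightarrow> ennreal" where
  "besov_norm p \<alpha> h = ennreal (torus_Lp_norm p h) + besov_seminorm p \<alpha> h"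

definition vec_besov_space :: "real \<Rightarrow> real \<Rightarrow> (real ^ 'n \<Rightarrow> real ^ 'n) set" where
  "vec_besov_space p \<alpha> = {h. \<forall>i. (\<lambda>x. h x $ i) \<in> besov_space p \<alpha>}"

definition vec_besov_norm :: "real \<Rightarrow> real \<Rightarrow> (real ^ 'n \<Rightarrow> real ^ 'n) \<Rightarrow> ennreal" where
  "vec_besov_norm p \<alpha> h = (\<Sum>i\<in>UNIV. besov_norm p \<alpha> (\<lambda>x. h x $ i))"

text \<open>
  $L^2([0,T);B^\alpha_{p,\infty})$. The Besov space is not separable, and strong measurability
  with respect to the Besov norm is not required, only measurability of the norm; every strongly
  measurable square-integrable function belongs to this class.
\<close>

definition L2_time_besov ::
    "real \<Rightarrow> real \<Rightarrow> real \<Rightarrow> (real \<Rightarrow> real ^ 'n \<Rightarrow> real ^ 'n) \<Rightarrow> bool" where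
  "L2_time_besov T p \<alpha> w \<longleftrightarrow>
     (AE t in time_measure T. w t \<in> vec_besov_space p \<alpha>) \<and>
     (\<lambda>t. vec_besov_norm p \<alpha> (w t)) \<in> borel_measurable (time_measure T) \<and>
     (\<integral>\<^sup>+ t. (vec_besov_norm p \<alpha> (w t))\<^sup>2 \<partial>time_measure T) < \<infinity>"


definition partial_deriv :: "'n \<Rightarrow> (real ^ 'n \<Rightarrow> 'b::real_normed_vector) \<Rightarrow> real ^ 'n \<Rightarrow> 'b" where
  "partial_deriv j f x = frechet_derivative f (at x) (axis j 1)"

definition grad :: "(real ^ 'n \<Rightarrow> real) \<Rightarrow> real ^ 'n \<Rightarrow> real ^ 'n" where
  "grad f x = (\<chi> j. partial_deriv j f x)"

definition divergence :: "(real ^ 'n \<Rightarrow> real ^ 'n) \<Rightarrow> real ^ 'n \<Rightarrow> real" where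
  "divergence f x = (\<Sum>j\<in>UNIV. partial_deriv j f x $ j)"

primrec Ck :: "nat \<Rightarrow> (real ^ 'n \<Rightarrow> real) \<Rightarrow> bool" where
  "Ck 0 f \<longleftrightarrow> continuous_on UNIV f"
| "Ck (Suc k) f \<longleftrightarrow> (\<forall>x. f differentiable (at x)) \<and> (\<forall>j. Ck k (partial_deriv j f))"

text \<open>The torus is compact, so compact support in space is no restriction.\<close>

definition torus_smooth :: "(real ^ 'n \<Rightarrow> real) \<Rightarrow> bool" where
  "torus_smooth f \<longleftrightarrow> torus_periodic f \<and> (\<forall>k. Ck k f)"

text \<open>
  $C_c^1([0,T)\times\Omega)$: the derivative at time 0 is one-sided. By compactness of the torus,
  the support is compact in $[0,T)\times\Omega$ iff the function vanishes from some time
  before \<open>T\<close> on; it need not vanish at time 0.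
\<close>

definition C1_test :: "real \<Rightarrow> (real \<Rightarrow> real ^ 'n \<Rightarrow> 'b::real_normed_vector) \<Rightarrow> bool" where
  "C1_test T \<psi> \<longleftrightarrow>
     (\<forall>t\<in>{0..<T}. torus_periodic (\<psi> t)) \<and>
     (\<exists>D :: real \<times> (real ^ 'n) \<Rightarrow> (real \<times> (real ^ 'n)) \<Rightarrow>\<^sub>L 'b.
        (\<forall>z\<in>{0..<T} \<times> UNIV.
           ((\<lambda>(t, x). \<psi> t x) has_derivative blinfun_apply (D z)) (at z within {0..<T} \<times> UNIV)) \<and>
        continuous_on ({0..<T} \<times> UNIV) D) \<and>
     (\<exists>T'<T. \<forall>t\<in>{0..<T}. T' \<le> t \<longrightarrow> (\<forall>x. \<psi> t x = 0))"

definition time_deriv ::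
    "real \<Rightarrow> (real \<Rightarrow> real ^ 'n \<Rightarrow> 'b::real_normed_vector) \<Rightarrow> real \<Rightarrow> real ^ 'n \<Rightarrow> 'b" where
  "time_deriv T \<psi> t x = vector_derivative (\<lambda>s. \<psi> s x) (at t within {0..<T})"


definition continuous_L2 :: "real \<Rightarrow> (real \<Rightarrow> real ^ 'n \<Rightarrow> real ^ 'n) \<Rightarrow> bool" where
  "continuous_L2 T u \<longleftrightarrow>
     (\<forall>t\<in>{0..<T}. torus_Lp 2 (u t)) \<and>
     (\<forall>t\<in>{0..<T}. ((\<lambda>s. torus_Lp_norm 2 (\<lambda>x. u s x - u t x)) \<longlongrightarrow> 0) (at t within {0..<T}))"

definition euler_weak_solution ::
    "real \<Rightarrow> (real ^ 'n \<Rightarrow> real ^ 'n) \<Rightarrow> (real \<Rightarrow> real ^ 'n \<Rightarrow> real ^ 'n) \<Rightarrow> bool" where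
  "euler_weak_solution T u0 u \<longleftrightarrow>
     continuous_L2 T u \<and>
     (AE x in torus. u 0 x = u0 x) \<and>
     (\<forall>\<tau>1 \<tau>2. 0 \<le> \<tau>1 \<and> \<tau>1 < \<tau>2 \<and> \<tau>2 < T \<longrightarrow>
        (\<forall>\<psi> :: real \<Rightarrow> real ^ 'n \<Rightarrow> real ^ 'n.
           C1_test T \<psi> \<and> (\<forall>t\<in>{0..<T}. \<forall>x. divergence (\<psi> t) x = 0) \<longrightarrow>
           (\<integral>t. (\<integral>x. u t x \<bullet> time_deriv T \<psi> t x
                   + (\<Sum>i\<in>UNIV. \<Sum>j\<in>UNIV. u t x $ i * u t x $ j * partial_deriv j (\<psi> t) x $ i)
                 \<partial>torus) \<partial>lebesgue_on {\<tau>1..\<tau>2})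
           = (\<integral>x. u \<tau>2 x \<bullet> \<psi> \<tau>2 x \<partial>torus) - (\<integral>x. u \<tau>1 x \<bullet> \<psi> \<tau>1 x \<partial>torus)) \<and>
        (\<forall>\<phi> :: real \<Rightarrow> real ^ 'n \<Rightarrow> real.
           C1_test T \<phi> \<longrightarrow>
           (\<integral>t. (\<integral>x. u t x \<bullet> grad (\<phi> t) x \<partial>torus) \<partial>lebesgue_on {\<tau>1..\<tau>2}) = 0))"

definition admissible_euler_weak_solution ::
    "real \<Rightarrow> (real ^ 'n \<Rightarrow> real ^ 'n) \<Rightarrow> (real \<Rightarrow> real ^ 'n \<Rightarrow> real ^ 'n) \<Rightarrow> bool" where
  "admissible_euler_weak_solution T u0 u \<longleftrightarrow>
     euler_weak_solution T u0 u \<and>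
     (\<exists>M. AE t in time_measure T. torus_Lp_norm 2 (u t) \<le> M) \<and>
     (\<forall>\<tau>1 \<tau>2. 0 \<le> \<tau>1 \<and> \<tau>1 < \<tau>2 \<and> \<tau>2 < T \<longrightarrow>
        (\<integral>x. (norm (u \<tau>2 x))\<^sup>2 \<partial>torus) \<le> (\<integral>x. (norm (u \<tau>1 x))\<^sup>2 \<partial>torus))"

end

theory Submission
  imports Defs
begin

text \<open>
  Applied to non-negative test functions, the one-sided condition bounds the symmetric part of
  \<open>\<nabla>v\<close> below by \<open>-C\<close>, and since its trace \<open>div v\<close> vanishes it is also bounded above: every
  positive mollification \<open>v\<^sup>m\<close> of \<open>v\<close> has \<open>\<bar>\<nabla>v\<^sup>m + (\<nabla>v\<^sup>m)\<^sup>T\<bar> \<le> 2(N+1)C\<close>. Testing each of the two weak formulations with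
  the mollification of the other solution gives, for \<open>w = u - v\<close>, the balance of
  \<open>\<parallel>w\<parallel>\<^sup>2 / 2\<close> with right-hand side \<open>- \<integral>w\<otimes>w : \<nabla>v\<^sup>m\<close> plus a defect, which is linear in
  \<open>\<integral>z\<^sub>i v\<^sub>j (\<partial>\<^sub>j v\<^sup>m\<^sub>i + \<partial>\<^sub>i v\<^sup>m\<^sub>j) + \<integral>v\<^sub>i v\<^sub>j \<partial>\<^sub>j z\<^sup>m\<^sub>i\<close> for the divergence free fields \<open>z = u\<close>
  and \<open>z = v\<close>. Replacing \<open>v\<^sub>i v\<^sub>j\<close> by \<open>v\<^sup>k\<^sub>i v\<^sup>k\<^sub>j\<close> and integrating by parts turns the second
  integral into \<open>-\<integral>z\<^sup>m\<^sub>i v\<^sup>k\<^sub>j (\<partial>\<^sub>j v\<^sup>k\<^sub>i + \<partial>\<^sub>i v\<^sup>k\<^sub>j)\<close>, so the bounded symmetric gradients make the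
  defect vanish in the limit, dominated by a multiple of \<open>C\<close>. As \<open>w\<otimes>w : \<nabla>v\<^sup>m \<ge> -C \<bar>w\<bar>\<^sup>2\<close>,
  Gronwall's inequality with the coefficient \<open>2C \<in> L\<^sup>1\<close> concludes.

  The mollifiers are trigonometric polynomials. Their kernels have finite rank by the addition
  theorems, so convolutions are differentiated and integrated by linearity, without Fubini.
\<close>

section \<open>Trigonometric polynomials\<close>

text \<open>Two obstacles shape the argument. In space, the antisymmetric part of the gradient of a
  mollified field is not controlled. The error terms therefore have to be grouped so that only
  symmetric gradients and divergences remain; the group that works is the cubic form with one
  argument z and two arguments v, summed over the three positions of z. In time, a mollified
  solution is only known to be continuous, so it is no test function for the other solution. Each
  increment of the pairing of u and v is instead split into two, in each of which one factor is
  frozen and serves as a stationary test field; differentiation happens on the diagonal of the time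
  square. The two energies are treated differently: for u there is only an inequality, so its energy
  enters without mollification, while v is paired with its own mollification, for which an exact
  balance holds.\<close>

inductive_set trig_polys :: "(real ^ 'n::finite \<Rightarrow> real) set" where
  const: "(\<lambda>x. c) \<in> trig_polys"
| cos: "(\<lambda>x. cos (pi * x $ i)) \<in> trig_polys"
| sin: "(\<lambda>x. sin (pi * x $ i)) \<in> trig_polys"
| add: "f \<in> trig_polys \<Longrightarrow> g \<in> trig_polys \<Longrightarrow> (\<lambda>x. f x + g x) \<in> trig_polys"
| mult: "f \<in> trig_polys \<Longrightarrow> g \<in> trig_polys \<Longrightarrow> (\<lambda>x. f x * g x) \<in> trig_polys"

lemma trig_polys_cmult: "f \<in> trig_polys \<Longrightarrow> (\<lambda>x. c * f x) \<in> trig_polys"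
  by (intro trig_polys.intros)

lemma trig_polys_uminus: "f \<in> trig_polys \<Longrightarrow> (\<lambda>x. - f x) \<in> trig_polys"
  using trig_polys_cmult[of f "-1"] by simp

lemma trig_polys_diff: "f \<in> trig_polys \<Longrightarrow> g \<in> trig_polys \<Longrightarrow> (\<lambda>x. f x - g x) \<in> trig_polys"
  using trig_polys.add[of f "\<lambda>x. - g x"] trig_polys_uminus[of g] by simp

lemma trig_polys_sum:
  "finite A \<Longrightarrow> (\<And>k. k \<in> A \<Longrightarrow> f k \<in> trig_polys) \<Longrightarrow> (\<lambda>x. \<Sum>k\<in>A. f k x) \<in> trig_polys"
  by (induction A rule: finite_induct) (auto intro: trig_polys.intros)

lemma trig_polys_power: "f \<in> trig_polys \<Longrightarrow> (\<lambda>x. f x ^ m) \<in> trig_polys"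
  by (induction m) (auto intro: trig_polys.intros)

lemma continuous_on_trig_poly: "f \<in> trig_polys \<Longrightarrow> continuous_on A f"
  by (induction rule: trig_polys.induct) (auto intro!: continuous_intros)

lemma torus_periodic_trig_poly: "f \<in> trig_polys \<Longrightarrow> torus_periodic f"
  by (induction rule: trig_polys.induct)
     (auto simp: torus_periodic_def axis_def algebra_simps cos_add sin_add)

lemma bounded_trig_poly:
  assumes "f \<in> trig_polys"
  obtains B where "B \<ge> 0" "\<And>x. \<bar>f x\<bar> \<le> B"
proof -
  have "\<exists>B. \<forall>x. \<bar>f x\<bar> \<le> B"
    using assms
  proof (induction rule: trig_polys.induct)
    case (cos i) then show ?case by (intro exI[of _ 1]) auto
  next
    case (sin i) then show ?case by (intro exI[of _ 1]) auto
  next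
    case (add f g)
    then obtain B B' where "\<forall>x. \<bar>f x\<bar> \<le> B" "\<forall>x. \<bar>g x\<bar> \<le> B'" by blast
    then show ?case
      by (intro exI[of _ "B + B'"]) (meson abs_triangle_ineq add_mono order_trans)
  next
    case (mult f g)
    then obtain B B' where "\<forall>x. \<bar>f x\<bar> \<le> B" "\<forall>x. \<bar>g x\<bar> \<le> B'" by blast
    then show ?case
      by (intro exI[of _ "B * B'"]) (metis abs_ge_zero abs_mult mult_mono' )
  qed auto
  then obtain B where B: "\<And>x. \<bar>f x\<bar> \<le> B" by blast
  moreover have "B \<ge> 0" using B[of undefined] by linarith
  ultimately show thesis using that by blast
qed

section \<open>Partial derivatives of trigonometric polynomials\<close>

lemma frechet_derivative_eq_partial_derivs:
  assumes "f differentiable (at (x :: real ^ 'n::finite))"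
  shows "(f has_derivative (\<lambda>h. \<Sum>j\<in>UNIV. h $ j *\<^sub>R partial_deriv j f x)) (at x)"
proof -
  let ?D = "frechet_derivative f (at x)"
  have D: "(f has_derivative ?D) (at x)"
    using assms frechet_derivative_works by blast
  then interpret bounded_linear ?D by (rule has_derivative_bounded_linear)
  have "?D h = (\<Sum>j\<in>UNIV. h $ j *\<^sub>R partial_deriv j f x)" for h
  proof -
    have "?D (\<Sum>j\<in>UNIV. h $ j *\<^sub>R axis j 1) = (\<Sum>j\<in>UNIV. h $ j *\<^sub>R ?D (axis j 1))"
      by (simp add: sum scaleR)
    moreover have "(\<Sum>j\<in>UNIV. h $ j *\<^sub>R axis j 1) = h"
      using basis_expansion[of h] by (simp add: vector_scalar_mult_def scalar_mult_eq_scaleR)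
    ultimately show ?thesis by (simp add: partial_deriv_def)
  qed
  then have "?D = (\<lambda>h. \<Sum>j\<in>UNIV. h $ j *\<^sub>R partial_deriv j f x)" by blast
  with D show ?thesis by simp
qed

lemma partial_deriv_eqI:
  "(f has_derivative D) (at x) \<Longrightarrow> partial_deriv j f x = D (axis j 1)"
  unfolding partial_deriv_def by (metis frechet_derivative_at)

lemma partial_deriv_const [simp]: "partial_deriv j (\<lambda>x. c) x = 0"
  by (rule partial_deriv_eqI) (rule has_derivative_const)

lemma partial_deriv_add:
  assumes "f differentiable (at x)" "g differentiable (at x)"
  shows "partial_deriv j (\<lambda>x. f x + g x) x = partial_deriv j f x + partial_deriv j g x"
  using assms[THEN frechet_derivative_works[THEN iffD1]]
  by (subst partial_deriv_eqI[OF has_derivative_add]) (auto simp: partial_deriv_def)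

lemma partial_deriv_mult:
  fixes f g :: "real ^ 'n::finite \<Rightarrow> real"
  assumes "f differentiable (at x)" "g differentiable (at x)"
  shows "partial_deriv j (\<lambda>x. f x * g x) x = f x * partial_deriv j g x + partial_deriv j f x * g x"
proof (rule partial_deriv_eqI[THEN trans])
  show "((\<lambda>x. f x * g x) has_derivative (\<lambda>h. f x * frechet_derivative g (at x) h +
      frechet_derivative f (at x) h * g x)) (at x)"
    using assms by (intro has_derivative_mult) (auto simp: frechet_derivative_works[symmetric])
qed (simp add: partial_deriv_def)

lemma has_derivative_cos_coord:
  "((\<lambda>x :: real ^ 'n::finite. cos (pi * x $ i)) has_derivative
     (\<lambda>h. - sin (pi * x $ i) * (pi * h $ i))) (at x)"
  by (auto intro!: derivative_eq_intros bounded_linear.has_derivative[OF bounded_linear_vec_nth]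
      simp: algebra_simps)

lemma has_derivative_sin_coord:
  "((\<lambda>x :: real ^ 'n::finite. sin (pi * x $ i)) has_derivative
     (\<lambda>h. cos (pi * x $ i) * (pi * h $ i))) (at x)"
  by (auto intro!: derivative_eq_intros bounded_linear.has_derivative[OF bounded_linear_vec_nth]
      simp: algebra_simps)

lemma differentiable_trig_poly: "f \<in> trig_polys \<Longrightarrow> f differentiable (at x)"
proof (induction rule: trig_polys.induct)
  case (cos i) then show ?case using has_derivative_cos_coord differentiable_def by blast
next
  case (sin i) then show ?case using has_derivative_sin_coord differentiable_def by blast
qed auto

lemma partial_deriv_trig_poly: "f \<in> trig_polys \<Longrightarrow> partial_deriv j f \<in> trig_polys"
proof (induction rule: trig_polys.induct)
  case (const c)
  have "partial_deriv j (\<lambda>x::real^'a. c) = (\<lambda>x. 0)" by (rule ext) simp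
  then show ?case by (simp add: trig_polys.const)
next
  case (cos i)
  have "partial_deriv j (\<lambda>x::real^'a. cos (pi * x $ i)) = (\<lambda>x. (- pi * axis j 1 $ i) * sin (pi * x $ i))"
    by (rule ext) (simp add: partial_deriv_eqI[OF has_derivative_cos_coord])
  then show ?case by (simp only: trig_polys_cmult trig_polys.sin)
next
  case (sin i)
  have "partial_deriv j (\<lambda>x::real^'a. sin (pi * x $ i)) = (\<lambda>x. (pi * axis j 1 $ i) * cos (pi * x $ i))"
    by (rule ext) (simp add: partial_deriv_eqI[OF has_derivative_sin_coord])
  then show ?case by (simp only: trig_polys_cmult trig_polys.cos)
next
  case (add f g)
  have "partial_deriv j (\<lambda>x. f x + g x) = (\<lambda>x. partial_deriv j f x + partial_deriv j g x)"
    using add by (intro ext partial_deriv_add differentiable_trig_poly)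
  then show ?case using add by (simp only: trig_polys.add)
next
  case (mult f g)
  have "partial_deriv j (\<lambda>x. f x * g x) = (\<lambda>x. f x * partial_deriv j g x + partial_deriv j f x * g x)"
    using mult by (intro ext partial_deriv_mult differentiable_trig_poly)
  then show ?case using mult by (simp only: trig_polys.add trig_polys.mult)
qed

lemma partial_deriv_cmult:
  fixes f :: "real ^ 'n::finite \<Rightarrow> real"
  shows "f differentiable (at x) \<Longrightarrow> partial_deriv j (\<lambda>x. c * f x) x = c * partial_deriv j f x"
  by (subst partial_deriv_mult) auto

lemma Ck_trig_poly: "f \<in> trig_polys \<Longrightarrow> Ck k f"
  by (induction k arbitrary: f)
     (auto intro: continuous_on_trig_poly differentiable_trig_poly partial_deriv_trig_poly)

lemma torus_smooth_trig_poly: "f \<in> trig_polys \<Longrightarrow> torus_smooth f"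
  by (simp add: torus_smooth_def Ck_trig_poly torus_periodic_trig_poly)

text \<open>The algebraic tensor product of \<open>trig_polys\<close> with itself. Its induction
  rule is the point: a statement about integral operators has to be checked only for one product
  a(x) b(y) and for sums.\<close>

inductive_set trig_kernels :: "(real ^ 'n::finite \<Rightarrow> real ^ 'n \<Rightarrow> real) set" where
  prod: "a \<in> trig_polys \<Longrightarrow> b \<in> trig_polys \<Longrightarrow> (\<lambda>x y. a x * b y) \<in> trig_kernels"
| add: "F \<in> trig_kernels \<Longrightarrow> G \<in> trig_kernels \<Longrightarrow> (\<lambda>x y. F x y + G x y) \<in> trig_kernels"

lemma trig_kernels_mult:
  assumes "F \<in> trig_kernels" "G \<in> trig_kernels"
  shows "(\<lambda>x y. F x y * G x y) \<in> trig_kernels"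
  using assms(1)
proof (induction rule: trig_kernels.induct)
  case (prod a b)
  show ?case using assms(2)
  proof (induction rule: trig_kernels.induct)
    case (prod c d)
    then have "(\<lambda>x y. (a x * c x) * (b y * d y)) \<in> trig_kernels"
      using \<open>a \<in> _\<close> \<open>b \<in> _\<close> by (intro trig_kernels.prod trig_polys.mult)
    then show ?case by (simp add: mult_ac)
  next
    case (add F G)
    from trig_kernels.add[OF add(3,4)] show ?case by (simp add: algebra_simps)
  qed
next
  case (add F H)
  from trig_kernels.add[OF add(3,4)] show ?case by (simp add: algebra_simps)
qed

text \<open>The addition theorems expand the cosine and sine of a difference into such products, and
  kernels are closed under sums and products.\<close>

lemma trig_kernels_difference: "f \<in> trig_polys \<Longrightarrow> (\<lambda>x y. f (x - y)) \<in> trig_kernels"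
proof (induction rule: trig_polys.induct)
  case (const c)
  have "(\<lambda>x y. (\<lambda>x. c) x * (\<lambda>x. 1) y) \<in> trig_kernels"
    by (intro trig_kernels.prod trig_polys.const)
  then show ?case by simp
next
  case (cos i)
  have "(\<lambda>x y::real^'a. cos (pi * x $ i) * cos (pi * y $ i) + sin (pi * x $ i) * sin (pi * y $ i)) \<in> trig_kernels"
    by (intro trig_kernels.intros trig_polys.intros)
  then show ?case by (simp add: algebra_simps cos_diff)
next
  case (sin i)
  have "(\<lambda>x y::real^'a. sin (pi * x $ i) * cos (pi * y $ i) + (- cos (pi * x $ i)) * sin (pi * y $ i)) \<in> trig_kernels"
    by (intro trig_kernels.intros trig_polys_uminus trig_polys.intros)
  then show ?case by (simp add: algebra_simps sin_diff)
qed (auto intro: trig_kernels.add trig_kernels_mult)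

lemma trig_kernels_fst: "F \<in> trig_kernels \<Longrightarrow> (\<lambda>x. F x y) \<in> trig_polys"
  by (induction rule: trig_kernels.induct) (auto intro!: trig_polys.intros)

lemma trig_kernels_snd: "F \<in> trig_kernels \<Longrightarrow> F x \<in> trig_polys"
proof (induction rule: trig_kernels.induct)
  case (add F G) from trig_polys.add[OF add(3,4)] show ?case by simp
qed (auto intro: trig_polys_cmult)

lemma trig_polys_reflect: "f \<in> trig_polys \<Longrightarrow> (\<lambda>y. f (x - y)) \<in> trig_polys"
  by (rule trig_kernels_snd[OF trig_kernels_difference])

section \<open>Integrals over the torus\<close>

abbreviation cube :: "(real ^ 'n::finite) set" where
  "cube \<equiv> cbox (\<chi> i. - 1) (\<chi> i. 1)"

lemma space_torus: "space (torus :: (real ^ 'n::finite) measure) = cube"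
  by (simp add: torus_def)

lemma finite_measure_torus: "finite_measure (torus :: (real ^ 'n::finite) measure)"
  unfolding torus_def
  by (intro finite_measureI)
     (simp add: emeasure_restrict_space emeasure_lborel_cbox_eq less_top[symmetric] del: emeasure_lborel_cbox)

lemma borel_measurable_torus_continuous:
  fixes f :: "real ^ 'n::finite \<Rightarrow> real"
  assumes "continuous_on UNIV f"
  shows "f \<in> borel_measurable torus"
  unfolding torus_def
  by (rule continuous_imp_measurable_on_sets_lebesgue)
     (auto intro: continuous_on_subset[OF assms])

lemma integrable_torus_continuous:
  fixes f :: "real ^ 'n::finite \<Rightarrow> real"
  assumes "continuous_on UNIV f"
  shows "integrable torus f"
  unfolding torus_def
  by (rule continuous_imp_integrable) (auto intro: continuous_on_subset[OF assms])

lemma integral_torus_eq: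
  fixes f :: "real ^ 'n::finite \<Rightarrow> real"
  assumes "continuous_on UNIV f"
  shows "integral\<^sup>L torus f = integral cube f"
  using integrable_torus_continuous[OF assms] unfolding torus_def
  by (rule lebesgue_integral_eq_integral) auto

text \<open>Cut the shifted cube at x_j = 1: the slab that sticks out is the translate by one period
  of the slab that is missing at the other end. The bounds on s put the cut inside the shifted
  cube.\<close>

lemma integral_torus_translate_axis:
  fixes f :: "real ^ 'n::finite \<Rightarrow> real"
  assumes f: "continuous_on UNIV f" "torus_periodic f" and s: "0 \<le> s" "s \<le> 2"
  shows "(\<integral>x. f (x + s *\<^sub>R axis j 1) \<partial>torus) = (\<integral>x. f x \<partial>torus)"
proof -
  define b where "b l r = cbox (\<chi> i. if i = j then l else - 1) (\<chi> i. if i = j then r else 1)" for l r :: real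
  have mem: "x \<in> b l r \<longleftrightarrow> l \<le> x $ j \<and> x $ j \<le> r \<and> (\<forall>i. i \<noteq> j \<longrightarrow> - 1 \<le> x $ i \<and> x $ i \<le> 1)" for l r x
    unfolding b_def mem_box_cart by (simp add: if_distrib if_distribR) (smt (verit))
  have int: "f integrable_on b l r" for l r
    unfolding b_def by (intro integrable_continuous continuous_on_subset[OF f(1)]) auto
  have shift: "integral (b l r) (\<lambda>x. f (x + c *\<^sub>R axis j 1)) = integral (b (l + c) (r + c)) f" for l r c
  proof -
    have "(\<chi> i. if i = j then l + c else - 1) - c *\<^sub>R axis j 1 = (\<chi> i. if i = j then l else - 1)"
      "(\<chi> i. if i = j then r + c else 1) - c *\<^sub>R axis j 1 = (\<chi> i. if i = j then r else 1)"
      by (auto simp: vec_eq_iff axis_def)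
    then show ?thesis
      using integral_shift_cbox[of "\<chi> i. if i = j then l + c else - 1" "c *\<^sub>R axis j 1"
          "\<chi> i. if i = j then r + c else 1" f]
      by (simp add: b_def)
  qed
  have split: "integral (b l r) f = integral (b l c) f + integral (b c r) f" if "l \<le> c" "c \<le> r" for l c r
  proof -
    have "b l r \<inter> {x. x \<bullet> axis j 1 \<le> c} = b l c" "b l r \<inter> {x. x \<bullet> axis j 1 \<ge> c} = b c r"
      using that by (auto simp: mem inner_axis)
    then show ?thesis
      using integral_split[of f "\<chi> i. if i = j then l else - 1" "\<chi> i. if i = j then r else 1" "axis j 1" c]
        int[of l r] by (simp add: b_def axis_in_Basis_iff)
  qed
  have b1: "b (-1) 1 = cube"
    by (auto simp: b_def mem_box_cart)
  have fc: "continuous_on UNIV (\<lambda>x. f (x + s *\<^sub>R axis j 1))"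
    by (rule continuous_on_compose2[OF f(1)]) (auto intro!: continuous_intros)
  have "(\<integral>x. f (x + s *\<^sub>R axis j 1) \<partial>torus) = integral (b (-1 + s) (1 + s)) f"
    unfolding integral_torus_eq[OF fc] b1[symmetric] by (rule shift)
  also have "\<dots> = integral (b (-1 + s) 1) f + integral (b 1 (1 + s)) f"
    using s by (intro split) auto
  also have "integral (b 1 (1 + s)) f = integral (b (-1) (-1 + s)) f"
    using shift[of "-1" "-1 + s" 2] f(2) by (simp add: torus_periodic_def add.commute)
  also have "integral (b (-1 + s) 1) f + integral (b (-1) (-1 + s)) f = integral (b (-1) 1) f"
    using s by (subst split[of "-1" "-1 + s" 1]) auto
  also have "\<dots> = (\<integral>x. f x \<partial>torus)"
    unfolding integral_torus_eq[OF f(1)] b1 ..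
  finally show ?thesis .
qed

text \<open>A general shift is composed of shifts along the axes, and the length of each is reduced
  modulo the period 2 to the range of the axis lemma.\<close>

lemma integral_torus_trig_poly_translate:
  assumes "f \<in> trig_polys"
  shows "(\<integral>x. f (x + y) \<partial>torus) = (\<integral>x. f x \<partial>torus)"
proof -
  define h where "h y = (\<integral>x. f (x + y) \<partial>torus)" for y
  note f = continuous_on_trig_poly[OF assms, of UNIV] torus_periodic_trig_poly[OF assms]
  have step: "h (y + s *\<^sub>R axis j 1) = h y" for y s j
  proof -
    define k :: int where "k = \<lfloor>s / 2\<rfloor>"
    define r where "r = s - 2 * of_int k"
    have r: "0 \<le> r" "r \<le> 2"
      unfolding r_def k_def by linarith+
    have per: "f (x + (2 * of_int m) *\<^sub>R axis j 1) = f x" for x and m :: int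
    proof -
      have nat: "f (x + (2 * of_nat n) *\<^sub>R axis j 1) = f x" for x and n :: nat
      proof (induction n arbitrary: x)
        case (Suc n)
        have "f (x + (2 * of_nat (Suc n)) *\<^sub>R axis j 1) = f ((x + (2 * of_nat n) *\<^sub>R axis j 1) + 2 *\<^sub>R axis j 1)"
          by (simp add: algebra_simps)
        also have "\<dots> = f x" using f(2) Suc by (simp add: torus_periodic_def)
        finally show ?case .
      qed simp
      show ?thesis
      proof (cases "m \<ge> 0")
        case True
        then show ?thesis using nat[of x "nat m"] by simp
      next
        case False
        then show ?thesis using nat[of "x + (2 * of_int m) *\<^sub>R axis j 1" "nat (-m)"] by simp
      qed
    qed
    have "h (y + s *\<^sub>R axis j 1) = (\<integral>x. f ((x + (y + r *\<^sub>R axis j 1)) + (2 * of_int k) *\<^sub>R axis j 1) \<partial>torus)"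
      unfolding h_def r_def by (simp add: algebra_simps)
    also have "\<dots> = (\<integral>x. f ((x + r *\<^sub>R axis j 1) + y) \<partial>torus)"
      unfolding per by (simp add: algebra_simps)
    also have "\<dots> = h y"
      unfolding h_def
    proof (rule integral_torus_translate_axis)
      show "continuous_on UNIV (\<lambda>x. f (x + y))"
        by (rule continuous_on_compose2[OF f(1)]) (auto intro!: continuous_intros)
      show "torus_periodic (\<lambda>x. f (x + y))"
        unfolding torus_periodic_def
      proof (intro allI)
        fix x i
        have "x + 2 *\<^sub>R axis i 1 + y = (x + y) + 2 *\<^sub>R axis i 1" by simp
        then show "f (x + 2 *\<^sub>R axis i 1 + y) = f (x + y)"
          using f(2) by (simp only: torus_periodic_def)
      qed
    qed (use r in auto)
    finally show ?thesis .
  qed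
  have "h (\<Sum>j\<in>A. y $ j *\<^sub>R axis j 1) = h 0" if "finite A" for A
    using that by (induction A rule: finite_induct) (auto simp: step add.commute[of "_ $ _ *\<^sub>R _"])
  from this[of UNIV] have "h y = h 0"
    using basis_expansion[of y] by (simp add: scalar_mult_eq_scaleR)
  then show ?thesis by (simp add: h_def)
qed

lemma integrable_torus_trig_poly: "f \<in> trig_polys \<Longrightarrow> integrable torus f"
  by (intro integrable_torus_continuous continuous_on_trig_poly)

lemma borel_measurable_torus_trig_poly: "f \<in> trig_polys \<Longrightarrow> f \<in> borel_measurable torus"
  by (intro borel_measurable_torus_continuous continuous_on_trig_poly)

lemma integral_torus_trig_poly_reflect:
  assumes "f \<in> trig_polys" and "\<And>x. f (- x) = f x"
  shows "(\<integral>y. f (x - y) \<partial>torus) = (\<integral>x. f x \<partial>torus)"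
proof -
  have "(\<lambda>y. f (x - y)) = (\<lambda>y. f (y + - x))"
    using assms(2) by (metis add.commute diff_conv_add_uminus minus_diff_eq)
  then show ?thesis using integral_torus_trig_poly_translate[OF assms(1), of "- x"] by simp
qed

section \<open>Square integrable functions on the torus\<close>

text \<open>Only the values on the cube matter; periodicity enters through the kernels with which f
  is convolved.\<close>

definition sq_integrable :: "(real ^ 'n::finite \<Rightarrow> real) \<Rightarrow> bool" where
  "sq_integrable f \<longleftrightarrow> f \<in> borel_measurable torus \<and> integrable torus (\<lambda>x. (f x)\<^sup>2)"

definition L2norm :: "(real ^ 'n::finite \<Rightarrow> real) \<Rightarrow> real" where
  "L2norm f = sqrt (\<integral>x. (f x)\<^sup>2 \<partial>torus)"

abbreviation L2dist :: "(real ^ 'n::finite \<Rightarrow> real) \<Rightarrow> (real ^ 'n \<Rightarrow> real) \<Rightarrow> real" where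
  "L2dist f g \<equiv> L2norm (\<lambda>x. f x - g x)"

lemma L2norm_nonneg [simp]: "L2norm f \<ge> 0"
  by (simp add: L2norm_def)

lemma L2norm_sq: "(L2norm f)\<^sup>2 = (\<integral>x. (f x)\<^sup>2 \<partial>torus)"
  by (simp add: L2norm_def)

lemma sq_integrable_measurable: "sq_integrable f \<Longrightarrow> f \<in> borel_measurable torus"
  by (simp add: sq_integrable_def)

lemma integrable_mult_sq_integrable:
  assumes "sq_integrable f" "sq_integrable g"
  shows "integrable torus (\<lambda>x. f x * g x)"
proof (rule Bochner_Integration.integrable_bound)
  show "integrable torus (\<lambda>x. (f x)\<^sup>2 + (g x)\<^sup>2)"
    using assms by (simp add: sq_integrable_def)
  show "(\<lambda>x. f x * g x) \<in> borel_measurable torus"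
    using assms by (intro borel_measurable_times sq_integrable_measurable)
  have "\<bar>f x * g x\<bar> \<le> (f x)\<^sup>2 + (g x)\<^sup>2" for x
    using sum_squares_bound[of "\<bar>f x\<bar>" "\<bar>g x\<bar>"] abs_ge_zero[of "f x * g x"]
    unfolding abs_mult power2_abs by linarith
  then show "AE x in torus. norm (f x * g x) \<le> norm ((f x)\<^sup>2 + (g x)\<^sup>2)" by simp
qed

lemma integrable_mult_bounded:
  fixes f g :: "real ^ 'n::finite \<Rightarrow> real"
  assumes "integrable torus f" "g \<in> borel_measurable torus" "\<And>x. \<bar>g x\<bar> \<le> B"
  shows "integrable torus (\<lambda>x. f x * g x)"
proof (rule Bochner_Integration.integrable_bound)
  show "integrable torus (\<lambda>x. B * f x)" using assms(1) by simp
  show "(\<lambda>x. f x * g x) \<in> borel_measurable torus" using assms by simp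
  have "\<bar>f x\<bar> * \<bar>g x\<bar> \<le> \<bar>f x\<bar> * \<bar>B\<bar>" for x
    using assms(3)[of x] by (intro mult_left_mono) auto
  then show "AE x in torus. norm (f x * g x) \<le> norm (B * f x)" by (simp add: abs_mult mult.commute)
qed

lemma integrable_mult_trig_poly:
  assumes "integrable torus f" "g \<in> trig_polys"
  shows "integrable torus (\<lambda>x. f x * g x)" "integrable torus (\<lambda>x. g x * f x)"
proof -
  obtain B where "\<And>x. \<bar>g x\<bar> \<le> B" using bounded_trig_poly[OF assms(2)] by blast
  then show "integrable torus (\<lambda>x. f x * g x)"
    using integrable_mult_bounded assms borel_measurable_torus_trig_poly by blast
  then show "integrable torus (\<lambda>x. g x * f x)" by (simp add: mult.commute)
qed

lemma sq_integrable_continuous: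
  "continuous_on UNIV f \<Longrightarrow> sq_integrable f"
  unfolding sq_integrable_def
  by (auto intro!: borel_measurable_torus_continuous integrable_torus_continuous continuous_intros)

lemma sq_integrable_trig_poly: "f \<in> trig_polys \<Longrightarrow> sq_integrable f"
  by (intro sq_integrable_continuous continuous_on_trig_poly)

lemma sq_integrable_imp_integrable: "sq_integrable f \<Longrightarrow> integrable torus f"
  using integrable_mult_sq_integrable[of f "\<lambda>x. 1"] sq_integrable_continuous[of "\<lambda>x. 1"]
  by simp

lemma sq_integrable_uminus: "sq_integrable f \<Longrightarrow> sq_integrable (\<lambda>x. - f x)"
  by (auto simp: sq_integrable_def)

lemma sq_integrable_add:
  assumes "sq_integrable f" "sq_integrable g"
  shows "sq_integrable (\<lambda>x. f x + g x)"
proof -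
  have "integrable torus (\<lambda>x. (f x)\<^sup>2 + (g x)\<^sup>2 + 2 * (f x * g x))"
    using assms integrable_mult_sq_integrable[OF assms] by (simp add: sq_integrable_def)
  then show ?thesis
    using borel_measurable_add[OF assms[THEN sq_integrable_measurable]]
    by (simp add: sq_integrable_def power2_sum mult.assoc)
qed

lemma sq_integrable_diff:
  "sq_integrable f \<Longrightarrow> sq_integrable g \<Longrightarrow> sq_integrable (\<lambda>x. f x - g x)"
  using sq_integrable_add[of f "\<lambda>x. - g x"] sq_integrable_uminus[of g] by simp

text \<open>The right-hand side of the weighted inequality is smallest at t = Y / X, where it equals
  2 X Y. In this form Cauchy-Schwarz comes from integrating a pointwise inequality, without dividing
  by a norm that may vanish.\<close>

lemma mult_le_of_scaled_squares:
  fixes X Y Z :: real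
  assumes "X \<ge> 0" "Y \<ge> 0" and le: "\<And>t. t > 0 \<Longrightarrow> 2 * Z \<le> t * X\<^sup>2 + Y\<^sup>2 / t"
  shows "Z \<le> X * Y"
proof (rule field_le_epsilon)
  fix e :: real assume e: "e > 0"
  define d where "d = e / (X + Y + 1)"
  have d: "d > 0" "d * (X + Y) \<le> e"
    using e assms(1,2) by (auto simp: d_def field_simps)
  \<comment> \<open>A perturbation of the optimal Y / X that stays positive and finite if X or Y is
    0; it costs d (X + Y) in the bound for 2 Z.\<close>
  define t where "t = (Y + d) / (X + d)"
  have t: "t > 0" using d assms by (simp add: t_def)
  have "t * X\<^sup>2 \<le> (Y + d) * X"
  proof -
    have "X * (Y + d) * X \<le> X * (Y + d) * (X + d)"
      using d assms by (intro mult_left_mono) auto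
    then show ?thesis using d assms by (simp add: t_def field_simps power2_eq_square)
  qed
  moreover have "Y\<^sup>2 / t \<le> Y * (X + d)"
  proof -
    have "Y * (X + d) * Y \<le> Y * (X + d) * (Y + d)"
      using d assms by (intro mult_left_mono) auto
    moreover have "Y + d > 0" using d assms by simp
    ultimately show ?thesis by (simp add: t_def field_simps power2_eq_square)
  qed
  ultimately have "2 * Z \<le> (Y + d) * X + Y * (X + d)" using le[OF t] by linarith
  also have "\<dots> = 2 * (X * Y) + d * (X + Y)" by (simp add: algebra_simps)
  finally show "Z \<le> X * Y + e" using d e by linarith
qed

lemma integral_abs_mult_le_L2norm:
  assumes "sq_integrable f" "sq_integrable g"
  shows "(\<integral>x. \<bar>f x * g x\<bar> \<partial>torus) \<le> L2norm f * L2norm g"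
proof (rule mult_le_of_scaled_squares)
  fix t :: real assume t: "t > 0"
  have *: "2 * \<bar>f x * g x\<bar> \<le> t * (f x)\<^sup>2 + (g x)\<^sup>2 / t" for x
    using sum_squares_bound[of "sqrt t * \<bar>f x\<bar>" "\<bar>g x\<bar> / sqrt t"] t
    by (simp add: abs_mult power_mult_distrib power_divide)
  have "2 * (\<integral>x. \<bar>f x * g x\<bar> \<partial>torus) = (\<integral>x. 2 * \<bar>f x * g x\<bar> \<partial>torus)" by simp
  also have "\<dots> \<le> (\<integral>x. t * (f x)\<^sup>2 + (g x)\<^sup>2 / t \<partial>torus)"
    using assms integrable_mult_sq_integrable[OF assms] *
    by (intro integral_mono) (auto simp: sq_integrable_def)
  also have "\<dots> = t * (L2norm f)\<^sup>2 + (L2norm g)\<^sup>2 / t"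
    using assms by (simp add: sq_integrable_def L2norm_sq)
  finally show "2 * (\<integral>x. \<bar>f x * g x\<bar> \<partial>torus) \<le> t * (L2norm f)\<^sup>2 + (L2norm g)\<^sup>2 / t" .
qed auto

lemma abs_integral_mult_le_L2norm:
  assumes "sq_integrable f" "sq_integrable g"
  shows "\<bar>\<integral>x. f x * g x \<partial>torus\<bar> \<le> L2norm f * L2norm g"
  using integral_abs_mult_le_L2norm[OF assms] integral_abs_bound[of torus "\<lambda>x. f x * g x"] by linarith

abbreviation integral3 :: "(real ^ 'n::finite \<Rightarrow> real) \<Rightarrow> (real ^ 'n \<Rightarrow> real) \<Rightarrow> (real ^ 'n \<Rightarrow> real) \<Rightarrow> real" where
  "integral3 f g h \<equiv> \<integral>x. f x * g x * h x \<partial>torus"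

lemma integrable_triple:
  assumes "sq_integrable f" "sq_integrable g" "h \<in> borel_measurable torus" "\<And>x. \<bar>h x\<bar> \<le> B"
  shows "integrable torus (\<lambda>x. f x * g x * h x)"
  using integrable_mult_bounded[OF integrable_mult_sq_integrable[OF assms(1,2)] assms(3,4)] .

lemma abs_integral_triple_le:
  assumes f: "sq_integrable f" and g: "sq_integrable g"
    and h: "h \<in> borel_measurable torus" "\<And>x. \<bar>h x\<bar> \<le> B"
  shows "\<bar>integral3 f g h\<bar> \<le> B * (L2norm f * L2norm g)"
proof -
  have B: "B \<ge> 0" using h(2)[of undefined] by linarith
  note i = integrable_mult_sq_integrable[OF f g]
  have "\<bar>integral3 f g h\<bar> \<le> (\<integral>x. \<bar>f x * g x * h x\<bar> \<partial>torus)"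
    by (rule integral_abs_bound)
  also have "\<dots> \<le> (\<integral>x. B * \<bar>f x * g x\<bar> \<partial>torus)"
  proof (rule integral_mono)
    show "integrable torus (\<lambda>x. \<bar>f x * g x * h x\<bar>)"
      using integrable_triple[OF assms] by simp
    show "integrable torus (\<lambda>x. B * \<bar>f x * g x\<bar>)" using i by simp
    fix x show "\<bar>f x * g x * h x\<bar> \<le> B * \<bar>f x * g x\<bar>"
      using mult_left_mono[OF h(2)[of x], of "\<bar>f x * g x\<bar>"] by (simp add: abs_mult mult.commute)
  qed
  also have "\<dots> \<le> B * (L2norm f * L2norm g)"
    using integral_abs_mult_le_L2norm[OF f g] B by (simp add: mult_left_mono)
  finally show ?thesis .
qed

lemma L2norm_triangle:
  assumes "sq_integrable f" "sq_integrable g"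
  shows "L2norm (\<lambda>x. f x + g x) \<le> L2norm f + L2norm g"
proof (rule power2_le_imp_le)
  have "(L2norm (\<lambda>x. f x + g x))\<^sup>2 = (\<integral>x. (f x)\<^sup>2 + (g x)\<^sup>2 + 2 * (f x * g x) \<partial>torus)"
    by (simp add: L2norm_sq power2_sum mult.assoc)
  also have "\<dots> = (L2norm f)\<^sup>2 + (L2norm g)\<^sup>2 + 2 * (\<integral>x. f x * g x \<partial>torus)"
    using assms integrable_mult_sq_integrable[OF assms] by (simp add: sq_integrable_def L2norm_sq)
  also have "\<dots> \<le> (L2norm f + L2norm g)\<^sup>2"
    using abs_integral_mult_le_L2norm[OF assms] by (simp add: power2_sum)
  finally show "(L2norm (\<lambda>x. f x + g x))\<^sup>2 \<le> (L2norm f + L2norm g)\<^sup>2" .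
qed simp

lemma L2norm_uminus: "L2norm (\<lambda>x. - f x) = L2norm f"
  by (simp add: L2norm_def)

lemma L2norm_minus_commute: "L2dist f g = L2dist g f"
  by (simp add: L2norm_def power2_commute)

lemma L2norm_diff_triangle:
  assumes "sq_integrable f" "sq_integrable g" "sq_integrable h"
  shows "L2dist f h \<le> L2dist f g + L2dist g h"
  using L2norm_triangle[OF sq_integrable_diff[OF assms(1,2)] sq_integrable_diff[OF assms(2,3)]] by simp

lemma L2norm_diff_le:
  assumes "sq_integrable f" "sq_integrable g"
  shows "\<bar>L2norm f - L2norm g\<bar> \<le> L2dist f g"
  using L2norm_triangle[OF sq_integrable_diff[OF assms(1,2)] assms(2)]
    L2norm_triangle[OF sq_integrable_diff[OF assms(2,1)] assms(1)] L2norm_minus_commute[of f g] by simp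

lemma L2norm_le_bound:
  fixes f :: "real ^ 'n::finite \<Rightarrow> real"
  assumes "sq_integrable f" "\<And>x. x \<in> space torus \<Longrightarrow> \<bar>f x\<bar> \<le> B" "B \<ge> 0"
  shows "L2norm f \<le> B * L2norm (\<lambda>x :: real ^ 'n. 1)"
proof -
  have "(\<integral>x. (f x)\<^sup>2 \<partial>torus) \<le> (\<integral>x. B\<^sup>2 * 1 \<partial>(torus :: (real ^ 'n) measure))"
  proof (rule integral_mono)
    fix x :: "real ^ 'n" assume "x \<in> space torus"
    then show "(f x)\<^sup>2 \<le> B\<^sup>2 * 1" using assms(2)[of x] power_mono[of "\<bar>f x\<bar>" B 2] by simp
  qed (use assms(1) finite_measure.integrable_const[OF finite_measure_torus, of "B\<^sup>2"] in \<open>auto simp: sq_integrable_def\<close>)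
  also have "\<dots> = (B * L2norm (\<lambda>x :: real ^ 'n. 1))\<^sup>2"
    by (simp add: power_mult_distrib L2norm_sq)
  finally show ?thesis
    using assms(3) by (simp add: L2norm_def real_le_lsqrt)
qed

section \<open>Convolution with trigonometric kernels\<close>

definition kernel_int :: "(real ^ 'n::finite \<Rightarrow> real ^ 'n \<Rightarrow> real) \<Rightarrow> (real ^ 'n \<Rightarrow> real) \<Rightarrow> real ^ 'n \<Rightarrow> real"
  where "kernel_int F f x = (\<integral>y. F x y * f y \<partial>torus)"

lemma integrable_kernel:
  "F \<in> trig_kernels \<Longrightarrow> integrable torus f \<Longrightarrow> integrable torus (\<lambda>y. F x y * f y)"
  by (intro integrable_mult_trig_poly trig_kernels_snd)

lemma kernel_int_add:
  assumes "F \<in> trig_kernels" "G \<in> trig_kernels" "integrable torus f"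
  shows "kernel_int (\<lambda>x y. F x y + G x y) f = (\<lambda>x. kernel_int F f x + kernel_int G f x)"
  using integrable_kernel[OF assms(1,3)] integrable_kernel[OF assms(2,3)]
  by (simp add: kernel_int_def fun_eq_iff distrib_right)

lemma kernel_int_prod: "kernel_int (\<lambda>x y. a x * b y) f = (\<lambda>x. (\<integral>y. b y * f y \<partial>torus) * a x)"
  by (simp add: kernel_int_def fun_eq_iff mult.assoc mult.commute[of _ "integral\<^sup>L _ _"])

lemma kernel_int_trig_poly:
  assumes "F \<in> trig_kernels" "integrable torus f"
  shows "kernel_int F f \<in> trig_polys"
  using assms(1)
proof (induction rule: trig_kernels.induct)
  case (prod a b)
  then show ?case by (simp add: kernel_int_prod trig_polys_cmult)
next
  case (add F G)
  then show ?case by (simp add: kernel_int_add assms(2) trig_polys.add)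
qed

text \<open>This exchanges the two integrations. For one product both sides are the integral of b f
  times the integral of a g; sums only require integrability.\<close>

lemma integral_mult_kernel_int:
  assumes "F \<in> trig_kernels" "integrable torus f" "integrable torus g"
  shows "(\<integral>x. g x * kernel_int F f x \<partial>torus) = (\<integral>y. f y * (\<integral>x. F x y * g x \<partial>torus) \<partial>torus)"
  using assms(1)
proof (induction rule: trig_kernels.induct)
  case (prod a b)
  have "(\<integral>x. g x * kernel_int (\<lambda>x y. a x * b y) f x \<partial>torus) =
      (\<integral>y. b y * f y \<partial>torus) * (\<integral>x. a x * g x \<partial>torus)"
    by (simp add: kernel_int_prod mult.left_commute[of _ "integral\<^sup>L _ _"] mult.commute[of "g _"])
  moreover have "(\<integral>x. a x * b y * g x \<partial>torus) = b y * (\<integral>x. a x * g x \<partial>torus)" for y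
    by (subst integral_mult_right_zero[symmetric]) (simp add: mult_ac)
  then have "(\<integral>y. f y * (\<integral>x. a x * b y * g x \<partial>torus) \<partial>torus) =
      (\<integral>y. b y * f y * (\<integral>x. a x * g x \<partial>torus) \<partial>torus)"
    by (intro Bochner_Integration.integral_cong) (simp_all add: mult_ac)
  ultimately show ?case by simp
next
  case (add F G)
  \<comment> \<open>The inner integral is a trigonometric polynomial in y, so its product with f is
    integrable and the outer integral splits.\<close>
  have *: "integrable torus (\<lambda>y. f y * (\<integral>x. H x y * g x \<partial>torus))" if "H \<in> trig_kernels" for H
  proof -
    have "(\<lambda>y. (\<integral>x. H x y * g x \<partial>torus)) \<in> trig_polys"
      using that
    proof (induction rule: trig_kernels.induct)
      case (prod a b)
      have "(\<integral>x. a x * b y * g x \<partial>torus) = (\<integral>x. a x * g x \<partial>torus) * b y" for y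
        by (subst integral_mult_left_zero[symmetric]) (simp add: mult_ac)
      then show ?case using prod by (simp add: trig_polys_cmult)
    next
      case (add F G)
      have "(\<lambda>y. (\<integral>x. (F x y + G x y) * g x \<partial>torus)) =
          (\<lambda>y. (\<integral>x. F x y * g x \<partial>torus) + (\<integral>x. G x y * g x \<partial>torus))"
        using add(1,2) assms(3)
        by (auto simp: distrib_right fun_eq_iff intro!: Bochner_Integration.integral_add
            integrable_mult_trig_poly trig_kernels_fst)
      then show ?case using add by (simp add: trig_polys.add)
    qed
    then show ?thesis using assms(2) integrable_mult_trig_poly by blast
  qed
  have kF: "integrable torus (\<lambda>x. g x * kernel_int F f x)" "integrable torus (\<lambda>x. g x * kernel_int G f x)"
    using add(1,2) assms kernel_int_trig_poly integrable_mult_trig_poly by blast+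
  have i: "integrable torus (\<lambda>x. F x y * g x)" "integrable torus (\<lambda>x. G x y * g x)" for y
    using add(1,2) assms(3) by (auto intro!: integrable_mult_trig_poly trig_kernels_fst)
  show ?case
    using add(3,4) *[OF add(1)] *[OF add(2)] kF i
    by (simp add: kernel_int_add[OF add(1,2) assms(2)] distrib_left distrib_right)
qed

lemma partial_deriv_kernel:
  assumes "F \<in> trig_kernels"
  shows "(\<lambda>x y. partial_deriv j (\<lambda>x. F x y) x) \<in> trig_kernels"
  using assms
proof (induction rule: trig_kernels.induct)
  case (prod a b)
  have "(\<lambda>x y. partial_deriv j (\<lambda>x. a x * b y) x) = (\<lambda>x y. partial_deriv j a x * b y)"
    using prod by (simp add: fun_eq_iff partial_deriv_mult differentiable_trig_poly)
  then show ?case using prod by (simp add: trig_kernels.prod partial_deriv_trig_poly)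
next
  case (add F G)
  have "(\<lambda>x y. partial_deriv j (\<lambda>x. F x y + G x y) x) =
      (\<lambda>x y. partial_deriv j (\<lambda>x. F x y) x + partial_deriv j (\<lambda>x. G x y) x)"
    using add by (simp add: fun_eq_iff partial_deriv_add differentiable_trig_poly trig_kernels_fst)
  then show ?case using add by (simp add: trig_kernels.add)
qed

text \<open>Differentiation under the integral: in a product a(x) b(y) the integral of b f is merely
  a constant factor of a.\<close>

lemma partial_deriv_kernel_int:
  assumes "F \<in> trig_kernels" "integrable torus f"
  shows "partial_deriv j (kernel_int F f) = kernel_int (\<lambda>x y. partial_deriv j (\<lambda>x. F x y) x) f"
  using assms(1)
proof (induction rule: trig_kernels.induct)
  case (prod a b)
  have "(\<lambda>x y. partial_deriv j (\<lambda>x. a x * b y) x) = (\<lambda>x y. partial_deriv j a x * b y)"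
    using prod by (simp add: fun_eq_iff partial_deriv_mult differentiable_trig_poly)
  then show ?case
    using prod by (simp add: kernel_int_prod fun_eq_iff partial_deriv_cmult differentiable_trig_poly)
next
  case (add F G)
  have "(\<lambda>x y. partial_deriv j (\<lambda>x. F x y + G x y) x) =
      (\<lambda>x y. partial_deriv j (\<lambda>x. F x y) x + partial_deriv j (\<lambda>x. G x y) x)"
    using add by (simp add: fun_eq_iff partial_deriv_add differentiable_trig_poly trig_kernels_fst)
  then show ?case
    using add assms(2)
    by (simp add: kernel_int_add partial_deriv_kernel fun_eq_iff partial_deriv_add
        differentiable_trig_poly kernel_int_trig_poly)
qed

section \<open>Convolution on the torus\<close>

definition conv :: "(real ^ 'n::finite \<Rightarrow> real) \<Rightarrow> (real ^ 'n \<Rightarrow> real) \<Rightarrow> real ^ 'n \<Rightarrow> real" where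
  "conv K f x = (\<integral>y. K (x - y) * f y \<partial>torus)"

lemma conv_eq_kernel_int: "conv K f = kernel_int (\<lambda>x y. K (x - y)) f"
  by (simp add: conv_def kernel_int_def fun_eq_iff)

lemma conv_trig_poly: "K \<in> trig_polys \<Longrightarrow> integrable torus f \<Longrightarrow> conv K f \<in> trig_polys"
  by (simp add: conv_eq_kernel_int kernel_int_trig_poly trig_kernels_difference)

lemma partial_deriv_translate:
  assumes "K \<in> trig_polys"
  shows "partial_deriv j (\<lambda>x. K (x - y)) x = partial_deriv j K (x - y)"
proof -
  have "((\<lambda>x. K (x - y)) has_derivative (\<lambda>h. frechet_derivative K (at (x - y)) h)) (at x)"
    using differentiable_trig_poly[OF assms, of "x - y"] frechet_derivative_works
    by (intro has_derivative_compose[of "\<lambda>x. x - y" "\<lambda>h. h" x UNIV K, simplified])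
       (auto intro!: derivative_eq_intros)
  from partial_deriv_eqI[OF this] show ?thesis by (simp add: partial_deriv_def)
qed

lemma partial_deriv_reflect:
  assumes "K \<in> trig_polys"
  shows "partial_deriv j (\<lambda>y. K (x - y)) y = - partial_deriv j K (x - y)"
proof -
  have D: "(K has_derivative frechet_derivative K (at (x - y))) (at (x - y))"
    using differentiable_trig_poly[OF assms, of "x - y"] frechet_derivative_works by blast
  have "((\<lambda>y. K (x - y)) has_derivative (\<lambda>h. frechet_derivative K (at (x - y)) (- h))) (at y)"
    using D by (intro has_derivative_compose[of "\<lambda>y. x - y" "\<lambda>h. - h" y UNIV K, simplified])
       (auto intro!: derivative_eq_intros)
  from partial_deriv_eqI[OF this] show ?thesis
    by (simp add: partial_deriv_def linear_neg[OF has_derivative_linear[OF D]])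
qed

lemma partial_deriv_conv:
  "K \<in> trig_polys \<Longrightarrow> integrable torus f \<Longrightarrow> partial_deriv j (conv K f) = conv (partial_deriv j K) f"
  by (simp add: conv_eq_kernel_int partial_deriv_kernel_int trig_kernels_difference partial_deriv_translate)

text \<open>For even K the kernel K(x - y) is symmetric in x and y, so exchanging the integrations
  returns the same operator: mollification is self-adjoint.\<close>

lemma integral_conv_symmetric:
  assumes "K \<in> trig_polys" "\<And>x. K (- x) = K x" "integrable torus f" "integrable torus g"
  shows "(\<integral>x. g x * conv K f x \<partial>torus) = (\<integral>x. f x * conv K g x \<partial>torus)"
proof -
  have "K (x - y) = K (y - x)" for x y using assms(2)[of "x - y"] by simp
  then show ?thesis
    using integral_mult_kernel_int[OF trig_kernels_difference[OF assms(1)] assms(3,4)]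
    by (simp add: conv_eq_kernel_int) (simp add: kernel_int_def)
qed

lemma conv_diff:
  assumes "K \<in> trig_polys" "integrable torus f" "integrable torus g"
  shows "conv K (\<lambda>x. f x - g x) = (\<lambda>x. conv K f x - conv K g x)"
  using integrable_kernel[OF trig_kernels_difference[OF assms(1)] assms(2)]
    integrable_kernel[OF trig_kernels_difference[OF assms(1)] assms(3)]
  by (simp add: conv_def fun_eq_iff right_diff_distrib)

text \<open>The constant is sup |K| times the norm of 1. Since it does not depend on f, convolution
  turns convergence in L2 into uniform convergence, which gives the continuity in time of the
  trilinear terms.\<close>

lemma abs_conv_le:
  assumes "K \<in> trig_polys"
  obtains B where "B \<ge> 0" "\<And>f x. sq_integrable f \<Longrightarrow> \<bar>conv K f x\<bar> \<le> B * L2norm f"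
proof -
  obtain B where B: "B \<ge> 0" "\<And>x. \<bar>K x\<bar> \<le> B" using bounded_trig_poly[OF assms] by blast
  have "\<bar>conv K f x\<bar> \<le> B * L2norm (\<lambda>x :: real ^ 'a. 1) * L2norm f" if "sq_integrable f" for f x
  proof -
    have "\<bar>\<integral>y. 1 * f y * K (x - y) \<partial>torus\<bar> \<le> B * (L2norm (\<lambda>x :: real ^ 'a. 1) * L2norm f)"
      using that B assms
      by (intro abs_integral_triple_le) (auto intro!: sq_integrable_continuous
        borel_measurable_torus_trig_poly trig_polys_reflect)
    then show ?thesis by (simp add: conv_def mult_ac)
  qed
  then show thesis using that[of "B * L2norm (\<lambda>x :: real ^ 'a. 1)"] B(1) by simp
qed

text \<open>K is a probability density, so Jensen's inequality bounds the square of the convolution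
  by the convolution of the square. After integration K is moved to the constant 1, which it leaves
  unchanged.\<close>

lemma L2norm_conv_le:
  assumes K: "K \<in> trig_polys" "\<And>x. K (- x) = K x" "\<And>x. K x \<ge> 0" "(\<integral>x. K x \<partial>torus) = 1"
    and f: "sq_integrable f"
  shows "L2norm (conv K f) \<le> L2norm f"
proof -
  have one: "conv K (\<lambda>y. 1) = (\<lambda>x. 1)"
    using integral_torus_trig_poly_reflect[OF K(1,2)] K(4) by (simp add: conv_def fun_eq_iff)
  note fi = sq_integrable_imp_integrable[OF f]
  have f2: "integrable torus (\<lambda>x. (f x)\<^sup>2)" using f by (simp add: sq_integrable_def)
  have 1: "integrable torus (\<lambda>x::real^'a. 1 :: real)"
    by (intro integrable_torus_continuous) auto
  have ptw: "(conv K f x)\<^sup>2 \<le> conv K (\<lambda>y. (f y)\<^sup>2) x" for x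
  proof -
    \<comment> \<open>Jensen by hand: integrate 2 a f(y) \<le> a^2 + f(y)^2 against K(x - y), where
      a is the value of the convolution itself.\<close>
    define a where "a = conv K f x"
    note Kx = trig_polys_reflect[OF K(1), of x]
    have "2 * a * a = 2 * a * (\<integral>y. K (x - y) * f y \<partial>torus)"
      by (simp add: a_def conv_def)
    also have "\<dots> = (\<integral>y. K (x - y) * (2 * a * f y) \<partial>torus)"
      by (subst integral_mult_right_zero[symmetric]) (simp add: mult_ac)
    also have "\<dots> \<le> (\<integral>y. a\<^sup>2 * K (x - y) + K (x - y) * (f y)\<^sup>2 \<partial>torus)"
    proof (rule integral_mono)
      show "integrable torus (\<lambda>y. K (x - y) * (2 * a * f y))"
        by (rule integrable_mult_trig_poly(2)[OF _ Kx]) (simp add: fi)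
      show "integrable torus (\<lambda>y. a\<^sup>2 * K (x - y) + K (x - y) * (f y)\<^sup>2)"
        using integrable_mult_trig_poly(2)[OF f2 Kx] integrable_torus_trig_poly[OF Kx] by simp
      fix y
      have "K (x - y) * (2 * a * f y) \<le> K (x - y) * (a\<^sup>2 + (f y)\<^sup>2)"
        using sum_squares_bound[of a "f y"] K(3) by (intro mult_left_mono) auto
      then show "K (x - y) * (2 * a * f y) \<le> a\<^sup>2 * K (x - y) + K (x - y) * (f y)\<^sup>2"
        by (simp add: algebra_simps)
    qed
    also have "\<dots> = a\<^sup>2 * conv K (\<lambda>y. 1) x + conv K (\<lambda>y. (f y)\<^sup>2) x"
      using integrable_mult_trig_poly(2)[OF f2 Kx] integrable_torus_trig_poly[OF Kx]
      by (simp add: conv_def)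
    finally show ?thesis using one by (simp add: a_def power2_eq_square)
  qed
  have "(L2norm (conv K f))\<^sup>2 \<le> (\<integral>x. 1 * conv K (\<lambda>y. (f y)\<^sup>2) x \<partial>torus)"
    unfolding L2norm_sq using ptw
    by (intro integral_mono)
       (auto intro!: integrable_torus_trig_poly trig_polys_power conv_trig_poly K fi f2)
  also have "\<dots> = (L2norm f)\<^sup>2"
    by (subst integral_conv_symmetric[OF K(1,2) f2 1]) (simp add: one L2norm_sq)
  finally show ?thesis by (rule power2_le_imp_le) simp
qed

text \<open>By translation invariance the convolution of the reflected f with 1 is constant. Its
  derivative at 0, computed on the kernel, is the integral in question up to sign.\<close>

lemma integral_partial_deriv_trig_poly:
  assumes "f \<in> trig_polys"
  shows "(\<integral>x. partial_deriv j f x \<partial>torus) = 0"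
proof -
  have 1: "integrable torus (\<lambda>x::real^'a. 1 :: real)"
    by (intro integrable_torus_continuous) auto
  have g: "(\<lambda>y. f (0 - y)) \<in> trig_polys" by (rule trig_polys_reflect[OF assms])
  have "conv (partial_deriv j (\<lambda>y. f (0 - y))) (\<lambda>y. 1) 0 = partial_deriv j (conv (\<lambda>y. f (0 - y)) (\<lambda>y. 1)) 0"
    by (simp only: partial_deriv_conv[OF g 1])
  moreover have "(\<integral>y. f (y - x) \<partial>torus) = (\<integral>y. f y \<partial>torus)" for x
    using integral_torus_trig_poly_translate[OF assms, of "- x"] by simp
  then have "conv (\<lambda>y. f (0 - y)) (\<lambda>y. 1) = (\<lambda>x. \<integral>y. f y \<partial>torus)"
    by (simp add: conv_def fun_eq_iff)
  ultimately have "(\<integral>y. partial_deriv j (\<lambda>y. f (0 - y)) (- y) \<partial>torus) = 0"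
    by (simp add: conv_def)
  then show ?thesis using partial_deriv_reflect[OF assms, of j 0] by simp
qed

lemma integral_by_parts_trig_poly:
  assumes "f \<in> trig_polys" "g \<in> trig_polys"
  shows "(\<integral>x. f x * partial_deriv j g x \<partial>torus) = - (\<integral>x. partial_deriv j f x * g x \<partial>torus)"
proof -
  have "(\<integral>x. f x * partial_deriv j g x + partial_deriv j f x * g x \<partial>torus) = 0"
    using integral_partial_deriv_trig_poly[OF trig_polys.mult[OF assms], of j]
    by (simp add: partial_deriv_mult differentiable_trig_poly assms)
  then show ?thesis
    using assms by (simp add: integrable_torus_trig_poly trig_polys.mult partial_deriv_trig_poly)
qed

section \<open>Trigonometric mollifiers\<close>

text \<open>Nonnegative, with maximum 2N attained exactly where all coordinates are even integers.
  Hence 2N minus the bump at x - y is a trigonometric substitute for the squared distance on the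
  torus.\<close>

definition cos_bump :: "real ^ 'n::finite \<Rightarrow> real" where
  "cos_bump x = (\<Sum>i\<in>UNIV. 1 + cos (pi * x $ i))"

text \<open>Normalised powers concentrate where the bump is maximal; in dimension one these are the
  de la Vallee Poussin kernels. Unlike Dirichlet kernels they are nonnegative, as the one-sided
  condition and the contraction in L2 demand.\<close>

definition mollifier :: "nat \<Rightarrow> real ^ 'n::finite \<Rightarrow> real" where
  "mollifier m x = cos_bump x ^ m / (\<integral>y. cos_bump y ^ m \<partial>(torus :: (real ^ 'n) measure))"

lemma cos_bump_trig_poly: "cos_bump \<in> trig_polys"
proof -
  have "(\<lambda>x::real^'a. \<Sum>i\<in>UNIV. 1 + cos (pi * x $ i)) \<in> trig_polys"
    by (intro trig_polys_sum trig_polys.intros) auto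
  then show ?thesis by (simp add: cos_bump_def[abs_def])
qed

lemma cos_bump_even: "cos_bump (- x) = cos_bump x"
  by (simp add: cos_bump_def)

lemma one_plus_cos_nonneg: "1 + cos (y :: real) \<ge> 0"
  using cos_ge_minus_one[of y] by linarith

lemma cos_bump_nonneg: "cos_bump x \<ge> 0"
  unfolding cos_bump_def by (intro sum_nonneg one_plus_cos_nonneg)

lemma cos_bump_le: "cos_bump (x :: real ^ 'n::finite) \<le> 2 * real CARD('n)"
proof -
  have "1 + cos y \<le> 2" for y :: real using cos_le_one[of y] by linarith
  then have "cos_bump x \<le> (\<Sum>i\<in>(UNIV :: 'n set). 2)"
    unfolding cos_bump_def by (rule sum_mono)
  then show ?thesis by simp
qed

lemma cos_bump_0: "cos_bump (0 :: real ^ 'n::finite) = 2 * real CARD('n)"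
  by (simp add: cos_bump_def)

text \<open>The bump exceeds c on a ball around 0, and \<mu> is the volume of that ball; the point
  is that \<mu> does not depend on m.\<close>

lemma integral_cos_bump_power_lower:
  assumes "0 \<le> c" "c < 2 * real CARD('n::finite)"
  obtains \<mu> where "\<mu> > 0" "\<And>m. \<mu> * c ^ m \<le> (\<integral>x. cos_bump x ^ m \<partial>(torus :: (real ^ 'n) measure))"
proof -
  let ?U = "{x :: real ^ 'n. c < cos_bump x} \<inter> box (\<chi> i. - 1) (\<chi> i. 1)"
  have "open {x :: real ^ 'n. c < cos_bump x}"
    by (intro open_Collect_less continuous_on_const continuous_on_trig_poly cos_bump_trig_poly)
  then have "open ?U" by (intro open_Int open_box)
  moreover have "0 \<in> ?U"
    using assms(2) by (auto simp: cos_bump_0 mem_box_cart)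
  ultimately obtain r where r: "r > 0" "ball 0 r \<subseteq> ?U"
    by (meson open_contains_ball)
  let ?B = "ball (0 :: real ^ 'n) r"
  have Bcube: "?B \<subseteq> cube" using r(2) box_subset_cbox by blast
  define \<mu> where "\<mu> = measure lborel ?B"
  have \<mu>: "measure torus ?B = \<mu>"
    unfolding torus_def \<mu>_def using Bcube by (subst measure_restrict_space) auto
  have sB: "?B \<in> sets torus"
    unfolding torus_def using Bcube by (auto simp: sets_restrict_space_iff)
  have iB: "integrable torus (\<lambda>x. c ^ m * indicator ?B x)" for m
    using finite_measure.emeasure_finite[OF finite_measure_torus, of ?B] sB
    by (intro integrable_mult_right integrable_real_indicator) (auto simp: less_top)
  show thesis
  proof (rule that[of \<mu>])
    show "\<mu> > 0" using r(1) by (simp add: \<mu>_def content_ball_pos)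
    fix m
    have "\<mu> * c ^ m = (\<integral>x. c ^ m * indicator ?B x \<partial>torus)"
      using \<mu> sB sets.sets_into_space[OF sB] by (simp add: Int_absorb2)
    also have "\<dots> \<le> (\<integral>x. cos_bump x ^ m \<partial>(torus :: (real ^ 'n) measure))"
    proof (rule integral_mono)
      show "integrable torus (\<lambda>x :: real ^ 'n. cos_bump x ^ m)"
        by (intro integrable_torus_trig_poly trig_polys_power cos_bump_trig_poly)
      fix x :: "real ^ 'n"
      show "c ^ m * indicator ?B x \<le> cos_bump x ^ m"
      proof (cases "x \<in> ?B")
        case True
        then have "c \<le> cos_bump x" using r(2) by auto
        then show ?thesis using assms(1) True by (simp add: power_mono)
      qed (simp add: cos_bump_nonneg)
    qed (rule iB)
    finally show "\<mu> * c ^ m \<le> (\<integral>x. cos_bump x ^ m \<partial>(torus :: (real ^ 'n) measure))" .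
  qed
qed

lemma integral_cos_bump_power_pos:
  "(\<integral>x. cos_bump x ^ m \<partial>(torus :: (real ^ 'n::finite) measure)) > 0"
proof -
  have "1 < 2 * real CARD('n)" using zero_less_card_finite[where 'a='n] by linarith
  then obtain \<mu> where "\<mu> > 0" "\<And>m. \<mu> * 1 ^ m \<le> (\<integral>x. cos_bump x ^ m \<partial>(torus :: (real ^ 'n) measure))"
    by (rule integral_cos_bump_power_lower[where 'n='n and c=1, rotated]) simp_all
  then show ?thesis by (metis less_le_trans mult_1_right power_one)
qed

lemma mollifier_trig_poly: "mollifier m \<in> trig_polys"
proof -
  have "(\<lambda>x::real^'a. inverse (\<integral>y. cos_bump y ^ m \<partial>(torus :: (real ^ 'a) measure)) * cos_bump x ^ m) \<in> trig_polys"
    by (intro trig_polys_cmult trig_polys_power cos_bump_trig_poly)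
  then show ?thesis by (simp add: mollifier_def[abs_def] divide_inverse mult.commute)
qed

lemma mollifier_even: "mollifier m (- x) = mollifier m x"
  by (simp add: mollifier_def cos_bump_even)

lemma mollifier_nonneg: "mollifier m x \<ge> 0"
  by (simp add: mollifier_def cos_bump_nonneg integral_cos_bump_power_pos less_imp_le)

lemma integral_mollifier: "(\<integral>x. mollifier m x \<partial>(torus :: (real ^ 'n::finite) measure)) = 1"
  using integral_cos_bump_power_pos[where 'n='n and m=m] by (simp add: mollifier_def)

text \<open>Where the bump is at least 2N - d, the integrand is at most d times the kernel.
  Elsewhere the power is at most (2N - d)^m, while the normalising integral is at least a multiple
  of (2N - d/2)^m, so this part decays geometrically.\<close>

lemma mollifier_concentrates:
  "(\<lambda>m. \<integral>x. mollifier m x * (2 * real CARD('n) - cos_bump x) \<partial>(torus :: (real ^ 'n::finite) measure))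
     \<longlonglongrightarrow> 0"
proof (rule LIMSEQ_I)
  fix e :: real assume "e > 0"
  let ?N = "2 * real CARD('n)"
  let ?T = "torus :: (real ^ 'n) measure"
  \<comment> \<open>The value e / 2 leaves the other half of e for the geometric term; the second
    bound keeps the bases 2N - d and c positive.\<close>
  define d where "d = min (e / 2) (?N / 2)"
  have d: "d > 0" "d \<le> e / 2" "d < ?N" using \<open>e > 0\<close> by (auto simp: d_def min_less_iff_disj)
  define c where "c = ?N - d / 2"
  have "0 \<le> c" "c < ?N" using d by (auto simp: c_def)
  then obtain \<mu> where \<mu>: "\<mu> > 0" "\<And>m. \<mu> * c ^ m \<le> (\<integral>x. cos_bump x ^ m \<partial>?T)"
    using integral_cos_bump_power_lower[where 'n='n and c=c] by blast
  define V :: real where "V = (\<integral>x. 1 \<partial>?T)"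
  have V: "V \<ge> 0" by (simp add: V_def)
  define q where "q = (?N - d) / c"
  have q: "0 \<le> q" "q < 1" using d by (auto simp: q_def c_def)
  have est: "(\<integral>x. mollifier m x * (?N - cos_bump x) \<partial>?T) \<le> d + ?N * V / \<mu> * q ^ m" for m
  proof -
    define I where "I = (\<integral>x. cos_bump x ^ m \<partial>?T)"
    have I: "I > 0" "\<mu> * c ^ m \<le> I" unfolding I_def by (rule integral_cos_bump_power_pos) (rule \<mu>)
    note tp = trig_polys_power[OF cos_bump_trig_poly, of m]
    have "(\<integral>x. cos_bump x ^ m * (?N - cos_bump x) \<partial>?T) \<le> (\<integral>x. d * cos_bump x ^ m + ?N * (?N - d) ^ m * 1 \<partial>?T)"
    proof (rule integral_mono)
      show "integrable ?T (\<lambda>x. cos_bump x ^ m * (?N - cos_bump x))"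
        by (intro integrable_torus_trig_poly trig_polys.mult tp trig_polys_diff trig_polys.const cos_bump_trig_poly)
      show "integrable ?T (\<lambda>x. d * cos_bump x ^ m + ?N * (?N - d) ^ m * 1)"
        by (intro integrable_torus_trig_poly trig_polys.add trig_polys_cmult tp trig_polys.const)
      fix x :: "real ^ 'n"
      have Q: "0 \<le> cos_bump x" "cos_bump x \<le> ?N" by (rule cos_bump_nonneg) (rule cos_bump_le)
      show "cos_bump x ^ m * (?N - cos_bump x) \<le> d * cos_bump x ^ m + ?N * (?N - d) ^ m * 1"
      proof (cases "cos_bump x \<ge> ?N - d")
        case True
        then have "cos_bump x ^ m * (?N - cos_bump x) \<le> cos_bump x ^ m * d"
          using Q by (intro mult_left_mono) auto
        moreover have "?N * (?N - d) ^ m \<ge> 0" using d by simp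
        ultimately show ?thesis by (simp add: mult.commute)
      next
        case False
        then have "cos_bump x ^ m * (?N - cos_bump x) \<le> (?N - d) ^ m * ?N"
          using Q d by (intro mult_mono power_mono) auto
        moreover have "d * cos_bump x ^ m \<ge> 0" using d Q by simp
        ultimately show ?thesis by (simp add: mult.commute)
      qed
    qed
    also have "\<dots> = d * I + ?N * (?N - d) ^ m * V"
    proof -
      have "(\<integral>x. d * cos_bump x ^ m + b * 1 \<partial>?T) = d * I + b * V" for b
        unfolding I_def V_def
        using integrable_torus_trig_poly[OF trig_polys_cmult[OF tp, of d]]
          integrable_torus_trig_poly[OF trig_polys.const[of b]]
        by (subst Bochner_Integration.integral_add) simp_all
      then show ?thesis .
    qed
    finally have "(\<integral>x. cos_bump x ^ m * (?N - cos_bump x) \<partial>?T) / I \<le> d + ?N * V * (?N - d) ^ m / I"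
      using I(1) by (simp add: field_simps)
    also have "?N * V * (?N - d) ^ m / I \<le> ?N * V * (?N - d) ^ m / (\<mu> * c ^ m)"
      using I \<mu>(1) V d \<open>0 \<le> c\<close>
      by (intro divide_left_mono) (auto simp: c_def intro!: mult_nonneg_nonneg)
    also have "\<dots> = ?N * V / \<mu> * q ^ m" by (simp add: q_def power_divide)
    finally show ?thesis by (simp add: mollifier_def I_def)
  qed
  have "(\<lambda>m. ?N * V / \<mu> * q ^ m) \<longlonglongrightarrow> ?N * V / \<mu> * 0"
    using q by (intro tendsto_mult tendsto_const LIMSEQ_realpow_zero) auto
  then have "\<forall>\<^sub>F m in sequentially. ?N * V / \<mu> * q ^ m < e / 2"
    using \<open>e > 0\<close> by (intro order_tendstoD) auto
  then obtain M where M: "\<And>m. m \<ge> M \<Longrightarrow> ?N * V / \<mu> * q ^ m < e / 2"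
    by (auto simp: eventually_sequentially)
  have nn: "(\<integral>x. mollifier m x * (?N - cos_bump x) \<partial>?T) \<ge> 0" for m
    using cos_bump_le[where 'n='n] by (intro Bochner_Integration.integral_nonneg) (simp add: mollifier_nonneg)
  show "\<exists>M. \<forall>m\<ge>M. norm ((\<integral>x. mollifier m x * (?N - cos_bump x) \<partial>?T) - 0) < e"
  proof (intro exI allI impI)
    fix m assume "m \<ge> M"
    then show "norm ((\<integral>x. mollifier m x * (?N - cos_bump x) \<partial>?T) - 0) < e"
      using M[of m] est[of m] d(2) nn[of m] by simp
  qed
qed

text \<open>At the maximum all coordinates of x - y are even integers. In the cube, coordinates that
  differ then do so by exactly 2, which puts the points on opposite faces.\<close>

lemma cos_bump_eq_max_imp:
  assumes "cos_bump (x - y :: real ^ 'n::finite) = 2 * real CARD('n)"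
    and "x \<in> cube" "y \<in> cube" "x \<noteq> y"
  obtains i where "\<bar>x $ i\<bar> = 1" "\<bar>y $ i\<bar> = 1"
proof -
  obtain i where i: "x $ i \<noteq> y $ i" using assms(4) by (auto simp: vec_eq_iff)
  have "(\<Sum>i\<in>UNIV. 1 - cos (pi * (x - y) $ i)) = 0"
    using assms(1) by (simp add: cos_bump_def sum_subtractf sum.distrib)
  then have "cos (pi * (x $ i - y $ i)) = 1"
    by (subst (asm) sum_nonneg_eq_0_iff) auto
  then obtain n :: int where "pi * (x $ i - y $ i) = of_int n * 2 * pi"
    unfolding cos_one_2pi_int by blast
  then have n: "x $ i - y $ i = 2 * of_int n" by simp
  have b: "- 1 \<le> x $ i" "x $ i \<le> 1" "- 1 \<le> y $ i" "y $ i \<le> 1"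
    using assms(2,3) by (auto simp: mem_box_cart)
  have "n \<noteq> 0" using n i by auto
  then have "\<bar>x $ i - y $ i\<bar> \<ge> 2" unfolding n by simp
  then show thesis using b by (intro that[of i]) auto
qed

text \<open>A modulus of continuity in terms of the bump. The pairs with |g y - g x| \<ge> e form a
  compact set, on which 2N minus the bump is positive and hence at least some d > 0. The zeros on
  the faces matter because the bump cannot tell opposite faces apart.\<close>

lemma approx_by_cos_bump:
  fixes g :: "real ^ 'n::finite \<Rightarrow> real"
  assumes g: "continuous_on UNIV g"
    and g0: "\<forall>x\<in>cube. \<forall>i. \<bar>x $ i\<bar> = 1 \<longrightarrow> g x = 0"
    and "e > 0"
  obtains c where "c \<ge> 0"
    "\<And>x y. x \<in> cube \<Longrightarrow> y \<in> cube \<Longrightarrow>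
       \<bar>g y - g x\<bar> \<le> e + c * (2 * real CARD('n) - cos_bump (x - y))"
proof -
  let ?N = "2 * real CARD('n)"
  let ?C = "cube :: (real ^ 'n) set"
  let ?S = "(?C \<times> ?C) \<inter> {z. \<bar>g (snd z) - g (fst z)\<bar> \<ge> e}"
  have gc: "continuous_on A (\<lambda>z. g (fst z))" "continuous_on A (\<lambda>z. g (snd z))" for A :: "((real^'n) \<times> (real^'n)) set"
    by (auto intro!: continuous_on_compose2[OF g] continuous_intros)
  have "compact (g ` ?C)"
    by (intro compact_continuous_image continuous_on_subset[OF g]) auto
  then have "bounded (g ` ?C)" by (rule compact_imp_bounded)
  then obtain M where "\<forall>y\<in>g ` ?C. \<bar>y\<bar> \<le> M" unfolding bounded_real by (elim exE)
  then have M: "\<bar>g x\<bar> \<le> M" if "x \<in> ?C" for x using that by simp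
  have "0 \<in> ?C" by (auto simp: mem_box_cart)
  then have "M \<ge> 0" using M[of 0] by linarith
  have "compact ?S"
    by (intro compact_Int_closed compact_Times compact_cbox closed_Collect_le continuous_intros gc)
  moreover have "continuous_on ?S (\<lambda>z. ?N - cos_bump (fst z - snd z))"
    by (intro continuous_intros continuous_on_compose2[OF continuous_on_trig_poly[OF cos_bump_trig_poly, of UNIV]]) auto
  ultimately have att: "?S \<noteq> {} \<Longrightarrow> \<exists>z\<in>?S. \<forall>z'\<in>?S. ?N - cos_bump (fst z - snd z) \<le> ?N - cos_bump (fst z' - snd z')"
    by (intro continuous_attains_inf) auto
  have pos: "?N - cos_bump (fst z - snd z) > 0" if z: "z \<in> ?S" for z
  proof (rule ccontr)
    assume "\<not> ?N - cos_bump (fst z - snd z) > 0"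
    then have "cos_bump (fst z - snd z) = ?N" using cos_bump_le[of "fst z - snd z"] by simp
    moreover have "fst z \<noteq> snd z" using that \<open>e > 0\<close> by auto
    ultimately obtain i where "\<bar>fst z $ i\<bar> = 1" "\<bar>snd z $ i\<bar> = 1"
      using cos_bump_eq_max_imp[of "fst z" "snd z"] IntD1[OF z] unfolding mem_Times_iff by blast
    then have "g (fst z) = 0" "g (snd z) = 0" using that g0 by auto
    then show False using that \<open>e > 0\<close> by auto
  qed
  obtain d where d: "d > 0" "\<And>z. z \<in> ?S \<Longrightarrow> d \<le> ?N - cos_bump (fst z - snd z)"
  proof (cases "?S = {}")
    case True then show thesis using that[of 1] by auto
  next
    case False
    from att[OF this] obtain z where z: "z \<in> ?S"
      "\<forall>z'\<in>?S. ?N - cos_bump (fst z - snd z) \<le> ?N - cos_bump (fst z' - snd z')" by blast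
    show thesis using that[OF pos[OF z(1)]] z(2) by blast
  qed
  show thesis
  \<comment> \<open>On the bad pairs the oscillation of g is at most 2 M and 2N minus the bump is at
    least d.\<close>
  proof (rule that[of "2 * M / d"])
    show "2 * M / d \<ge> 0" using d \<open>M \<ge> 0\<close> by simp
    fix x y assume xy: "x \<in> ?C" "y \<in> ?C"
    have nn: "?N - cos_bump (x - y) \<ge> 0" using cos_bump_le[of "x - y"] by simp
    show "\<bar>g y - g x\<bar> \<le> e + 2 * M / d * (?N - cos_bump (x - y))"
    proof (cases "\<bar>g y - g x\<bar> \<ge> e")
      case True
      then have "d \<le> ?N - cos_bump (x - y)" using d(2)[of "(x, y)"] xy by simp
      then have "2 * M / d * d \<le> 2 * M / d * (?N - cos_bump (x - y))"
        using d(1) \<open>M \<ge> 0\<close> by (intro mult_left_mono) auto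
      moreover have "\<bar>g y - g x\<bar> \<le> 2 * M" using M[OF xy(1)] M[OF xy(2)] by linarith
      ultimately show ?thesis using d(1) \<open>e > 0\<close> by simp
    next
      case False
      then show ?thesis using nn d(1) \<open>M \<ge> 0\<close>
        by (smt (verit) divide_nonneg_pos mult_nonneg_nonneg)
    qed
  qed
qed

text \<open>Averaging the estimate of \<open>approx_by_cos_bump\<close> with the kernel bounds the
  error, uniformly on the cube, by e plus c times the integral in
  \<open>mollifier_concentrates\<close>.\<close>

lemma conv_mollifier_tendsto_continuous:
  fixes g :: "real ^ 'n::finite \<Rightarrow> real"
  assumes g: "continuous_on UNIV g"
    and g0: "\<forall>x\<in>cube. \<forall>i. \<bar>x $ i\<bar> = 1 \<longrightarrow> g x = 0"
  shows "(\<lambda>m. L2dist (conv (mollifier m) g) g) \<longlonglongrightarrow> 0"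
proof (rule LIMSEQ_I)
  fix r :: real assume "r > 0"
  let ?N = "2 * real CARD('n)"
  let ?T = "torus :: (real ^ 'n) measure"
  define L where "L = L2norm (\<lambda>x :: real ^ 'n. 1)"
  define e where "e = r / (2 * (L + 1))"
  have L: "L \<ge> 0" by (simp add: L_def)
  then have e: "e > 0" "2 * e * L < r" using \<open>r > 0\<close> by (auto simp: e_def field_simps)
  obtain c where c: "c \<ge> 0"
    "\<And>x y. x \<in> space ?T \<Longrightarrow> y \<in> space ?T \<Longrightarrow> \<bar>g y - g x\<bar> \<le> e + c * (?N - cos_bump (x - y))"
    unfolding space_torus using approx_by_cos_bump[OF g g0 e(1)] by blast
  note ig = integrable_torus_continuous[OF g]
  let ?\<rho> = "\<lambda>m. \<integral>x. mollifier m x * (?N - cos_bump x) \<partial>?T"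
  have est: "\<bar>conv (mollifier m) g x - g x\<bar> \<le> e + c * ?\<rho> m" if x: "x \<in> space ?T" for m x
  proof -
    note Kx = trig_polys_reflect[OF mollifier_trig_poly, of m x]
    have w: "(\<lambda>x. mollifier m x * (?N - cos_bump x)) \<in> trig_polys"
      by (intro trig_polys.mult trig_polys_diff mollifier_trig_poly trig_polys.const cos_bump_trig_poly)
    note wx = trig_polys_reflect[OF w, of x]
    have "(\<integral>y. mollifier m (x - y) \<partial>?T) = 1"
      using integral_torus_trig_poly_reflect[OF mollifier_trig_poly mollifier_even] integral_mollifier by metis
    then have "conv (mollifier m) g x - g x = (\<integral>y. mollifier m (x - y) * (g y - g x) \<partial>?T)"
      using integrable_mult_trig_poly(2)[OF ig Kx] integrable_torus_trig_poly[OF Kx]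
      by (simp add: conv_def right_diff_distrib)
    then have "\<bar>conv (mollifier m) g x - g x\<bar> \<le> (\<integral>y. \<bar>mollifier m (x - y) * (g y - g x)\<bar> \<partial>?T)"
      by (metis integral_abs_bound)
    also have "\<dots> \<le> (\<integral>y. e * mollifier m (x - y) + c * (mollifier m (x - y) * (?N - cos_bump (x - y))) \<partial>?T)"
    proof (rule integral_mono)
      have "integrable ?T (\<lambda>y. g y - g x)"
        using g by (intro integrable_torus_continuous continuous_intros)
      then show "integrable ?T (\<lambda>y. \<bar>mollifier m (x - y) * (g y - g x)\<bar>)"
        by (intro integrable_abs integrable_mult_trig_poly(2) Kx)
      show "integrable ?T (\<lambda>y. e * mollifier m (x - y) + c * (mollifier m (x - y) * (?N - cos_bump (x - y))))"
        by (intro integrable_torus_trig_poly trig_polys.add trig_polys_cmult Kx wx)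
      fix y assume "y \<in> space ?T"
      from mult_left_mono[OF c(2)[OF x this] mollifier_nonneg[of m "x - y"]]
      show "\<bar>mollifier m (x - y) * (g y - g x)\<bar> \<le> e * mollifier m (x - y) + c * (mollifier m (x - y) * (?N - cos_bump (x - y)))"
        by (simp add: abs_mult mollifier_nonneg distrib_left mult.left_commute mult.commute[of e])
    qed
    also have "\<dots> = e * (\<integral>y. mollifier m (x - y) \<partial>?T) + c * (\<integral>y. mollifier m (x - y) * (?N - cos_bump (x - y)) \<partial>?T)"
      using integrable_torus_trig_poly[OF Kx] integrable_torus_trig_poly[OF wx] by simp
    also have "(\<integral>y. mollifier m (x - y) * (?N - cos_bump (x - y)) \<partial>?T) = ?\<rho> m"
      by (rule integral_torus_trig_poly_reflect[OF w]) (simp add: mollifier_even cos_bump_even)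
    finally show ?thesis using \<open>(\<integral>y. mollifier m (x - y) \<partial>?T) = 1\<close> by simp
  qed
  have \<rho>0: "?\<rho> m \<ge> 0" for m
    using cos_bump_le[where 'n='n] by (intro Bochner_Integration.integral_nonneg) (simp add: mollifier_nonneg)
  have "(\<lambda>m. c * ?\<rho> m) \<longlonglongrightarrow> c * 0"
    by (intro tendsto_mult tendsto_const mollifier_concentrates)
  then have "\<forall>\<^sub>F m in sequentially. c * ?\<rho> m < e"
    using e by (intro order_tendstoD) auto
  then obtain M where M: "\<And>m. m \<ge> M \<Longrightarrow> c * ?\<rho> m < e"
    by (auto simp: eventually_sequentially)
  show "\<exists>M. \<forall>m\<ge>M. norm (L2dist (conv (mollifier m) g) g - 0) < r"
  proof (intro exI allI impI)
    fix m assume "m \<ge> M"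
    have "L2dist (conv (mollifier m) g) g \<le> (e + c * ?\<rho> m) * L"
      unfolding L_def
      using est e(1) c(1) \<rho>0[of m]
      by (intro L2norm_le_bound sq_integrable_diff sq_integrable_trig_poly conv_trig_poly
          mollifier_trig_poly ig sq_integrable_continuous g) auto
    also have "\<dots> \<le> 2 * e * L" using M[OF \<open>m \<ge> M\<close>] L by (intro mult_right_mono) auto
    finally show "norm (L2dist (conv (mollifier m) g) g - 0) < r" using e(2) by simp
  qed
qed

section \<open>Density of continuous functions in L2 and convergence of mollifications\<close>

lemma L2norm_dominated_convergence:
  fixes f :: "real ^ 'n::finite \<Rightarrow> real"
  assumes f: "sq_integrable f" and s: "\<And>n. sq_integrable (s n)" and w: "sq_integrable w"
    and lim: "AE x in torus. (\<lambda>n. s n x) \<longlonglongrightarrow> f x"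
    and bound: "\<And>n. AE x in torus. \<bar>s n x\<bar> \<le> w x"
  shows "(\<lambda>n. L2dist f (s n)) \<longlonglongrightarrow> 0"
proof -
  have "(\<lambda>n. \<integral>x. (f x - s n x)\<^sup>2 \<partial>torus) \<longlonglongrightarrow> (\<integral>x. 0 \<partial>(torus :: (real ^ 'n) measure))"
  proof (rule integral_dominated_convergence)
    show "integrable torus (\<lambda>x. 2 * (f x)\<^sup>2 + 2 * (w x)\<^sup>2)"
      using f w by (simp add: sq_integrable_def)
    show "AE x in torus. (\<lambda>n. (f x - s n x)\<^sup>2) \<longlonglongrightarrow> 0"
      using lim
    proof eventually_elim
      case (elim x)
      then have "(\<lambda>n. (f x - s n x)\<^sup>2) \<longlonglongrightarrow> (f x - f x)\<^sup>2" by (intro tendsto_intros)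
      then show ?case by simp
    qed
    show "AE x in torus. norm ((f x - s n x)\<^sup>2) \<le> 2 * (f x)\<^sup>2 + 2 * (w x)\<^sup>2" for n
      using bound[of n]
    proof eventually_elim
      case (elim x)
      have "(s n x)\<^sup>2 \<le> (w x)\<^sup>2" using power_mono[OF elim, of 2] by simp
      moreover have "(f x - s n x)\<^sup>2 + (f x + s n x)\<^sup>2 = 2 * (f x)\<^sup>2 + 2 * (s n x)\<^sup>2"
        by (simp add: power2_eq_square algebra_simps)
      ultimately have "(f x - s n x)\<^sup>2 \<le> 2 * (f x)\<^sup>2 + 2 * (w x)\<^sup>2"
        using zero_le_power2[of "f x + s n x"] by linarith
      then show ?case by simp
    qed
    show "(\<lambda>x. (f x - s n x)\<^sup>2) \<in> borel_measurable torus" for n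
      using f s[of n] sq_integrable_diff[of f "s n"] by (intro borel_measurable_power) (simp add: sq_integrable_def)
  qed simp
  then have "(\<lambda>n. \<integral>x. (f x - s n x)\<^sup>2 \<partial>torus) \<longlonglongrightarrow> 0" by simp
  from tendsto_real_sqrt[OF this] show ?thesis by (simp add: L2norm_def)
qed

text \<open>The boundary of the cube is negligible, so exceptional behaviour on the faces is
  harmless.\<close>

lemma AE_torusI:
  fixes P :: "real ^ 'n::finite \<Rightarrow> bool"
  assumes "negligible N" "\<And>x. x \<in> box (\<chi> i. - 1) (\<chi> i. 1) \<Longrightarrow> x \<notin> N \<Longrightarrow> P x"
  shows "AE x in torus. P x"
proof -
  let ?C = "cube :: (real ^ 'n) set"
  have "negligible (frontier ?C)" by (intro negligible_convex_frontier convex_box)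
  then have "negligible (N \<union> frontier ?C)" using assms(1) by (rule negligible_Un[rotated])
  then have "AE x in lebesgue. x \<notin> N \<union> frontier ?C"
    by (intro AE_not_in) (simp add: negligible_iff_null_sets)
  then have "AE x in lebesgue. x \<in> ?C \<longrightarrow> P x"
  proof eventually_elim
    case (elim x)
    then show ?case
      using assms(2)[of x] by (auto simp: frontier_def interior_cbox)
  qed
  then show ?thesis unfolding torus_def by (subst AE_restrict_space_iff) auto
qed

lemma abs_clamp_le:
  fixes k y :: real
  assumes "k \<ge> 0"
  shows "\<bar>max (- k) (min k y)\<bar> \<le> k" "\<bar>max (- k) (min k y)\<bar> \<le> \<bar>y\<bar>"
  using assms by linarith+

text \<open>First f is clamped to [-k, k]. Continuous functions converging to f almost everywhere
  are clamped in the same way and cut off near the faces, so that the constant k dominates them.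
  Both errors vanish by dominated convergence.\<close>

lemma continuous_L2_dense:
  fixes f :: "real ^ 'n::finite \<Rightarrow> real"
  assumes f: "sq_integrable f" and e: "e > 0"
  obtains g where "continuous_on UNIV g" "L2dist f g < e"
    "\<forall>x\<in>cube. \<forall>i. \<bar>x $ i\<bar> = 1 \<longrightarrow> g x = 0"
proof -
  let ?C = "cube :: (real ^ 'n) set"
  define fk where "fk k x = max (- real k) (min (real k) (f x))" for k x
  note fm = sq_integrable_measurable[OF f]
  have fkm: "fk k \<in> borel_measurable torus" for k
    unfolding fk_def using fm by (intro borel_measurable_max borel_measurable_min) auto
  have fabs: "sq_integrable (\<lambda>x. \<bar>f x\<bar>)"
    using f fm borel_measurable_abs[OF fm] by (simp add: sq_integrable_def)
  have fk: "sq_integrable (fk k)" for k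
    unfolding sq_integrable_def
  proof (rule conjI[OF fkm Bochner_Integration.integrable_bound[of torus "\<lambda>x. (f x)\<^sup>2"]])
    show "integrable torus (\<lambda>x. (f x)\<^sup>2)" using f by (simp add: sq_integrable_def)
    have "(fk k x)\<^sup>2 \<le> (f x)\<^sup>2" for x
      using abs_clamp_le(2)[of "real k" "f x"] unfolding fk_def by (simp add: abs_le_square_iff)
    then show "AE x in torus. norm ((fk k x)\<^sup>2) \<le> norm ((f x)\<^sup>2)" by simp
  qed (use fkm in simp)
  have "(\<lambda>k. L2dist f (fk k)) \<longlonglongrightarrow> 0"
  proof (rule L2norm_dominated_convergence[OF f fk fabs])
    have "(\<lambda>k. fk k x) \<longlonglongrightarrow> f x" for x
    proof (rule tendsto_eventually, unfold eventually_sequentially, intro exI allI impI)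
      fix k assume "nat \<lceil>\<bar>f x\<bar>\<rceil> \<le> k"
      then have "\<bar>f x\<bar> \<le> real k" by linarith
      then show "fk k x = f x" by (auto simp: fk_def)
    qed
    then show "AE x in torus. (\<lambda>k. fk k x) \<longlonglongrightarrow> f x" by simp
    show "AE x in torus. \<bar>fk k x\<bar> \<le> \<bar>f x\<bar>" for k
      by (simp add: fk_def abs_clamp_le)
  qed
  from order_tendstoD(2)[OF this, of "e / 2"] e
  have "\<forall>\<^sub>F k in sequentially. L2dist f (fk k) < e / 2" by simp
  then obtain k where k: "L2dist f (fk k) < e / 2"
    by (meson eventually_happens' sequentially_bot)
  have "(\<lambda>x. if x \<in> ?C then f x else 0) \<in> borel_measurable lebesgue"
    using fm unfolding torus_def by (intro borel_measurable_if_I) auto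
  then have "(\<lambda>x. if x \<in> ?C then f x else 0) measurable_on UNIV"
    by (intro lebesgue_measurable_imp_measurable_on_real) auto
  then obtain N g where N: "negligible N" and g: "\<And>n. continuous_on UNIV (g n)"
    and glim: "\<And>x. x \<notin> N \<Longrightarrow> (\<lambda>n. g n x) \<longlonglongrightarrow> (if x \<in> ?C then f x else 0)"
    unfolding measurable_on_def by auto
  \<comment> \<open>Positive inside the cube and 0 on the faces: the factor min 1 (n p) is
    continuous, is eventually 1 at each interior point, and forces the zeros on the faces.\<close>
  define p where "p x = (\<Prod>i\<in>UNIV. 1 - (x $ i)\<^sup>2)" for x :: "real ^ 'n"
  define h where "h n x = max (- real k) (min (real k) (g n x)) * min 1 (real n * p x)" for n x
  have pc: "continuous_on UNIV p" unfolding p_def by (intro continuous_intros)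
  have hc: "continuous_on UNIV (h n)" for n
    unfolding h_def by (intro continuous_intros g pc)
  have ppos: "p x > 0" if "x \<in> box (\<chi> i. - 1) (\<chi> i. 1)" for x
  proof -
    have "(x $ i)\<^sup>2 < 1" for i
    proof -
      have "- 1 < x $ i" "x $ i < 1" using that by (auto simp: mem_box_cart)
      then show ?thesis by (intro abs_square_less_1[THEN iffD2]) linarith
    qed
    then show ?thesis unfolding p_def by (intro prod_pos) auto
  qed
  have "(\<lambda>n. L2dist (fk k) (h n)) \<longlonglongrightarrow> 0"
  proof (rule L2norm_dominated_convergence[OF fk, where w = "\<lambda>x. real k"])
    show "AE x in torus. (\<lambda>n. h n x) \<longlonglongrightarrow> fk k x"
    proof (rule AE_torusI[OF N])
      fix x assume x: "x \<in> box (\<chi> i. - 1) (\<chi> i. 1)" "x \<notin> N"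
      have "(\<lambda>n. g n x) \<longlonglongrightarrow> f x" using glim[OF x(2)] subsetD[OF box_subset_cbox x(1)] by simp
      moreover have "(\<lambda>n. min 1 (real n * p x)) \<longlonglongrightarrow> 1"
      proof (rule tendsto_eventually, unfold eventually_sequentially, intro exI allI impI)
        fix n assume "nat \<lceil>1 / p x\<rceil> \<le> n"
        then have "1 / p x \<le> real n" by linarith
        then show "min 1 (real n * p x) = 1" using ppos[OF x(1)] by (simp add: field_simps)
      qed
      ultimately have "(\<lambda>n. h n x) \<longlonglongrightarrow> max (- real k) (min (real k) (f x)) * 1"
        unfolding h_def by (intro tendsto_intros)
      then show "(\<lambda>n. h n x) \<longlonglongrightarrow> fk k x" by (simp add: fk_def)
    qed
    show "AE x in torus. \<bar>h n x\<bar> \<le> real k" for n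
    proof (rule AE_torusI[of "{}"])
      fix x :: "real ^ 'n" assume "x \<in> box (\<chi> i. - 1) (\<chi> i. 1)"
      then have "\<bar>min 1 (real n * p x)\<bar> \<le> 1" using ppos[of x] by auto
      then have "\<bar>h n x\<bar> \<le> real k * 1"
        unfolding h_def abs_mult by (intro mult_mono abs_clamp_le) auto
      then show "\<bar>h n x\<bar> \<le> real k" by simp
    qed simp
  qed (auto intro: sq_integrable_continuous hc)
  from order_tendstoD(2)[OF this, of "e / 2"] e
  have "\<forall>\<^sub>F n in sequentially. L2dist (fk k) (h n) < e / 2" by simp
  then obtain n where n: "L2dist (fk k) (h n) < e / 2"
    by (meson eventually_happens' sequentially_bot)
  show thesis
  proof (rule that[OF hc[of n]])
    show "L2dist f (h n) < e"
      using L2norm_diff_triangle[OF f fk[of k] sq_integrable_continuous[OF hc[of n]]] k n by linarith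
    show "\<forall>x\<in>?C. \<forall>i. \<bar>x $ i\<bar> = 1 \<longrightarrow> h n x = 0"
    proof (intro ballI allI impI)
      fix x :: "real ^ 'n" and i assume "\<bar>x $ i\<bar> = 1"
      then have "(x $ i)\<^sup>2 = 1" by (metis one_power2 power2_abs)
      then have "p x = 0" unfolding p_def by (intro prod_zero) auto
      then show "h n x = 0" by (simp add: h_def)
    qed
  qed
qed

lemma L2norm_conv_mollifier_le: "sq_integrable f \<Longrightarrow> L2norm (conv (mollifier m) f) \<le> L2norm f"
  by (intro L2norm_conv_le mollifier_trig_poly mollifier_even mollifier_nonneg integral_mollifier)

lemma sq_integrable_conv_mollifier: "sq_integrable f \<Longrightarrow> sq_integrable (conv (mollifier m) f)"
  by (rule sq_integrable_trig_poly[OF conv_trig_poly[OF mollifier_trig_poly sq_integrable_imp_integrable]])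

text \<open>The contraction property makes the error of replacing f by a nearby continuous g
  independent of m, which carries the convergence from the dense class to all of L2.\<close>

lemma conv_mollifier_tendsto:
  assumes f: "sq_integrable f"
  shows "(\<lambda>m. L2dist (conv (mollifier m) f) f) \<longlonglongrightarrow> 0"
proof (rule LIMSEQ_I)
  fix r :: real assume "r > 0"
  obtain g where g: "continuous_on UNIV g" "L2dist f g < r / 3"
    "\<forall>x\<in>cube. \<forall>i. \<bar>x $ i\<bar> = 1 \<longrightarrow> g x = 0"
    using continuous_L2_dense[OF f, of "r / 3"] \<open>r > 0\<close> by auto
  note gs = sq_integrable_continuous[OF g(1)]
  have "\<forall>\<^sub>F m in sequentially. L2dist (conv (mollifier m) g) g < r / 3"
    using conv_mollifier_tendsto_continuous[OF g(1,3)] \<open>r > 0\<close> by (intro order_tendstoD) auto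
  then obtain M where M: "\<And>m. m \<ge> M \<Longrightarrow> L2dist (conv (mollifier m) g) g < r / 3"
    by (auto simp: eventually_sequentially)
  show "\<exists>M. \<forall>m\<ge>M. norm (L2dist (conv (mollifier m) f) f - 0) < r"
  proof (intro exI allI impI)
    fix m assume "m \<ge> M"
    note c = sq_integrable_conv_mollifier[of _ m]
    have "L2dist (conv (mollifier m) f) f \<le>
        L2dist (conv (mollifier m) f) (conv (mollifier m) g) + L2dist (conv (mollifier m) g) f"
      by (intro L2norm_diff_triangle c f gs)
    also have "L2dist (conv (mollifier m) g) f \<le>
        L2dist (conv (mollifier m) g) g + L2dist g f"
      by (intro L2norm_diff_triangle c f gs)
    also have "L2dist (conv (mollifier m) f) (conv (mollifier m) g) = L2norm (conv (mollifier m) (\<lambda>x. f x - g x))"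
      using conv_diff[OF mollifier_trig_poly[of m] sq_integrable_imp_integrable[OF f] sq_integrable_imp_integrable[OF gs]] by simp
    also have "\<dots> \<le> L2dist f g"
      by (intro L2norm_conv_mollifier_le sq_integrable_diff f gs)
    finally show "norm (L2dist (conv (mollifier m) f) f - 0) < r"
      using g(2) M[OF \<open>m \<ge> M\<close>] L2norm_minus_commute[of f g] by simp
  qed
qed

section \<open>Divergence free fields with one-sided bounded symmetric gradient\<close>

text \<open>Vector fields are treated as families of component functions.\<close>

abbreviation mollify :: "nat \<Rightarrow> (real ^ 'n::finite \<Rightarrow> real) \<Rightarrow> real ^ 'n \<Rightarrow> real" where
  "mollify m \<equiv> conv (mollifier m)"

definition mgrad :: "nat \<Rightarrow> ('n \<Rightarrow> real ^ 'n::finite \<Rightarrow> real) \<Rightarrow> 'n \<Rightarrow> 'n \<Rightarrow> real ^ 'n \<Rightarrow> real" where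
  "mgrad m v i j = partial_deriv j (mollify m (v i))"

definition mstrain :: "nat \<Rightarrow> ('n \<Rightarrow> real ^ 'n::finite \<Rightarrow> real) \<Rightarrow> 'n \<Rightarrow> 'n \<Rightarrow> real ^ 'n \<Rightarrow> real" where
  "mstrain m v i j x = mgrad m v i j x + mgrad m v j i x"

text \<open>Trigonometric test functions suffice for the sequel because the reflected kernels y to
  \<open>mollifier m (x - y)\<close> are among them.\<close>

definition div_free :: "('n \<Rightarrow> real ^ 'n::finite \<Rightarrow> real) \<Rightarrow> bool" where
  "div_free v \<longleftrightarrow> (\<forall>P\<in>trig_polys. (\<Sum>j\<in>UNIV. \<integral>x. v j x * partial_deriv j P x \<partial>torus) = 0)"

text \<open>After integration by parts this says that the quadratic form of the distributional
  gradient of v is at least - C times |\<zeta>|^2.\<close>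

definition one_sided :: "('n \<Rightarrow> real ^ 'n::finite \<Rightarrow> real) \<Rightarrow> real \<Rightarrow> bool" where
  "one_sided v C \<longleftrightarrow> (\<forall>\<zeta> :: real ^ 'n. \<forall>P\<in>trig_polys. (\<forall>x. P x \<ge> 0) \<longrightarrow>
     (\<Sum>i\<in>UNIV. \<Sum>j\<in>UNIV. \<zeta> $ i * \<zeta> $ j * (\<integral>x. v i x * partial_deriv j P x \<partial>torus))
       \<le> C * (norm \<zeta>)\<^sup>2 * (\<integral>x. P x \<partial>torus))"

lemma mollify_trig_poly: "sq_integrable f \<Longrightarrow> mollify m f \<in> trig_polys"
  by (rule conv_trig_poly[OF mollifier_trig_poly sq_integrable_imp_integrable])

lemma mgrad_trig_poly: "sq_integrable (v i) \<Longrightarrow> mgrad m v i j \<in> trig_polys"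
  by (simp add: mgrad_def partial_deriv_trig_poly mollify_trig_poly)

lemma mstrain_trig_poly:
  "sq_integrable (v i) \<Longrightarrow> sq_integrable (v j) \<Longrightarrow> mstrain m v i j \<in> trig_polys"
  unfolding mstrain_def[abs_def] by (intro trig_polys.add mgrad_trig_poly)

text \<open>With the derivative on the kernel as a function of y, which changes the sign, the weak
  conditions on v can be tested with that kernel.\<close>

lemma mgrad_eq:
  assumes "sq_integrable (v i)"
  shows "mgrad m v i j x = - (\<integral>y. v i y * partial_deriv j (\<lambda>y. mollifier m (x - y)) y \<partial>torus)"
  unfolding mgrad_def partial_deriv_conv[OF mollifier_trig_poly sq_integrable_imp_integrable[OF assms]]
    conv_def partial_deriv_reflect[OF mollifier_trig_poly]
  by (simp add: mult.commute)

lemma mgrad_trace: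
  assumes "\<And>i. sq_integrable (v i)" "div_free v"
  shows "(\<Sum>i\<in>UNIV. mgrad m v i i x) = 0"
  using bspec[OF assms(2)[unfolded div_free_def] trig_polys_reflect[OF mollifier_trig_poly, of m x]]
  unfolding mgrad_eq[OF assms(1)] sum_negf by simp

lemma mgrad_quadratic_form_ge:
  fixes v :: "'n \<Rightarrow> real ^ 'n::finite \<Rightarrow> real"
  assumes "\<And>i. sq_integrable (v i)" "one_sided v C"
  shows "(\<Sum>i\<in>UNIV. \<Sum>j\<in>UNIV. \<zeta> $ i * \<zeta> $ j * mgrad m v i j x) \<ge> - (C * (norm \<zeta>)\<^sup>2)"
proof -
  have "(\<integral>y. mollifier m (x - y) \<partial>(torus :: (real ^ 'n) measure)) = 1"
    using integral_torus_trig_poly_reflect[OF mollifier_trig_poly mollifier_even] integral_mollifier by metis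
  moreover have "(\<Sum>i\<in>UNIV. \<Sum>j\<in>UNIV. \<zeta> $ i * \<zeta> $ j *
      (\<integral>y. v i y * partial_deriv j (\<lambda>y. mollifier m (x - y)) y \<partial>torus))
    \<le> C * (norm \<zeta>)\<^sup>2 * (\<integral>y. mollifier m (x - y) \<partial>torus)"
    using assms(2)[unfolded one_sided_def, rule_format, OF trig_polys_reflect[OF mollifier_trig_poly, of m x], of \<zeta>]
      mollifier_nonneg by blast
  ultimately show ?thesis
    unfolding mgrad_eq[OF assms(1)] by (simp add: sum_negf)
qed

lemma quadratic_form_axis:
  "(\<Sum>k\<in>UNIV. \<Sum>l\<in>UNIV. axis i 1 $ k * axis j 1 $ l * (D k l :: real)) = D i j"
proof -
  have "axis i 1 $ k * axis j 1 $ l * D k l = (if l = j then (if k = i then D k l else 0) else 0)" for k l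
    by (simp add: axis_def)
  then show ?thesis by (simp add: sum.delta)
qed

text \<open>The unit vectors e_k give D k k \<ge> - C, so the zero trace gives D k k \<le> (N - 1)
  C, rounded up to N C. Testing with e_i + e_j and e_i - e_j then bounds the off-diagonal sum by 2 C
  + 2 N C.\<close>

lemma abs_strain_le:
  fixes D :: "'n::finite \<Rightarrow> 'n \<Rightarrow> real"
  assumes ge: "\<And>\<zeta> :: real ^ 'n. (\<Sum>i\<in>UNIV. \<Sum>j\<in>UNIV. \<zeta> $ i * \<zeta> $ j * D i j) \<ge> - (C * (norm \<zeta>)\<^sup>2)"
    and tr: "(\<Sum>i\<in>UNIV. D i i) = 0" and C: "C \<ge> 0"
  shows "\<bar>D i j + D j i\<bar> \<le> 2 * (real CARD('n) + 1) * C"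
proof -
  let ?N = "real CARD('n)"
  have lower: "D k k \<ge> - C" for k
    using ge[of "axis k 1"] by (simp add: quadratic_form_axis power2_norm_eq_inner inner_axis_axis)
  have upper: "D k k \<le> ?N * C" for k
  proof -
    have "(\<Sum>i\<in>UNIV - {k}. - C) \<le> (\<Sum>i\<in>UNIV - {k}. D i i)" using lower by (intro sum_mono)
    then have "- (real (card (UNIV - {k} :: 'n set)) * C) \<le> - D k k"
      using tr sum.remove[of UNIV k "\<lambda>i. D i i"] by simp
    moreover have "real (card (UNIV - {k} :: 'n set)) * C \<le> ?N * C"
      using C by (intro mult_right_mono) (auto intro: card_mono)
    ultimately show ?thesis by linarith
  qed
  show ?thesis
  proof (cases "i = j")
    case True
    have "?N * C \<ge> 0" using C by simp
    moreover have "2 * (?N + 1) * C = 2 * (?N * C) + 2 * C" by (simp add: algebra_simps)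
    ultimately show ?thesis unfolding True using lower[of j] upper[of j] C by linarith
  next
    case False
    have n: "(norm (axis i 1 + s *\<^sub>R axis j 1 :: real ^ 'n))\<^sup>2 = 2" if "s = 1 \<or> s = - 1" for s :: real
      unfolding power2_norm_eq_inner inner_add_left inner_add_right inner_scaleR_left inner_scaleR_right
      using that False by (auto simp: inner_axis_axis)
    have pm: "D i i + D j j + s * (D i j + D j i) \<ge> - (2 * C)" if s: "s = 1 \<or> s = - 1" for s
    proof -
      let ?a = "\<lambda>k. axis i 1 $ k :: real" and ?b = "\<lambda>k. axis j 1 $ k :: real"
      have "(\<Sum>k\<in>UNIV. \<Sum>l\<in>UNIV. (axis i 1 + s *\<^sub>R axis j 1) $ k * (axis i 1 + s *\<^sub>R axis j 1) $ l * D k l) =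
        (\<Sum>k\<in>UNIV. \<Sum>l\<in>UNIV. ?a k * ?a l * D k l) + s * s * (\<Sum>k\<in>UNIV. \<Sum>l\<in>UNIV. ?b k * ?b l * D k l) +
        s * ((\<Sum>k\<in>UNIV. \<Sum>l\<in>UNIV. ?a k * ?b l * D k l) + (\<Sum>k\<in>UNIV. \<Sum>l\<in>UNIV. ?b k * ?a l * D k l))"
      proof -
        have "(axis i 1 + s *\<^sub>R axis j 1) $ k * (axis i 1 + s *\<^sub>R axis j 1) $ l * D k l =
            ?a k * ?a l * D k l + s * s * (?b k * ?b l * D k l) + s * (?a k * ?b l * D k l + ?b k * ?a l * D k l)" for k l
          by (simp add: algebra_simps)
        then show ?thesis by (simp only: sum.distrib sum_distrib_left[symmetric])
      qed
      also have "\<dots> = D i i + s * s * D j j + s * (D i j + D j i)"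
        unfolding quadratic_form_axis ..
      finally have eq: "(\<Sum>k\<in>UNIV. \<Sum>l\<in>UNIV. (axis i 1 + s *\<^sub>R axis j 1) $ k * (axis i 1 + s *\<^sub>R axis j 1) $ l * D k l) =
          D i i + s * s * D j j + s * (D i j + D j i)" .
      have ss: "s * s = 1" using s by (elim disjE) simp_all
      show ?thesis using ge[of "axis i 1 + s *\<^sub>R axis j 1", unfolded eq n[OF s] ss] by linarith
    qed
    have "D i i + D j j + (D i j + D j i) \<ge> - (2 * C)"
      using pm[OF disjI1[OF refl]] by (simp only: mult_1_left)
    moreover have "D i i + D j j - (D i j + D j i) \<ge> - (2 * C)"
      using pm[OF disjI2[OF refl]] by (simp only: mult_minus1 diff_conv_add_uminus)
    moreover have "2 * (?N + 1) * C = 2 * (?N * C) + 2 * C" by (simp add: algebra_simps)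
    ultimately show ?thesis using upper[of i] upper[of j] by linarith
  qed
qed

lemma abs_mstrain_le:
  fixes v :: "'n \<Rightarrow> real ^ 'n::finite \<Rightarrow> real"
  assumes "\<And>i. sq_integrable (v i)" "div_free v" "one_sided v C" "C \<ge> 0"
  shows "\<bar>mstrain m v i j x\<bar> \<le> 2 * (real CARD('n) + 1) * C"
  unfolding mstrain_def
  by (rule abs_strain_le[OF mgrad_quadratic_form_ge[OF assms(1,3)] mgrad_trace[OF assms(1,2)] assms(4)])

section \<open>Limits of trilinear integrals under mollification\<close>

lemma abs_integral_triple_diff_le:
  assumes f: "sq_integrable f" "sq_integrable f'" and g: "sq_integrable g" "sq_integrable g'"
    and h: "h \<in> borel_measurable torus" "\<And>x. \<bar>h x\<bar> \<le> B"
  shows "\<bar>integral3 f g h - (integral3 f' g' h)\<bar>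
    \<le> B * (L2dist f f' * L2norm g + L2norm f' * L2dist g g')"
proof -
  note d = sq_integrable_diff[OF f] sq_integrable_diff[OF g]
  have "(integral3 f g h) - (integral3 f' g' h) =
      (\<integral>x. f x * g x * h x - f' x * g' x * h x \<partial>torus)"
    by (intro Bochner_Integration.integral_diff[symmetric] integrable_triple[OF _ _ h] f g)
  also have "\<dots> = (\<integral>x. (f x - f' x) * g x * h x + f' x * (g x - g' x) * h x \<partial>torus)"
    by (simp add: algebra_simps)
  also have "\<dots> = (\<integral>x. (f x - f' x) * g x * h x \<partial>torus) + (\<integral>x. f' x * (g x - g' x) * h x \<partial>torus)"
    by (intro Bochner_Integration.integral_add integrable_triple[OF _ _ h] f g d)
  finally show ?thesis
    using abs_integral_triple_le[OF d(1) g(1) h] abs_integral_triple_le[OF f(2) d(2) h]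
    unfolding distrib_left by linarith
qed

lemma L2norm_mollify_diff_tendsto:
  "sq_integrable f \<Longrightarrow> (\<lambda>k. L2dist (mollify k f) f) \<longlonglongrightarrow> 0"
  "sq_integrable f \<Longrightarrow> (\<lambda>k. L2dist f (mollify k f)) \<longlonglongrightarrow> 0"
  using conv_mollifier_tendsto[of f] L2norm_minus_commute[of "mollify _ f" f] by simp_all

lemma integral_triple_mollify_tendsto:
  assumes f: "sq_integrable f" and g: "sq_integrable g"
    and h: "h \<in> borel_measurable torus" "\<And>x. \<bar>h x\<bar> \<le> B"
  shows "(\<lambda>k. integral3 (mollify k f) (mollify k g) h) \<longlonglongrightarrow> integral3 f g h"
proof (rule LIM_zero_cancel, rule Lim_null_comparison[OF always_eventually[OF allI]])
  have B: "B \<ge> 0" using h(2)[of undefined] by linarith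
  let ?R = "\<lambda>k. B * (L2dist (mollify k f) f * L2norm g + L2norm f * L2dist (mollify k g) g)"
  have "?R \<longlonglongrightarrow> B * (0 * L2norm g + L2norm f * 0)"
    by (intro tendsto_intros L2norm_mollify_diff_tendsto f g)
  then show "?R \<longlonglongrightarrow> 0" by simp
  fix k
  have "norm (integral3 (mollify k f) (mollify k g) h - integral3 f g h)
      \<le> B * (L2dist (mollify k f) f * L2norm (mollify k g) + L2norm f * L2dist (mollify k g) g)"
    unfolding real_norm_def
    by (intro abs_integral_triple_diff_le f g h sq_integrable_conv_mollifier)
  also have "\<dots> \<le> ?R k"
    using B L2norm_conv_mollifier_le[OF g, of k] by (intro mult_left_mono add_right_mono) auto
  finally show "norm (integral3 (mollify k f) (mollify k g) h - integral3 f g h) \<le> ?R k" .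
qed

lemma integral_mult_mollify_tendsto:
  assumes f: "sq_integrable f" and g: "sq_integrable g"
  shows "(\<lambda>k. \<integral>x. f x * mollify k g x \<partial>torus) \<longlonglongrightarrow> (\<integral>x. f x * g x \<partial>torus)"
proof (rule LIM_zero_cancel, rule Lim_null_comparison[OF always_eventually[OF allI]])
  fix k
  note mg = sq_integrable_conv_mollifier[OF g, of k]
  have "(\<integral>x. f x * mollify k g x \<partial>torus) - (\<integral>x. f x * g x \<partial>torus) = (\<integral>x. f x * (mollify k g x - g x) \<partial>torus)"
    using integrable_mult_sq_integrable[OF f mg] integrable_mult_sq_integrable[OF f g]
    by (simp add: right_diff_distrib)
  then show "norm ((\<integral>x. f x * mollify k g x \<partial>torus) - (\<integral>x. f x * g x \<partial>torus)) \<le> L2norm f * L2dist (mollify k g) g"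
    using abs_integral_mult_le_L2norm[OF f sq_integrable_diff[OF mg g]] by simp
next
  show "(\<lambda>k. L2norm f * L2dist (mollify k g) g) \<longlonglongrightarrow> 0"
    by (intro tendsto_mult_right_zero L2norm_mollify_diff_tendsto g)
qed

lemma convergent_uniform_approx:
  fixes a :: "nat \<Rightarrow> real"
  assumes "\<And>e. e > 0 \<Longrightarrow> \<exists>b. convergent b \<and> (\<forall>k. \<bar>a k - b k\<bar> \<le> e)"
  shows "convergent a"
proof (rule Cauchy_convergent, rule metric_CauchyI)
  fix e :: real assume "e > 0"
  then obtain b where b: "convergent b" "\<And>k. \<bar>a k - b k\<bar> \<le> e / 4" using assms[of "e / 4"] by auto
  from metric_CauchyD[OF convergent_Cauchy[OF b(1)], of "e / 4"] \<open>e > 0\<close>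
  obtain M where M: "\<And>m n. m \<ge> M \<Longrightarrow> n \<ge> M \<Longrightarrow> \<bar>b m - b n\<bar> < e / 4"
    unfolding dist_real_def by auto
  show "\<exists>M. \<forall>m\<ge>M. \<forall>n\<ge>M. dist (a m) (a n) < e"
  proof (intro exI allI impI)
    fix m n assume "m \<ge> M" "n \<ge> M"
    then show "dist (a m) (a n) < e"
      using M[of m n] b(2)[of m] b(2)[of n] unfolding dist_real_def by linarith
  qed
qed

lemma convergent_integral_mgrad_trig_poly:
  assumes "P \<in> trig_polys" "sq_integrable (v i)"
  shows "convergent (\<lambda>k. \<integral>x. P x * mgrad k v i j x \<partial>torus)"
proof -
  let ?Q = "partial_deriv j P"
  note Q = partial_deriv_trig_poly[OF assms(1), of j]
  note Qs = sq_integrable_trig_poly[OF Q]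
  have eq: "(\<integral>x. P x * mgrad k v i j x \<partial>torus) = - (\<integral>x. ?Q x * mollify k (v i) x \<partial>torus)" for k
    unfolding mgrad_def by (rule integral_by_parts_trig_poly[OF assms(1) mollify_trig_poly[OF assms(2)]])
  have "(\<lambda>k. \<integral>x. v i x * mollify k ?Q x \<partial>torus) \<longlonglongrightarrow> (\<integral>x. v i x * ?Q x \<partial>torus)"
    by (rule integral_mult_mollify_tendsto[OF assms(2) Qs])
  then have "convergent (\<lambda>k. - (\<integral>x. v i x * mollify k ?Q x \<partial>torus))"
    by (intro convergentI[OF tendsto_minus])
  moreover have "(\<integral>x. v i x * mollify k ?Q x \<partial>torus) = (\<integral>x. ?Q x * mollify k (v i) x \<partial>torus)" for k
    by (intro integral_conv_symmetric mollifier_trig_poly mollifier_even sq_integrable_imp_integrable Qs assms(2))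
  ultimately show ?thesis by (simp add: eq)
qed

text \<open>Weak convergence of the mollified strains: integration by parts handles trigonometric
  weights, and the uniform bound B extends this to weights f g by density. The limit need not be
  identified, since \<open>defect_tendsto_0\<close> uses only its existence.\<close>

lemma convergent_integral_mstrain:
  assumes f: "sq_integrable f" and g: "sq_integrable g" and v: "\<And>i. sq_integrable (v i)"
    and B: "\<And>k x. \<bar>mstrain k v i j x\<bar> \<le> B"
  shows "convergent (\<lambda>k. integral3 f g (mstrain k v i j))"
proof (rule convergent_uniform_approx)
  fix e :: real assume e: "e > 0"
  note Sm = borel_measurable_torus_trig_poly[OF mstrain_trig_poly[OF v v]]
  have B0: "B \<ge> 0" using B[of 0 undefined] by linarith
  have "(\<lambda>m. B * (L2dist f (mollify m f) * L2norm g + L2norm f * L2dist g (mollify m g)))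
      \<longlonglongrightarrow> B * (0 * L2norm g + L2norm f * 0)"
    by (intro tendsto_intros L2norm_mollify_diff_tendsto f g)
  from order_tendstoD(2)[OF this, of e] e
  obtain m where m: "B * (L2dist f (mollify m f) * L2norm g + L2norm f * L2dist g (mollify m g)) < e"
    by (force dest: eventually_happens'[rotated])
  let ?P = "\<lambda>x. mollify m f x * mollify m g x"
  have P: "?P \<in> trig_polys" by (intro trig_polys.mult mollify_trig_poly f g)
  have "(\<integral>x. ?P x * mstrain k v i j x \<partial>torus) = (\<integral>x. ?P x * mgrad k v i j x \<partial>torus) + (\<integral>x. ?P x * mgrad k v j i x \<partial>torus)" for k
    unfolding mstrain_def distrib_left
    by (intro Bochner_Integration.integral_add integrable_torus_trig_poly trig_polys.mult[OF P] mgrad_trig_poly v)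
  then have "convergent (\<lambda>k. \<integral>x. ?P x * mstrain k v i j x \<partial>torus)"
    by (simp add: convergent_add convergent_integral_mgrad_trig_poly[OF P v])
  moreover have "\<bar>integral3 f g (mstrain k v i j) - (\<integral>x. ?P x * mstrain k v i j x \<partial>torus)\<bar> \<le> e" for k
  proof -
    have "\<bar>integral3 f g (mstrain k v i j) - (\<integral>x. ?P x * mstrain k v i j x \<partial>torus)\<bar>
       \<le> B * (L2dist f (mollify m f) * L2norm g + L2norm (mollify m f) * L2dist g (mollify m g))"
      by (intro abs_integral_triple_diff_le f g Sm B sq_integrable_conv_mollifier)
    also have "\<dots> \<le> B * (L2dist f (mollify m f) * L2norm g + L2norm f * L2dist g (mollify m g))"
      using B0 L2norm_conv_mollifier_le[OF f, of m] by (intro mult_left_mono add_left_mono mult_right_mono) auto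
    finally show ?thesis using m by linarith
  qed
  ultimately show "\<exists>b. convergent b \<and> (\<forall>k. \<bar>integral3 f g (mstrain k v i j) - b k\<bar> \<le> e)"
    by blast
qed

text \<open>Integrating by parts in x_j leaves - b_i a_j \<partial>_j a_i, as the other term
  contains the divergence of a. The sum of b_i a_j \<partial>_i a_j is half of b times the gradient
  of |a|^2, which integrates to 0 because b is divergence free; adding it completes the symmetric
  gradient of a.\<close>

lemma trilinear_swap:
  fixes a b :: "'n \<Rightarrow> real ^ 'n::finite \<Rightarrow> real"
  assumes a: "\<And>i. a i \<in> trig_polys" and b: "\<And>i. b i \<in> trig_polys"
    and diva: "\<And>x. (\<Sum>j\<in>UNIV. partial_deriv j (a j) x) = 0"
    and divb: "\<And>x. (\<Sum>j\<in>UNIV. partial_deriv j (b j) x) = 0"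
  shows "(\<Sum>i\<in>UNIV. \<Sum>j\<in>UNIV. integral3 (a i) (a j) (partial_deriv j (b i))) =
    - (\<Sum>i\<in>UNIV. \<Sum>j\<in>UNIV. \<integral>x. b i x * a j x * (partial_deriv j (a i) x + partial_deriv i (a j) x) \<partial>torus)"
proof -
  note tp = a b partial_deriv_trig_poly[OF a] partial_deriv_trig_poly[OF b]
  note I = integrable_torus_trig_poly
  have pm: "partial_deriv j (\<lambda>x. a i x * a l x) x = a i x * partial_deriv j (a l) x + partial_deriv j (a i) x * a l x" for i j l x
    by (intro partial_deriv_mult differentiable_trig_poly a)
  have 1: "(\<Sum>i\<in>UNIV. \<Sum>j\<in>UNIV. integral3 (a i) (a j) (partial_deriv j (b i))) =
      - (\<Sum>i\<in>UNIV. \<Sum>j\<in>UNIV. integral3 (b i) (a j) (partial_deriv j (a i)))"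
  proof -
    have "(integral3 (a i) (a j) (partial_deriv j (b i))) =
        - (integral3 (b i) (a j) (partial_deriv j (a i))) - (integral3 (b i) (a i) (partial_deriv j (a j)))" for i j
    proof -
      have "(integral3 (a i) (a j) (partial_deriv j (b i))) =
        - (\<integral>x. (a i x * partial_deriv j (a j) x + partial_deriv j (a i) x * a j x) * b i x \<partial>torus)"
        using integral_by_parts_trig_poly[OF trig_polys.mult[OF a[of i] a[of j]] b[of i], of j]
        by (simp add: pm)
      also have "(\<integral>x. (a i x * partial_deriv j (a j) x + partial_deriv j (a i) x * a j x) * b i x \<partial>torus) =
          (\<integral>x. b i x * a j x * partial_deriv j (a i) x + b i x * a i x * partial_deriv j (a j) x \<partial>torus)"
        by (simp add: algebra_simps)
      also have "\<dots> = (integral3 (b i) (a j) (partial_deriv j (a i))) + (integral3 (b i) (a i) (partial_deriv j (a j)))"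
        by (intro Bochner_Integration.integral_add I trig_polys.mult tp)
      finally show ?thesis by simp
    qed
    moreover have "(\<Sum>j\<in>UNIV. integral3 (b i) (a i) (partial_deriv j (a j))) = 0" for i
    proof -
      have "(\<Sum>j\<in>UNIV. integral3 (b i) (a i) (partial_deriv j (a j))) =
          (\<integral>x. (\<Sum>j\<in>UNIV. b i x * a i x * partial_deriv j (a j) x) \<partial>torus)"
        by (intro Bochner_Integration.integral_sum[symmetric] I trig_polys.mult tp)
      then show ?thesis by (simp add: sum_distrib_left[symmetric] diva)
    qed
    ultimately show ?thesis by (simp add: sum_subtractf sum_negf)
  qed
  have 2: "(\<Sum>i\<in>UNIV. \<Sum>j\<in>UNIV. integral3 (b i) (a j) (partial_deriv i (a j))) = 0"
  proof -
    have "(integral3 (b i) (a j) (partial_deriv i (a j))) =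
        - (1 / 2) * (integral3 (a j) (a j) (partial_deriv i (b i)))" for i j
    proof -
      have "- (\<integral>x. partial_deriv i (b i) x * (a j x * a j x) \<partial>torus) = (\<integral>x. 2 * (b i x * a j x * partial_deriv i (a j) x) \<partial>torus)"
        using integral_by_parts_trig_poly[OF b[of i] trig_polys.mult[OF a[of j] a[of j]], of i]
        by (simp add: pm algebra_simps)
      then show ?thesis by (simp add: mult.commute)
    qed
    moreover have "(\<Sum>i\<in>UNIV. integral3 (a j) (a j) (partial_deriv i (b i))) = 0" for j
    proof -
      have "(\<Sum>i\<in>UNIV. integral3 (a j) (a j) (partial_deriv i (b i))) =
          (\<integral>x. (\<Sum>i\<in>UNIV. a j x * a j x * partial_deriv i (b i) x) \<partial>torus)"
        by (intro Bochner_Integration.integral_sum[symmetric] I trig_polys.mult tp)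
      then show ?thesis by (simp add: sum_distrib_left[symmetric] divb)
    qed
    ultimately show ?thesis
      by (subst sum.swap) (simp only: sum_distrib_left[symmetric] mult_zero_right sum.neutral_const)
  qed
  have "(\<integral>x. b i x * a j x * (partial_deriv j (a i) x + partial_deriv i (a j) x) \<partial>torus) =
      (integral3 (b i) (a j) (partial_deriv j (a i))) + (integral3 (b i) (a j) (partial_deriv i (a j)))" for i j
    unfolding distrib_left
    by (intro Bochner_Integration.integral_add I trig_polys.mult tp)
  then show ?thesis using 1 2 by (simp add: sum.distrib)
qed

text \<open>The defect compares the two ways of regularising \<open>v\<close> and \<open>z\<close> in the trilinear form of the
  Euler equations; it would vanish for smooth fields.\<close>

definition defect :: "nat \<Rightarrow> ('n \<Rightarrow> real ^ 'n::finite \<Rightarrow> real) \<Rightarrow> ('n \<Rightarrow> real ^ 'n \<Rightarrow> real) \<Rightarrow> real" where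
  "defect m v z = (\<Sum>i\<in>UNIV. \<Sum>j\<in>UNIV. integral3 (z i) (v j) (mstrain m v i j))
    + (\<Sum>i\<in>UNIV. \<Sum>j\<in>UNIV. integral3 (v i) (v j) (mgrad m z i j))"

context
  fixes v z :: "'n \<Rightarrow> real ^ 'n::finite \<Rightarrow> real" and B :: real
  assumes v: "\<And>i. sq_integrable (v i)" and z: "\<And>i. sq_integrable (z i)"
    and divv: "div_free v" and divz: "div_free z"
    and B: "\<And>k i j x. \<bar>mstrain k v i j x\<bar> \<le> B"
begin

lemma B_nonneg: "B \<ge> 0"
  using B[of 0 undefined undefined undefined] by linarith

lemma mstrain_measurable: "mstrain k v i j \<in> borel_measurable torus"
  by (intro borel_measurable_torus_trig_poly mstrain_trig_poly v)

text \<open>This is \<open>trilinear_swap\<close> with a = v^k and b = z^m. Keeping m fixed while k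
  grows trades the gradient of z^m, which has no bound uniform in m, for the bounded strain of
  v^k.\<close>

lemma defect_limit:
  "(\<lambda>k. - (\<Sum>i\<in>UNIV. \<Sum>j\<in>UNIV. integral3 (mollify m (z i)) (mollify k (v j)) (mstrain k v i j)))
     \<longlonglongrightarrow> (\<Sum>i\<in>UNIV. \<Sum>j\<in>UNIV. integral3 (v i) (v j) (mgrad m z i j))"
proof -
  have "(\<lambda>k. integral3 (mollify k (v i)) (mollify k (v j)) (mgrad m z i j))
      \<longlonglongrightarrow> integral3 (v i) (v j) (mgrad m z i j)" for i j
  proof -
    obtain b where "\<And>x. \<bar>mgrad m z i j x\<bar> \<le> b"
      using bounded_trig_poly[OF mgrad_trig_poly[of z i m j, OF z]] by blast
    then show ?thesis
      by (intro integral_triple_mollify_tendsto v borel_measurable_torus_trig_poly mgrad_trig_poly z)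
  qed
  then have "(\<lambda>k. \<Sum>i\<in>UNIV. \<Sum>j\<in>UNIV. integral3 (mollify k (v i)) (mollify k (v j)) (mgrad m z i j))
      \<longlonglongrightarrow> (\<Sum>i\<in>UNIV. \<Sum>j\<in>UNIV. integral3 (v i) (v j) (mgrad m z i j))"
    by (intro tendsto_sum)
  moreover have "(\<Sum>i\<in>UNIV. \<Sum>j\<in>UNIV. integral3 (mollify k (v i)) (mollify k (v j)) (mgrad m z i j)) =
      - (\<Sum>i\<in>UNIV. \<Sum>j\<in>UNIV. integral3 (mollify m (z i)) (mollify k (v j)) (mstrain k v i j))" for k
    using trilinear_swap[of "\<lambda>i. mollify k (v i)" "\<lambda>i. mollify m (z i)"]
      mgrad_trace[of v k, OF v divv] mgrad_trace[of z m, OF z divz]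
    by (simp add: mstrain_def mgrad_def mollify_trig_poly v z)
  ultimately show ?thesis by simp
qed

text \<open>Each of the two parts contributes B once: the first directly, the second because the
  bound holds along the sequence in \<open>defect_limit\<close> and survives the limit.\<close>

lemma abs_defect_le: "\<bar>defect m v z\<bar> \<le> (\<Sum>i\<in>UNIV. \<Sum>j\<in>UNIV. 2 * B * (L2norm (z i) * L2norm (v j)))"
proof -
  let ?s = "\<Sum>i\<in>UNIV. \<Sum>j\<in>UNIV. B * (L2norm (z i) * L2norm (v j))"
  have "\<bar>\<Sum>i\<in>UNIV. \<Sum>j\<in>UNIV. integral3 (z i) (v j) (mstrain m v i j)\<bar> \<le> ?s"
    by (intro order_trans[OF sum_abs] sum_mono abs_integral_triple_le z v mstrain_measurable B)
  moreover have "\<bar>\<Sum>i\<in>UNIV. \<Sum>j\<in>UNIV. integral3 (v i) (v j) (mgrad m z i j)\<bar> \<le> ?s"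
  proof (rule LIMSEQ_le_const2[OF tendsto_rabs[OF defect_limit]], intro exI allI impI)
    fix k
    have "\<bar>integral3 (mollify m (z i)) (mollify k (v j)) (mstrain k v i j)\<bar> \<le> B * (L2norm (z i) * L2norm (v j))" for i j
    proof -
      have "\<bar>integral3 (mollify m (z i)) (mollify k (v j)) (mstrain k v i j)\<bar>
          \<le> B * (L2norm (mollify m (z i)) * L2norm (mollify k (v j)))"
        by (intro abs_integral_triple_le sq_integrable_conv_mollifier z v mstrain_measurable B)
      also have "\<dots> \<le> B * (L2norm (z i) * L2norm (v j))"
        by (intro mult_left_mono mult_mono L2norm_conv_mollifier_le z v L2norm_nonneg B_nonneg)
      finally show ?thesis .
    qed
    then show "\<bar>- (\<Sum>i\<in>UNIV. \<Sum>j\<in>UNIV. integral3 (mollify m (z i)) (mollify k (v j)) (mstrain k v i j))\<bar> \<le> ?s"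
      unfolding abs_minus_cancel by (intro order_trans[OF sum_abs] sum_mono)
  qed
  ultimately have "\<bar>defect m v z\<bar> \<le> 2 * ?s" unfolding defect_def by linarith
  also have "2 * ?s = (\<Sum>i\<in>UNIV. \<Sum>j\<in>UNIV. 2 * B * (L2norm (z i) * L2norm (v j)))"
    by (simp add: sum_distrib_left mult.assoc)
  finally show ?thesis .
qed

text \<open>The first part of the defect is \<open>L m\<close>, with limit l. The second is the
  limit of \<open>- X m k\<close> in k, and X differs from L by
  \<open>\<delta> m + \<epsilon> k\<close>. Letting k grow for fixed m puts the second part within
  \<open>\<delta> m\<close> of - l, so the two parts cancel.\<close>

lemma defect_tendsto_0: "(\<lambda>m. defect m v z) \<longlonglongrightarrow> 0"
proof -
  define L where "L k = (\<Sum>i\<in>UNIV. \<Sum>j\<in>UNIV. integral3 (z i) (v j) (mstrain k v i j))" for k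
  define X where "X m k = (\<Sum>i\<in>UNIV. \<Sum>j\<in>UNIV. integral3 (mollify m (z i)) (mollify k (v j)) (mstrain k v i j))" for m k
  define W where "W m = (\<Sum>i\<in>UNIV. \<Sum>j\<in>UNIV. integral3 (v i) (v j) (mgrad m z i j))" for m
  define \<delta> where "\<delta> m = (\<Sum>i\<in>UNIV. \<Sum>j\<in>UNIV. B * (L2dist (mollify m (z i)) (z i) * L2norm (v j)))" for m
  define \<epsilon> where "\<epsilon> k = (\<Sum>i\<in>UNIV. \<Sum>j\<in>UNIV. B * (L2norm (z i) * L2dist (mollify k (v j)) (v j)))" for k
  have "convergent L" unfolding L_def
    by (intro convergent_sum convergent_integral_mstrain[where B = B] z v B)
  then obtain l where l: "L \<longlonglongrightarrow> l" by (auto simp: convergent_def)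
  have "\<delta> \<longlonglongrightarrow> (\<Sum>i\<in>(UNIV :: 'n set). \<Sum>j\<in>UNIV. B * (0 * L2norm (v j)))"
    unfolding \<delta>_def by (intro tendsto_sum tendsto_mult tendsto_const L2norm_mollify_diff_tendsto z)
  then have \<delta>: "\<delta> \<longlonglongrightarrow> 0" by simp
  have "\<epsilon> \<longlonglongrightarrow> (\<Sum>i\<in>UNIV. \<Sum>j\<in>(UNIV :: 'n set). B * (L2norm (z i) * 0))"
    unfolding \<epsilon>_def by (intro tendsto_sum tendsto_mult tendsto_const L2norm_mollify_diff_tendsto v)
  then have \<epsilon>: "\<epsilon> \<longlonglongrightarrow> 0" by simp
  have XL: "\<bar>X m k - L k\<bar> \<le> \<delta> m + \<epsilon> k" for m k
  proof -
    have t: "\<bar>(integral3 (mollify m (z i)) (mollify k (v j)) (mstrain k v i j)) - (integral3 (z i) (v j) (mstrain k v i j))\<bar>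
      \<le> B * (L2dist (mollify m (z i)) (z i) * L2norm (v j)) + B * (L2norm (z i) * L2dist (mollify k (v j)) (v j))" for i j
    proof -
      have "\<bar>(integral3 (mollify m (z i)) (mollify k (v j)) (mstrain k v i j)) - (integral3 (z i) (v j) (mstrain k v i j))\<bar>
        \<le> B * (L2dist (mollify m (z i)) (z i) * L2norm (mollify k (v j)) + L2norm (z i) * L2dist (mollify k (v j)) (v j))"
        by (intro abs_integral_triple_diff_le sq_integrable_conv_mollifier z v mstrain_measurable B)
      also have "\<dots> \<le> B * (L2dist (mollify m (z i)) (z i) * L2norm (v j) + L2norm (z i) * L2dist (mollify k (v j)) (v j))"
        by (intro mult_left_mono add_right_mono L2norm_conv_mollifier_le v L2norm_nonneg B_nonneg)
      finally show ?thesis by (simp add: distrib_left)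
    qed
    have "\<bar>X m k - L k\<bar> \<le> (\<Sum>i\<in>UNIV. \<Sum>j\<in>UNIV. B * (L2dist (mollify m (z i)) (z i) * L2norm (v j)) + B * (L2norm (z i) * L2dist (mollify k (v j)) (v j)))"
      unfolding X_def L_def sum_subtractf[symmetric]
      by (intro order_trans[OF sum_abs] sum_mono t)
    then show ?thesis by (simp add: \<delta>_def \<epsilon>_def sum.distrib)
  qed
  have Wl: "\<bar>W m + l\<bar> \<le> \<delta> m" for m
  proof -
    have "(\<lambda>k. \<bar>(- X m k) + L k\<bar>) \<longlonglongrightarrow> \<bar>W m + l\<bar>"
      using defect_limit[of m] unfolding X_def[symmetric] W_def[symmetric] by (intro tendsto_intros l)
    moreover have "(\<lambda>k. \<delta> m + \<epsilon> k) \<longlonglongrightarrow> \<delta> m + 0" by (intro tendsto_intros \<epsilon>)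
    moreover have "\<bar>(- X m k) + L k\<bar> \<le> \<delta> m + \<epsilon> k" for k using XL[of m k] by linarith
    ultimately have "\<bar>W m + l\<bar> \<le> \<delta> m + 0" by (intro LIMSEQ_le) auto
    then show ?thesis by simp
  qed
  have "(\<lambda>m. \<bar>L m - l\<bar> + \<delta> m) \<longlonglongrightarrow> \<bar>l - l\<bar> + 0" by (intro tendsto_intros l \<delta>)
  then have lim: "(\<lambda>m. \<bar>L m - l\<bar> + \<delta> m) \<longlonglongrightarrow> 0" by simp
  have "\<bar>defect m v z\<bar> \<le> \<bar>L m - l\<bar> + \<delta> m" for m
    using Wl[of m] unfolding defect_def L_def[symmetric] W_def[symmetric] by linarith
  then show ?thesis by (intro Lim_null_comparison[OF _ lim]) simp
qed

end

section \<open>Continuity in time with values in \<open>L\<^sup>2\<close>\<close>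

definition L2_continuous_on :: "real set \<Rightarrow> (real \<Rightarrow> real ^ 'n::finite \<Rightarrow> real) \<Rightarrow> bool" where
  "L2_continuous_on S f \<longleftrightarrow> (\<forall>t\<in>S. sq_integrable (f t) \<and>
     ((\<lambda>s. L2dist (f s) (f t)) \<longlongrightarrow> 0) (at t within S))"

lemma L2_continuous_on_sq_integrable: "L2_continuous_on S f \<Longrightarrow> t \<in> S \<Longrightarrow> sq_integrable (f t)"
  by (simp add: L2_continuous_on_def)

lemma L2_continuous_on_subset: "L2_continuous_on S f \<Longrightarrow> R \<subseteq> S \<Longrightarrow> L2_continuous_on R f"
  unfolding L2_continuous_on_def by (meson subsetD tendsto_within_subset)

lemma L2_continuous_on_const: "sq_integrable f \<Longrightarrow> L2_continuous_on S (\<lambda>_. f)"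
  by (simp add: L2_continuous_on_def L2norm_def)

lemma L2_continuous_on_diff:
  assumes "L2_continuous_on S f" "L2_continuous_on S g"
  shows "L2_continuous_on S (\<lambda>t x. f t x - g t x)"
  unfolding L2_continuous_on_def
proof (intro ballI conjI)
  fix t assume t: "t \<in> S"
  note sf = L2_continuous_on_sq_integrable[OF assms(1)] and sg = L2_continuous_on_sq_integrable[OF assms(2)]
  show "sq_integrable (\<lambda>x. f t x - g t x)" by (intro sq_integrable_diff sf sg t)
  have lim: "((\<lambda>s. L2dist (f s) (f t) + L2dist (g s) (g t)) \<longlongrightarrow> 0) (at t within S)"
    using assms t unfolding L2_continuous_on_def by (intro tendsto_add_zero) auto
  have "L2norm (\<lambda>x. (f s x - g s x) - (f t x - g t x)) \<le> L2dist (f s) (f t) + L2dist (g s) (g t)"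
    if s: "s \<in> S" for s
    using L2norm_triangle[OF sq_integrable_diff[OF sf[OF s] sf[OF t]] sq_integrable_uminus[OF sq_integrable_diff[OF sg[OF s] sg[OF t]]]]
    by (simp only: L2norm_uminus) (simp add: algebra_simps)
  then have "\<forall>\<^sub>F s in at t within S. norm (L2norm (\<lambda>x. (f s x - g s x) - (f t x - g t x)))
      \<le> L2dist (f s) (f t) + L2dist (g s) (g t)"
    unfolding eventually_at_filter by (simp add: always_eventually)
  then show "((\<lambda>s. L2norm (\<lambda>x. (f s x - g s x) - (f t x - g t x))) \<longlongrightarrow> 0) (at t within S)"
    using lim by (rule Lim_null_comparison)
qed

lemma tendsto_L2norm:
  assumes "((\<lambda>s. L2dist (f s) f0) \<longlongrightarrow> 0) F" "\<forall>\<^sub>F s in F. sq_integrable (f s)" "sq_integrable f0"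
  shows "((\<lambda>s. L2norm (f s)) \<longlongrightarrow> L2norm f0) F"
proof (rule LIM_zero_cancel, rule Lim_null_comparison[OF _ assms(1)])
  show "\<forall>\<^sub>F s in F. norm (L2norm (f s) - L2norm f0) \<le> L2dist (f s) f0"
    using assms(2) by eventually_elim (use L2norm_diff_le assms(3) in auto)
qed

lemma tendsto_integral_triple:
  assumes f: "((\<lambda>s. L2dist (f s) f0) \<longlongrightarrow> 0) F" "\<forall>\<^sub>F s in F. sq_integrable (f s)" "sq_integrable f0"
    and g: "((\<lambda>s. L2dist (g s) g0) \<longlongrightarrow> 0) F" "\<forall>\<^sub>F s in F. sq_integrable (g s)" "sq_integrable g0"
    and h: "\<forall>\<^sub>F s in F. h s \<in> trig_polys \<and> (\<forall>x. \<bar>h s x - h0 x\<bar> \<le> \<delta> s)" "(\<delta> \<longlongrightarrow> 0) F" "h0 \<in> trig_polys"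
  shows "((\<lambda>s. integral3 (f s) (g s) (h s)) \<longlongrightarrow> (integral3 f0 g0 h0)) F"
proof -
  obtain B where B: "\<And>x. \<bar>h0 x\<bar> \<le> B" using bounded_trig_poly[OF h(3)] by blast
  note h0m = borel_measurable_torus_trig_poly[OF h(3)]
  let ?R = "\<lambda>s. \<delta> s * (L2norm (f s) * L2norm (g s)) +
    B * (L2dist (f s) f0 * L2norm (g s) + L2norm f0 * L2dist (g s) g0)"
  note nf = tendsto_L2norm[OF f] and ng = tendsto_L2norm[OF g]
  have "(?R \<longlongrightarrow> 0 * (L2norm f0 * L2norm g0) + B * (0 * L2norm g0 + L2norm f0 * 0)) F"
    by (intro tendsto_add tendsto_mult tendsto_const nf ng f g h(2))
  then have R: "(?R \<longlongrightarrow> 0) F" by simp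
  have "\<forall>\<^sub>F s in F. norm (integral3 (f s) (g s) (h s) - (integral3 f0 g0 h0)) \<le> ?R s"
    using f(2) g(2) h(1)
  proof eventually_elim
    case (elim s)
    then have hs: "h s \<in> trig_polys" and hd: "\<And>x. \<bar>h s x - h0 x\<bar> \<le> \<delta> s" by auto
    note dm = borel_measurable_torus_trig_poly[OF trig_polys_diff[OF hs h(3)]]
    obtain B' where B': "\<And>x. \<bar>h s x\<bar> \<le> B'" using bounded_trig_poly[OF hs] by blast
    have "(integral3 (f s) (g s) (h s)) - (integral3 (f s) (g s) h0) =
        (\<integral>x. f s x * g s x * (h s x - h0 x) \<partial>torus)"
      using integrable_triple[OF elim(1,2) borel_measurable_torus_trig_poly[OF hs] B']
        integrable_triple[OF elim(1,2) h0m B]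
      by (simp add: right_diff_distrib)
    moreover have "\<bar>\<integral>x. f s x * g s x * (h s x - h0 x) \<partial>torus\<bar> \<le> \<delta> s * (L2norm (f s) * L2norm (g s))"
      by (rule abs_integral_triple_le[OF elim(1,2) dm hd])
    moreover note abs_integral_triple_diff_le[OF elim(1) f(3) elim(2) g(3) h0m B]
    ultimately show ?case unfolding real_norm_def by linarith
  qed
  then show ?thesis using R by (rule LIM_zero_cancel[OF Lim_null_comparison])
qed

lemma tendsto_L2_continuous_compose:
  fixes p :: "'b::t2_space \<Rightarrow> real"
  assumes "L2_continuous_on S f" "continuous_on A p" "p ` A \<subseteq> S" "z \<in> A"
  shows "((\<lambda>y. L2dist (f (p y)) (f (p z))) \<longlongrightarrow> 0) (at z within A)"
    "\<forall>\<^sub>F y in at z within A. sq_integrable (f (p y))" "sq_integrable (f (p z))"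
proof -
  have pz: "p z \<in> S" using assms(3,4) by auto
  then have "((\<lambda>s. L2dist (f s) (f (p z))) \<longlongrightarrow> L2dist (f (p z)) (f (p z))) (at (p z) within S)"
    using assms(1) by (simp add: L2_continuous_on_def L2norm_def)
  then have "continuous (at (p z) within S) (\<lambda>s. L2dist (f s) (f (p z)))"
    by (simp add: continuous_within)
  moreover have "continuous (at z within A) p"
    using assms(2,4) by (simp add: continuous_on_eq_continuous_within)
  ultimately have "continuous (at z within A) (\<lambda>y. L2dist (f (p y)) (f (p z)))"
    using continuous_within_compose2[of z A p "\<lambda>s. L2dist (f s) (f (p z))"] continuous_within_subset assms(3)
    by blast
  then show "((\<lambda>y. L2dist (f (p y)) (f (p z))) \<longlongrightarrow> 0) (at z within A)"
    by (simp add: continuous_within L2norm_def)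
  have "sq_integrable (f (p y))" if "y \<in> A" for y
    using that assms(1,3) L2_continuous_on_sq_integrable by blast
  then show "\<forall>\<^sub>F y in at z within A. sq_integrable (f (p y))"
    unfolding eventually_at_filter by (simp add: always_eventually)
  show "sq_integrable (f (p z))" using L2_continuous_on_sq_integrable[OF assms(1) pz] .
qed

text \<open>The times p, q and r are independent because increments of a pairing freeze one field at
  an end of the time interval. Convolution makes the third factor continuous in the uniform norm, so
  the product of two L2 factors can be integrated against it.\<close>

lemma continuous_on_integral_triple_conv:
  fixes f g h :: "real \<Rightarrow> real ^ 'n::finite \<Rightarrow> real" and p q r :: "'b::t2_space \<Rightarrow> real"
  assumes f: "L2_continuous_on S f" "continuous_on A p" "p ` A \<subseteq> S"
    and g: "L2_continuous_on S g" "continuous_on A q" "q ` A \<subseteq> S"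
    and h: "L2_continuous_on S h" "continuous_on A r" "r ` A \<subseteq> S"
    and K: "K \<in> trig_polys"
  shows "continuous_on A (\<lambda>z. \<integral>x. f (p z) x * g (q z) x * conv K (h (r z)) x \<partial>torus)"
  unfolding continuous_on_def
proof (intro ballI)
  fix z assume z: "z \<in> A"
  obtain B where B: "B \<ge> 0" "\<And>f x. sq_integrable f \<Longrightarrow> \<bar>conv K f x\<bar> \<le> B * L2norm f"
    using abs_conv_le[OF K] by blast
  note lf = tendsto_L2_continuous_compose[OF f z] and lg = tendsto_L2_continuous_compose[OF g z]
    and lh = tendsto_L2_continuous_compose[OF h z]
  show "((\<lambda>z. \<integral>x. f (p z) x * g (q z) x * conv K (h (r z)) x \<partial>torus) \<longlongrightarrow>
      (\<integral>x. f (p z) x * g (q z) x * conv K (h (r z)) x \<partial>torus)) (at z within A)"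
  proof (rule tendsto_integral_triple[OF lf lg])
    show "\<forall>\<^sub>F y in at z within A. conv K (h (r y)) \<in> trig_polys \<and>
        (\<forall>x. \<bar>conv K (h (r y)) x - conv K (h (r z)) x\<bar> \<le> B * L2dist (h (r y)) (h (r z)))"
      using lh(2)
    proof eventually_elim
      case (elim y)
      note i = sq_integrable_imp_integrable[OF elim] sq_integrable_imp_integrable[OF lh(3)]
      show ?case
        using B(2)[OF sq_integrable_diff[OF elim lh(3)]] conv_diff[OF K i]
        by (simp add: conv_trig_poly[OF K i(1)])
    qed
    show "conv K (h (r z)) \<in> trig_polys"
      by (rule conv_trig_poly[OF K sq_integrable_imp_integrable[OF lh(3)]])
    have "((\<lambda>y. B * L2dist (h (r y)) (h (r z))) \<longlongrightarrow> B * 0) (at z within A)"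
      by (intro tendsto_mult tendsto_const lh)
    then show "((\<lambda>y. B * L2dist (h (r y)) (h (r z))) \<longlongrightarrow> 0) (at z within A)" by simp
  qed
qed

lemma continuous_on_integral_triple:
  fixes f g :: "real \<Rightarrow> real ^ 'n::finite \<Rightarrow> real"
  assumes "L2_continuous_on S f" "L2_continuous_on S g" "H \<in> trig_polys"
  shows "continuous_on S (\<lambda>t. integral3 (f t) (g t) H)"
  unfolding continuous_on_def
proof (intro ballI)
  fix t assume t: "t \<in> S"
  note l = tendsto_L2_continuous_compose[OF _ continuous_on_id _ t, unfolded id_def]
  show "((\<lambda>t. integral3 (f t) (g t) H) \<longlongrightarrow> (integral3 (f t) (g t) H)) (at t within S)"
    by (rule tendsto_integral_triple[where \<delta> = "\<lambda>_. 0", OF l[OF assms(1)] l[OF assms(2)]])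
       (use assms(3) in auto)
qed

lemma continuous_on_integral_mult:
  fixes f g :: "real \<Rightarrow> real ^ 'n::finite \<Rightarrow> real"
  assumes "L2_continuous_on S f" "L2_continuous_on S g"
  shows "continuous_on S (\<lambda>t. \<integral>x. f t x * g t x \<partial>torus)"
  using continuous_on_integral_triple[OF assms trig_polys.const[of 1]] by simp

lemma continuous_on_L2norm:
  "L2_continuous_on S f \<Longrightarrow> continuous_on S (\<lambda>t. L2norm (f t))"
  using continuous_on_integral_mult[of S f f]
  by (simp add: L2norm_def power2_eq_square continuous_on_real_sqrt)

section \<open>Test functions\<close>

lemma has_derivative_vec_family:
  fixes W :: "'m::finite \<Rightarrow> real ^ 'n::finite \<Rightarrow> real"
  assumes "\<And>i. W i differentiable (at x)"
  shows "((\<lambda>x. \<chi> i. W i x) has_derivative (\<lambda>h. \<Sum>j\<in>UNIV. h $ j *\<^sub>R (\<chi> i. partial_deriv j (W i) x))) (at x)"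
proof (subst has_derivative_componentwise_within, intro ballI)
  fix b :: "real ^ 'm" assume "b \<in> Basis"
  then obtain i where b: "b = axis i 1" by (auto simp: Basis_vec_def)
  have "(W i has_derivative (\<lambda>h. \<Sum>j\<in>UNIV. h $ j *\<^sub>R partial_deriv j (W i) x)) (at x)"
    using frechet_derivative_eq_partial_derivs[OF assms] .
  then show "((\<lambda>x. (\<chi> i. W i x) \<bullet> b) has_derivative
      (\<lambda>h. (\<Sum>j\<in>UNIV. h $ j *\<^sub>R (\<chi> i. partial_deriv j (W i) x)) \<bullet> b)) (at x)"
    by (simp add: b inner_axis inner_sum_left)
qed

lemma partial_deriv_vec_family:
  fixes W :: "'m::finite \<Rightarrow> real ^ 'n::finite \<Rightarrow> real"
  assumes "\<And>i. W i differentiable (at x)"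
  shows "partial_deriv j (\<lambda>x. \<chi> i. W i x) x = (\<chi> i. partial_deriv j (W i) x)"
proof -
  have "(\<Sum>l\<in>UNIV. axis j (1::real) $ l *\<^sub>R (\<chi> i. partial_deriv l (W i) x)) = (\<chi> i. partial_deriv j (W i) x)"
    by (simp add: axis_def if_distrib if_distribR cong: if_cong)
  then show ?thesis using partial_deriv_eqI[OF has_derivative_vec_family[of W x, OF assms], of j] by simp
qed

text \<open>A stationary field becomes a test function through a time cutoff. Choosing k constant up
  to the last time in the weak formulation removes the time derivative there, while the support
  still ends before T.\<close>

lemma C1_test_cutoff:
  fixes W :: "real ^ 'n::finite \<Rightarrow> 'b::real_normed_vector"
  assumes W: "torus_periodic W" "\<And>x. (W has_derivative (\<lambda>h. \<Sum>j\<in>UNIV. h $ j *\<^sub>R g j x)) (at x)"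
    and g: "\<And>j. continuous_on UNIV (g j)"
    and k: "\<And>r. (k has_real_derivative k' r) (at r)" "continuous_on UNIV k'"
    and b: "\<And>r. b \<le> r \<Longrightarrow> k r = 0" "b < T"
  shows "C1_test T (\<lambda>t x. k t *\<^sub>R W x)"
proof -
  define l where "l j = (Blinfun (\<lambda>z. snd z $ j) :: (real \<times> (real ^ 'n)) \<Rightarrow>\<^sub>L real)" for j
  have l: "blinfun_apply (l j) z = snd z $ j" for j z
    unfolding l_def
    by (subst bounded_linear_Blinfun_apply)
       (auto intro: bounded_linear_compose[OF bounded_linear_vec_nth bounded_linear_snd])
  \<comment> \<open>The total derivative is assembled as a bounded linear map because
    \<open>C1_test\<close> asks for its continuity in operator norm.\<close>
  define D where "D z = (blinfun_scaleR_left (k' (fst z) *\<^sub>R W (snd z)) o\<^sub>L fst_blinfun) +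
      (\<Sum>j\<in>UNIV. (blinfun_scaleR_left (k (fst z) *\<^sub>R g j (snd z)) o\<^sub>L l j))" for z :: "real \<times> (real ^ 'n)"
  have Wc: "continuous_on UNIV W"
    using W(2) by (meson continuous_at_imp_continuous_on has_derivative_continuous)
  have kc: "continuous_on UNIV k"
    using k(1) by (meson DERIV_isCont continuous_at_imp_continuous_on)
  have Dapp: "blinfun_apply (D (t, x)) = (\<lambda>z. k t *\<^sub>R (\<Sum>j\<in>UNIV. snd z $ j *\<^sub>R g j x) + (k' t * fst z) *\<^sub>R W x)" for t x
    by (auto simp: D_def plus_blinfun.rep_eq blinfun.sum_left l fun_eq_iff scaleR_sum_right mult.commute)
  have der: "((\<lambda>(t, x). k t *\<^sub>R W x) has_derivative blinfun_apply (D z)) (at z within X)" for z X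
  proof -
    obtain t x where z: "z = (t, x)" by force
    have 1: "((\<lambda>z. k (fst z)) has_derivative (\<lambda>z. k' t * fst z)) (at z within X)"
      using has_derivative_compose[OF has_derivative_fst[OF has_derivative_ident], of k "\<lambda>y. k' t * y" z X]
        k(1)[of t] by (simp add: z has_field_derivative_def)
    have 2: "((\<lambda>z. W (snd z)) has_derivative (\<lambda>z. \<Sum>j\<in>UNIV. snd z $ j *\<^sub>R g j x)) (at z within X)"
      using has_derivative_compose[OF has_derivative_snd[OF has_derivative_ident], of W "\<lambda>h. \<Sum>j\<in>UNIV. h $ j *\<^sub>R g j x" z X]
        W(2)[of x] by (simp add: z)
    show ?thesis
      using has_derivative_scaleR[OF 1 2] unfolding z Dapp case_prod_unfold by simp
  qed
  have cf: "continuous_on UNIV (\<lambda>z :: real \<times> (real ^ 'n). W (snd z))"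
    "continuous_on UNIV (\<lambda>z :: real \<times> (real ^ 'n). k (fst z))"
    "continuous_on UNIV (\<lambda>z :: real \<times> (real ^ 'n). k' (fst z))"
    "continuous_on UNIV (\<lambda>z :: real \<times> (real ^ 'n). g j (snd z))" for j
    using continuous_on_compose2[OF Wc continuous_on_snd[OF continuous_on_id]]
      continuous_on_compose2[OF kc continuous_on_fst[OF continuous_on_id]]
      continuous_on_compose2[OF k(2) continuous_on_fst[OF continuous_on_id]]
      continuous_on_compose2[OF g continuous_on_snd[OF continuous_on_id]] by auto
  have "continuous_on UNIV D"
    unfolding D_def
    by (intro continuous_on_add continuous_on_sum continuous_on_const continuous_on_scaleR cf
        bounded_bilinear.continuous_on[OF bounded_bilinear_blinfun_compose]
        bounded_linear.continuous_on[OF bounded_linear_blinfun_scaleR_left])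
  then have "continuous_on ({0..<T} \<times> UNIV) D" by (rule continuous_on_subset) auto
  moreover have "\<exists>T'<T. \<forall>t\<in>{0..<T}. T' \<le> t \<longrightarrow> (\<forall>x. k t *\<^sub>R W x = 0)"
    using b by (intro exI[of _ b]) auto
  moreover have "torus_periodic (\<lambda>x. k t *\<^sub>R W x)" for t
    using W(1) by (simp add: torus_periodic_def)
  ultimately show ?thesis
    unfolding C1_test_def using der by blast
qed

lemma has_real_derivative_max_0_sq: "((\<lambda>s. (max 0 s)\<^sup>2) has_real_derivative 2 * max 0 s) (at s)"
proof (cases s "0 :: real" rule: linorder_cases)
  case greater
  have "((\<lambda>s. s\<^sup>2) has_real_derivative 2 * max 0 s) (at s)"
    using greater by (auto intro!: derivative_eq_intros)
  then show ?thesis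
    by (rule has_field_derivative_transform_within_open[of _ _ _ "{0<..}"]) (use greater in auto)
next
  case less
  have "((\<lambda>s. 0) has_real_derivative 2 * max 0 s) (at s)"
    using less by (auto intro!: derivative_eq_intros)
  then show ?thesis
    by (rule has_field_derivative_transform_within_open[of _ _ _ "{..<0}"]) (use less in auto)
next
  case equal
  have "((\<lambda>h. (max 0 h)\<^sup>2 / h) \<longlongrightarrow> 0) (at (0::real))"
  proof (rule Lim_null_comparison)
    have "norm ((max 0 h)\<^sup>2 / h) \<le> \<bar>h\<bar>" for h :: real
      by (cases "h > 0") (auto simp: power2_eq_square)
    then show "\<forall>\<^sub>F h in at (0::real). norm ((max 0 h)\<^sup>2 / h) \<le> \<bar>h\<bar>" by simp
    show "((\<lambda>h. \<bar>h\<bar>) \<longlongrightarrow> 0) (at (0::real))" by (rule tendsto_rabs_zero) (rule tendsto_ident_at)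
  qed
  then show ?thesis using equal by (simp add: has_field_derivative_iff)
qed

text \<open>The square of the positive part is continuously differentiable. Applying it once
  flattens the left end of the transition, and applying it again to 1 minus the result flattens the
  right end.\<close>

lemma C1_cutoff:
  fixes a b :: real
  assumes "a < b"
  obtains k k' where "\<And>r. (k has_real_derivative k' r) (at r)" "continuous_on UNIV k'"
    "\<And>r. r \<le> a \<Longrightarrow> k r = 1" "\<And>r. r \<le> a \<Longrightarrow> k' r = 0" "\<And>r. b \<le> r \<Longrightarrow> k r = 0"
proof -
  define f where "f s = (max 0 s)\<^sup>2" for s :: real
  define k where "k r = f (1 - f ((r - a) / (b - a)))" for r
  define k' where "k' r = 2 * max 0 (1 - f ((r - a) / (b - a))) * - (2 * max 0 ((r - a) / (b - a)) * (1 / (b - a)))" for r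
  have f: "(f has_real_derivative 2 * max 0 s) (at s)" for s
    unfolding f_def by (rule has_real_derivative_max_0_sq)
  show thesis
  proof (rule that)
    show "(k has_real_derivative k' r) (at r)" for r
    proof -
      have "((\<lambda>r. (r - a) / (b - a)) has_real_derivative 1 / (b - a)) (at r)"
        using assms by (auto intro!: derivative_eq_intros)
      from DERIV_chain2[OF f DERIV_diff[OF DERIV_const[of 1] DERIV_chain2[OF f this]]]
      show ?thesis unfolding k_def k'_def by simp
    qed
    show "continuous_on UNIV k'"
      unfolding k'_def f_def using assms by (intro continuous_intros) auto
    show "k r = 1" "k' r = 0" if "r \<le> a" for r
    proof -
      have "(r - a) / (b - a) \<le> 0" using that assms by (simp add: divide_nonpos_pos)
      then show "k r = 1" "k' r = 0" by (auto simp: k_def k'_def f_def)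
    qed
    show "k r = 0" if "b \<le> r" for r
    proof -
      have "1 \<le> (r - a) / (b - a)" using that assms by (simp add: field_simps)
      then have "1 \<le> f ((r - a) / (b - a))" by (simp add: f_def)
      then show ?thesis by (simp add: k_def f_def)
    qed
  qed
qed

section \<open>Weak solutions as continuous curves in \<open>L\<^sup>2\<close>\<close>

text \<open>What the proof retains of a weak solution. Continuity in time allows the divergence
  condition to be stated at each single time, and stationary test fields leave a continuous
  integrand in the momentum equation.\<close>

definition euler_flow :: "real \<Rightarrow> (real \<Rightarrow> 'n \<Rightarrow> real ^ 'n::finite \<Rightarrow> real) \<Rightarrow> bool" where
  "euler_flow T u \<longleftrightarrow> (\<forall>i. L2_continuous_on {0..<T} (\<lambda>t. u t i)) \<and>
     (\<forall>t\<in>{0..<T}. div_free (u t)) \<and>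
     (\<forall>s t W. 0 \<le> s \<and> s < t \<and> t < T \<and> (\<forall>i. W i \<in> trig_polys) \<and>
        (\<forall>x. (\<Sum>j\<in>UNIV. partial_deriv j (W j) x) = 0) \<longrightarrow>
        (\<Sum>i\<in>UNIV. \<integral>x. u t i x * W i x \<partial>torus) - (\<Sum>i\<in>UNIV. \<integral>x. u s i x * W i x \<partial>torus) =
        integral {s..t} (\<lambda>r. \<Sum>i\<in>UNIV. \<Sum>j\<in>UNIV. integral3 (u r i) (u r j) (partial_deriv j (W i))))"

section \<open>From vector-valued weak solutions to component families\<close>

lemma norm_powr_2: "norm x powr 2 = (norm x)\<^sup>2"
  by (cases "norm x = 0") auto

lemma torus_Lp_2_D:
  assumes "torus_Lp 2 f"
  shows "f \<in> borel_measurable torus" "integrable torus (\<lambda>x. (norm (f x))\<^sup>2)"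
  using assms by (auto simp: torus_Lp_def norm_powr_2)

lemma torus_Lp_norm_2: "torus_Lp_norm 2 f = sqrt (\<integral>x. (norm (f x))\<^sup>2 \<partial>torus)"
  by (simp add: torus_Lp_norm_def norm_powr_2 powr_half_sqrt)

lemma component_sq_le: "((x :: real ^ 'n::finite) $ i)\<^sup>2 \<le> (norm x)\<^sup>2"
  using power_mono[OF component_le_norm_cart[of x i], of 2] by simp

lemma sq_integrable_component:
  fixes f :: "real ^ 'n::finite \<Rightarrow> real ^ 'n"
  assumes "f \<in> borel_measurable torus" "integrable torus (\<lambda>x. (norm (f x))\<^sup>2)"
  shows "sq_integrable (\<lambda>x. f x $ i)"
proof -
  have m: "(\<lambda>x. f x $ i) \<in> borel_measurable torus"
    unfolding cart_eq_inner_axis by (intro borel_measurable_inner assms(1)) simp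
  have "integrable torus (\<lambda>x. (f x $ i)\<^sup>2)"
    by (rule Bochner_Integration.integrable_bound[OF assms(2)])
       (use m in \<open>auto intro: borel_measurable_power simp: component_sq_le\<close>)
  with m show ?thesis by (simp add: sq_integrable_def)
qed

lemma L2norm_component_le:
  fixes f :: "real ^ 'n::finite \<Rightarrow> real ^ 'n"
  assumes "f \<in> borel_measurable torus" "integrable torus (\<lambda>x. (norm (f x))\<^sup>2)"
  shows "L2norm (\<lambda>x. f x $ i) \<le> torus_Lp_norm 2 f"
proof -
  have "integrable torus (\<lambda>x. (f x $ i)\<^sup>2)"
    using sq_integrable_component[OF assms, of i] by (simp add: sq_integrable_def)
  then have "(\<integral>x. (f x $ i)\<^sup>2 \<partial>torus) \<le> (\<integral>x. (norm (f x))\<^sup>2 \<partial>torus)"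
    using assms(2) component_sq_le by (rule integral_mono)
  then show ?thesis unfolding L2norm_def torus_Lp_norm_2 by (rule real_sqrt_le_mono)
qed

lemma integrable_norm_diff_sq:
  fixes f g :: "real ^ 'n::finite \<Rightarrow> real ^ 'n"
  assumes "torus_Lp 2 f" "torus_Lp 2 g"
  shows "(\<lambda>x. f x - g x) \<in> borel_measurable torus" "integrable torus (\<lambda>x. (norm (f x - g x))\<^sup>2)"
proof -
  note f = torus_Lp_2_D[OF assms(1)] and g = torus_Lp_2_D[OF assms(2)]
  show m: "(\<lambda>x. f x - g x) \<in> borel_measurable torus" by (intro borel_measurable_diff f g)
  have "(norm (f x - g x))\<^sup>2 \<le> 2 * (norm (f x))\<^sup>2 + 2 * (norm (g x))\<^sup>2" for x
  proof -
    have "(norm (f x - g x))\<^sup>2 \<le> (norm (f x) + norm (g x))\<^sup>2"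
      by (intro power_mono norm_triangle_ineq4) simp
    also have "\<dots> + (norm (f x) - norm (g x))\<^sup>2 = 2 * (norm (f x))\<^sup>2 + 2 * (norm (g x))\<^sup>2"
      by (simp add: power2_eq_square algebra_simps)
    finally show ?thesis using zero_le_power2[of "norm (f x) - norm (g x)"] by linarith
  qed
  moreover have i: "integrable torus (\<lambda>x. 2 * (norm (f x))\<^sup>2 + 2 * (norm (g x))\<^sup>2)"
    using f(2) g(2) by simp
  moreover have "(\<lambda>x. (norm (f x - g x))\<^sup>2) \<in> borel_measurable torus"
    by (rule borel_measurable_power[OF measurable_compose[OF m borel_measurable_norm]])
  ultimately show "integrable torus (\<lambda>x. (norm (f x - g x))\<^sup>2)"
    by (intro Bochner_Integration.integrable_bound[OF i] AE_I2) (simp_all del: power2_norm_eq_inner)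
qed

lemma L2_continuous_on_component:
  assumes "continuous_L2 T w"
  shows "L2_continuous_on {0..<T} (\<lambda>t x. w t x $ i)"
  unfolding L2_continuous_on_def
proof (intro ballI conjI)
  fix t assume t: "t \<in> {0..<T}"
  have L: "torus_Lp 2 (w s)" if "s \<in> {0..<T}" for s
    using assms that unfolding continuous_L2_def by blast
  show "sq_integrable (\<lambda>x. w t x $ i)"
    by (intro sq_integrable_component torus_Lp_2_D L t)
  have le: "norm (L2norm (\<lambda>x. w s x $ i - w t x $ i)) \<le> torus_Lp_norm 2 (\<lambda>x. w s x - w t x)"
    if "s \<in> {0..<T}" for s
    using L2norm_component_le[OF integrable_norm_diff_sq[OF L[OF that] L[OF t]], of i] by simp
  show "((\<lambda>s. L2norm (\<lambda>x. w s x $ i - w t x $ i)) \<longlongrightarrow> 0) (at t within {0..<T})"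
  proof (rule Lim_null_comparison)
    show "\<forall>\<^sub>F s in at t within {0..<T}. norm (L2norm (\<lambda>x. w s x $ i - w t x $ i)) \<le> torus_Lp_norm 2 (\<lambda>x. w s x - w t x)"
      unfolding eventually_at_filter using le by (simp add: always_eventually)
    show "((\<lambda>s. torus_Lp_norm 2 (\<lambda>x. w s x - w t x)) \<longlongrightarrow> 0) (at t within {0..<T})"
      using assms t unfolding continuous_L2_def by blast
  qed
qed

text \<open>Serves to pass from the time-integrated divergence condition to every time:
  differentiate the integral, one-sidedly at 0.\<close>

lemma integral_zero_imp_continuous_zero:
  fixes h :: "real \<Rightarrow> real"
  assumes "continuous_on {0..<T} h" and zero: "\<And>t. 0 < t \<Longrightarrow> t < T \<Longrightarrow> integral {0..t} h = 0"
    and t: "t \<in> {0..<T}"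
  shows "h t = 0"
proof -
  define b where "b = (t + T) / 2"
  have b: "t < b" "b < T" "0 < b" using t by (auto simp: b_def)
  have "((\<lambda>u. integral {0..u} h) has_vector_derivative h t) (at t within cbox 0 b)"
    unfolding cbox_interval
    by (rule integral_has_vector_derivative) (use b t in \<open>auto intro: continuous_on_subset[OF assms(1)]\<close>)
  moreover have "((\<lambda>u. integral {0..u} h) has_vector_derivative 0) (at t within cbox 0 b)"
  proof (rule has_vector_derivative_transform[where f = "\<lambda>_. 0"])
    show "integral {0..u} h = 0" if "u \<in> cbox 0 b" for u
      using that zero[of u] b by (cases "u = 0") auto
  qed (use b t in auto)
  ultimately show ?thesis
    using vector_derivative_unique_within_closed_interval[of 0 b t] b t by auto
qed

lemma lebesgue_on_integral_continuous:
  fixes h :: "real \<Rightarrow> real"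
  assumes "continuous_on {a..b} h"
  shows "integral\<^sup>L (lebesgue_on {a..b}) h = integral {a..b} h"
  by (rule lebesgue_integral_eq_integral[OF continuous_imp_integrable_real[OF assms]]) simp

text \<open>Makes the derivative within the half-open time interval unique, including the one-sided
  derivative at time 0.\<close>

lemma at_within_half_open_neq_bot:
  fixes t T :: real
  assumes "t \<in> {0..<T}"
  shows "at t within {0..<T} \<noteq> bot"
proof -
  define b where "b = (t + T) / 2"
  have "t < b" "{t..b} \<subseteq> {0..<T}" using assms by (auto simp: b_def)
  then have "at_right t \<le> at t within {0..<T}"
    using at_within_Icc_at_right[of t b] at_le[of "{t..b}" "{0..<T}" t] by simp
  then show ?thesis using trivial_limit_at_right_real[of t] by (metis bot.extremum_uniqueI)
qed

lemma euler_flow_weak_solution: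
  fixes w :: "real \<Rightarrow> real ^ 'n::finite \<Rightarrow> real ^ 'n"
  assumes sol: "euler_weak_solution T u0 w"
  shows "euler_flow T (\<lambda>t i x. w t x $ i)"
proof -
  let ?u = "\<lambda>t i x. w t x $ i"
  have cont: "L2_continuous_on {0..<T} (\<lambda>t. ?u t i)" for i
    using sol unfolding euler_weak_solution_def by (intro L2_continuous_on_component) blast
  have sq: "sq_integrable (?u t i)" if "t \<in> {0..<T}" for t i
    using L2_continuous_on_sq_integrable[OF cont that] .
  have "div_free (?u t)" if t: "t \<in> {0..<T}" for t
    unfolding div_free_def
  proof
    fix P :: "real ^ 'n \<Rightarrow> real" assume P: "P \<in> trig_polys"
    define h where "h t = (\<Sum>j\<in>UNIV. \<integral>x. ?u t j x * partial_deriv j P x \<partial>torus)" for t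
    have hc: "continuous_on {0..<T} h"
      unfolding h_def
      using continuous_on_integral_mult[OF cont L2_continuous_on_const[OF sq_integrable_trig_poly[OF partial_deriv_trig_poly[OF P]]]]
      by (intro continuous_on_sum) auto
    have "h t = 0"
    proof (rule integral_zero_imp_continuous_zero[OF hc _ t])
      fix \<tau> :: real assume \<tau>: "0 < \<tau>" "\<tau> < T"
      \<comment> \<open>The cutoff drops to 0 between \<tau> and the midpoint b of \<tau> and T, so
        the test function equals P on the whole interval of integration.\<close>
      define b where "b = (\<tau> + T) / 2"
      have b: "\<tau> < b" "b < T" using \<tau> by (auto simp: b_def)
      obtain k k' where k: "\<And>r. (k has_real_derivative k' r) (at r)" "continuous_on UNIV k'"
        "\<And>r. r \<le> \<tau> \<Longrightarrow> k r = 1" "\<And>r. b \<le> r \<Longrightarrow> k r = 0"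
        using C1_cutoff[OF b(1)] by metis
      have "C1_test T (\<lambda>t x. k t *\<^sub>R P x)"
        by (rule C1_test_cutoff[OF torus_periodic_trig_poly[OF P]
              frechet_derivative_eq_partial_derivs[OF differentiable_trig_poly[OF P]]
              continuous_on_trig_poly[OF partial_deriv_trig_poly[OF P]] k(1,2,4) b(2)])
      moreover have "\<forall>\<phi> :: real \<Rightarrow> real ^ 'n \<Rightarrow> real. C1_test T \<phi> \<longrightarrow>
          (\<integral>t. (\<integral>x. w t x \<bullet> grad (\<phi> t) x \<partial>torus) \<partial>lebesgue_on {0..\<tau>}) = 0"
        using sol \<tau> unfolding euler_weak_solution_def by (meson order_refl)
      ultimately have "(\<integral>t. (\<integral>x. w t x \<bullet> grad (\<lambda>x. k t *\<^sub>R P x) x \<partial>torus) \<partial>lebesgue_on {0..\<tau>}) = 0"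
        by blast
      moreover have "(\<integral>t. (\<integral>x. w t x \<bullet> grad (\<lambda>x. k t *\<^sub>R P x) x \<partial>torus) \<partial>lebesgue_on {0..\<tau>}) =
          integral\<^sup>L (lebesgue_on {0..\<tau>}) h"
      proof (rule Bochner_Integration.integral_cong[OF refl])
        fix t assume "t \<in> space (lebesgue_on {0..\<tau>})"
        then have t: "t \<in> {0..<T}" "t \<le> \<tau>" using \<tau> by auto
        have "(\<integral>x. w t x \<bullet> grad (\<lambda>x. k t *\<^sub>R P x) x \<partial>torus) =
            (\<integral>x. (\<Sum>j\<in>UNIV. ?u t j x * partial_deriv j P x) \<partial>torus)"
          by (simp add: k(3)[OF t(2)] grad_def inner_vec_def)
        also have "\<dots> = h t"
          unfolding h_def
          by (intro Bochner_Integration.integral_sum integrable_mult_sq_integrable sq t(1)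
              sq_integrable_trig_poly partial_deriv_trig_poly P)
        finally show "(\<integral>x. w t x \<bullet> grad (\<lambda>x. k t *\<^sub>R P x) x \<partial>torus) = h t" .
      qed
      moreover have "integral\<^sup>L (lebesgue_on {0..\<tau>}) h = integral {0..\<tau>} h"
        by (intro lebesgue_on_integral_continuous continuous_on_subset[OF hc]) (use \<tau> in auto)
      ultimately show "integral {0..\<tau>} h = 0" by simp
    qed
    then show "(\<Sum>j\<in>UNIV. \<integral>x. ?u t j x * partial_deriv j P x \<partial>torus) = 0" by (simp add: h_def)
  qed
  moreover have "(\<Sum>i\<in>UNIV. \<integral>x. ?u t i x * W i x \<partial>torus) - (\<Sum>i\<in>UNIV. \<integral>x. ?u s i x * W i x \<partial>torus) =
        integral {s..t} (\<lambda>r. \<Sum>i\<in>UNIV. \<Sum>j\<in>UNIV. integral3 (?u r i) (?u r j) (partial_deriv j (W i)))"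
    if st: "0 \<le> s" "s < t" "t < T" and W: "\<And>i. W i \<in> trig_polys"
      and divW: "\<And>x. (\<Sum>j\<in>UNIV. partial_deriv j (W j) x) = 0" for s t W
  proof -
    define h where "h r = (\<Sum>i\<in>UNIV. \<Sum>j\<in>UNIV. integral3 (?u r i) (?u r j) (partial_deriv j (W i)))" for r
    have hc: "continuous_on {0..<T} h"
      unfolding h_def
      by (intro continuous_on_sum continuous_on_integral_triple cont partial_deriv_trig_poly W)
    define V :: "real ^ 'n \<Rightarrow> real ^ 'n" where "V x = (\<chi> i. W i x)" for x
    note dW = differentiable_trig_poly[OF W]
    have Vder: "(V has_derivative (\<lambda>h. \<Sum>j\<in>UNIV. h $ j *\<^sub>R (\<chi> i. partial_deriv j (W i) x))) (at x)" for x
      unfolding V_def by (rule has_derivative_vec_family[OF dW])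
    define b where "b = (t + T) / 2"
    have b: "t < b" "b < T" using st by (auto simp: b_def)
    obtain k k' where k: "\<And>r. (k has_real_derivative k' r) (at r)" "continuous_on UNIV k'"
      "\<And>r. r \<le> t \<Longrightarrow> k r = 1" "\<And>r. r \<le> t \<Longrightarrow> k' r = 0" "\<And>r. b \<le> r \<Longrightarrow> k r = 0"
      using C1_cutoff[OF b(1)] by metis
    let ?\<psi> = "\<lambda>r x. k r *\<^sub>R V x"
    have pd: "partial_deriv j (?\<psi> r) x $ i = k r * partial_deriv j (W i) x" for r j x i
    proof -
      have "?\<psi> r = (\<lambda>x. \<chi> i. k r * W i x)" by (simp add: V_def vec_eq_iff fun_eq_iff)
      moreover have "(\<lambda>x. k r * W i x) differentiable (at x)" for i
        by (intro differentiable_trig_poly trig_polys_cmult W)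
      ultimately show ?thesis
        using partial_deriv_vec_family[of "\<lambda>i x. k r * W i x" x j] by (simp add: partial_deriv_cmult dW)
    qed
    have "C1_test T ?\<psi>"
    proof (rule C1_test_cutoff[OF _ Vder _ k(1,2,5) b(2)])
      show "torus_periodic V"
        using torus_periodic_trig_poly[OF W] by (simp add: torus_periodic_def V_def)
      show "continuous_on UNIV (\<lambda>x. \<chi> i. partial_deriv j (W i) x)" for j
        by (intro continuous_on_vec_lambda continuous_on_trig_poly partial_deriv_trig_poly W)
    qed
    moreover have "\<forall>r\<in>{0..<T}. \<forall>x. divergence (?\<psi> r) x = 0"
      by (simp add: divergence_def pd sum_distrib_left[symmetric] divW del: vector_scaleR_component)
    ultimately have "(\<integral>r. (\<integral>x. w r x \<bullet> time_deriv T ?\<psi> r x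
           + (\<Sum>i\<in>UNIV. \<Sum>j\<in>UNIV. w r x $ i * w r x $ j * partial_deriv j (?\<psi> r) x $ i)
         \<partial>torus) \<partial>lebesgue_on {s..t})
       = (\<integral>x. w t x \<bullet> ?\<psi> t x \<partial>torus) - (\<integral>x. w s x \<bullet> ?\<psi> s x \<partial>torus)"
      using sol st unfolding euler_weak_solution_def by blast
    moreover have "(\<integral>r. (\<integral>x. w r x \<bullet> time_deriv T ?\<psi> r x
           + (\<Sum>i\<in>UNIV. \<Sum>j\<in>UNIV. w r x $ i * w r x $ j * partial_deriv j (?\<psi> r) x $ i)
         \<partial>torus) \<partial>lebesgue_on {s..t}) = integral\<^sup>L (lebesgue_on {s..t}) h"
    proof (rule Bochner_Integration.integral_cong[OF refl])
      fix r assume "r \<in> space (lebesgue_on {s..t})"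
      then have r: "r \<in> {0..<T}" "r \<le> t" using st by auto
      \<comment> \<open>The cutoff is stationary up to and including t, where its derivative is 0
        too, so only the convective term survives.\<close>
      have td: "time_deriv T ?\<psi> r x = 0" for x
      proof -
        have "(k has_vector_derivative 0) (at r within {0..<T})"
          using k(1)[of r] unfolding k(4)[OF r(2)] has_real_derivative_iff_has_vector_derivative
          by (rule has_vector_derivative_at_within)
        then have "((\<lambda>r. k r *\<^sub>R V x) has_vector_derivative 0) (at r within {0..<T})"
          using has_vector_derivative_scaleR[of k 0 r "{0..<T}" "\<lambda>_. V x" 0]
          by (simp add: has_real_derivative_iff_has_vector_derivative)
        then show ?thesis
          unfolding time_deriv_def by (rule vector_derivative_within[OF at_within_half_open_neq_bot[OF r(1)]])
      qed
      have "(\<integral>x. w r x \<bullet> time_deriv T ?\<psi> r x + (\<Sum>i\<in>UNIV. \<Sum>j\<in>UNIV. w r x $ i * w r x $ j * partial_deriv j (?\<psi> r) x $ i) \<partial>torus)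
        = (\<integral>x. (\<Sum>i\<in>UNIV. \<Sum>j\<in>UNIV. ?u r i x * ?u r j x * partial_deriv j (W i) x) \<partial>torus)"
        unfolding td pd by (simp add: k(3)[OF r(2)])
      also have "\<dots> = h r"
      proof -
        have i: "integrable torus (\<lambda>x. ?u r i x * ?u r j x * partial_deriv j (W i) x)" for i j
          by (rule integrable_mult_trig_poly(1)[OF integrable_mult_sq_integrable[OF sq[OF r(1)] sq[OF r(1)]]
                partial_deriv_trig_poly[OF W]])
        then show ?thesis
          unfolding h_def by (simp add: Bochner_Integration.integral_sum Bochner_Integration.integrable_sum)
      qed
      finally show "(\<integral>x. w r x \<bullet> time_deriv T ?\<psi> r x + (\<Sum>i\<in>UNIV. \<Sum>j\<in>UNIV. w r x $ i * w r x $ j * partial_deriv j (?\<psi> r) x $ i) \<partial>torus) = h r" .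
    qed
    moreover have "integral\<^sup>L (lebesgue_on {s..t}) h = integral {s..t} h"
      by (intro lebesgue_on_integral_continuous continuous_on_subset[OF hc]) (use st in auto)
    moreover have "(\<integral>x. w r x \<bullet> ?\<psi> r x \<partial>torus) = (\<Sum>i\<in>UNIV. \<integral>x. ?u r i x * W i x \<partial>torus)"
      if r: "r \<in> {0..<T}" "r \<le> t" for r
    proof -
      have "(\<integral>x. w r x \<bullet> ?\<psi> r x \<partial>torus) = (\<integral>x. (\<Sum>i\<in>UNIV. ?u r i x * W i x) \<partial>torus)"
        by (simp add: k(3)[OF r(2)] V_def inner_vec_def)
      also have "\<dots> = (\<Sum>i\<in>UNIV. \<integral>x. ?u r i x * W i x \<partial>torus)"
        by (intro Bochner_Integration.integral_sum integrable_mult_sq_integrable sq r(1)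
              sq_integrable_trig_poly W)
      finally show ?thesis .
    qed
    ultimately show ?thesis using st unfolding h_def[symmetric] by simp
  qed
  ultimately show ?thesis unfolding euler_flow_def using cont by blast
qed

section \<open>Energy balance\<close>

text \<open>The convective term a \<otimes> b : \<nabla>c of the weak formulation, tested with the
  mollification of c.\<close>

definition trilinear :: "nat \<Rightarrow> ('n \<Rightarrow> real ^ 'n::finite \<Rightarrow> real) \<Rightarrow> ('n \<Rightarrow> real ^ 'n \<Rightarrow> real) \<Rightarrow>
    ('n \<Rightarrow> real ^ 'n \<Rightarrow> real) \<Rightarrow> real" where
  "trilinear m a b c = (\<Sum>i\<in>UNIV. \<Sum>j\<in>UNIV. integral3 (a i) (b j) (mgrad m c i j))"

lemma integrable_trilinear:
  assumes "\<And>i. sq_integrable (a i)" "\<And>i. sq_integrable (b i)" "\<And>i. sq_integrable (c i)"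
  shows "integrable torus (\<lambda>x. a i x * b j x * mgrad m c k l x)"
  by (rule integrable_mult_trig_poly(1)[OF integrable_mult_sq_integrable[OF assms(1,2)] mgrad_trig_poly[of c, OF assms(3)]])

text \<open>The transposed half of the strain, after exchanging i and j, is the term with z in the
  second slot. The defect is thus symmetrised: z takes each of the three slots once.\<close>

lemma defect_eq_trilinear:
  assumes v: "\<And>i. sq_integrable (v i)" and z: "\<And>i. sq_integrable (z i)"
  shows "defect m v z = trilinear m z v v + trilinear m v z v + trilinear m v v z"
proof -
  have "(integral3 (z i) (v j) (mstrain m v i j)) =
      (integral3 (z i) (v j) (mgrad m v i j)) + integral3 (v j) (z i) (mgrad m v j i)" for i j
    using integrable_trilinear[of z v v i j m i j, OF z v v] integrable_trilinear[of z v v i j m j i, OF z v v]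
    by (simp add: mstrain_def distrib_left mult.commute[of "v j _"])
  then have "(\<Sum>i\<in>UNIV. \<Sum>j\<in>UNIV. integral3 (z i) (v j) (mstrain m v i j)) =
      trilinear m z v v + (\<Sum>i\<in>UNIV. \<Sum>j\<in>UNIV. integral3 (v j) (z i) (mgrad m v j i))"
    by (simp add: trilinear_def sum.distrib)
  also have "(\<Sum>i\<in>UNIV. \<Sum>j\<in>UNIV. integral3 (v j) (z i) (mgrad m v j i)) = trilinear m v z v"
    unfolding trilinear_def by (rule sum.swap)
  finally show ?thesis by (simp add: defect_def trilinear_def)
qed

lemma trilinear_diff:
  assumes u: "\<And>i. sq_integrable (u i)" and v: "\<And>i. sq_integrable (v i)"
  shows "trilinear m (\<lambda>i x. u i x - v i x) (\<lambda>i x. u i x - v i x) v =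
    trilinear m u u v - trilinear m u v v - trilinear m v u v + trilinear m v v v"
proof -
  have "(\<integral>x. (u i x - v i x) * (u j x - v j x) * mgrad m v i j x \<partial>torus) =
      (integral3 (u i) (u j) (mgrad m v i j)) - (integral3 (u i) (v j) (mgrad m v i j))
      - (integral3 (v i) (u j) (mgrad m v i j)) + integral3 (v i) (v j) (mgrad m v i j)" for i j
  proof -
    have "(u i x - v i x) * (u j x - v j x) * mgrad m v i j x =
        u i x * u j x * mgrad m v i j x - u i x * v j x * mgrad m v i j x - v i x * u j x * mgrad m v i j x
        + v i x * v j x * mgrad m v i j x" for x
      by (simp add: algebra_simps)
    then show ?thesis
      using integrable_trilinear[of u u v i j m i j, OF u u v] integrable_trilinear[of u v v i j m i j, OF u v v]
        integrable_trilinear[of v u v i j m i j, OF v u v] integrable_trilinear[of v v v i j m i j, OF v v v]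
      by simp
  qed
  then show ?thesis by (simp add: trilinear_def sum.distrib sum_subtractf)
qed

text \<open>The lower bound for the quadratic form is used pointwise, with \<zeta> the value of w at
  x.\<close>

lemma trilinear_ge:
  fixes v w :: "'n \<Rightarrow> real ^ 'n::finite \<Rightarrow> real"
  assumes v: "\<And>i. sq_integrable (v i)" "one_sided v C" and w: "\<And>i. sq_integrable (w i)"
  shows "trilinear m w w v \<ge> - (C * (\<Sum>i\<in>UNIV. (L2norm (w i))\<^sup>2))"
proof -
  note i = integrable_trilinear[of w w v, OF w w v(1)]
  have i2: "integrable torus (\<lambda>x. (w i x)\<^sup>2)" for i using w[of i] by (simp add: sq_integrable_def)
  have "- (C * (\<Sum>i\<in>UNIV. (L2norm (w i))\<^sup>2)) = (\<integral>x. - (C * (\<Sum>i\<in>UNIV. (w i x)\<^sup>2)) \<partial>torus)"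
    using i2 by (simp add: L2norm_sq)
  also have "\<dots> \<le> (\<integral>x. (\<Sum>i\<in>UNIV. \<Sum>j\<in>UNIV. w i x * w j x * mgrad m v i j x) \<partial>torus)"
  proof (rule integral_mono)
    show "integrable torus (\<lambda>x. - (C * (\<Sum>i\<in>UNIV. (w i x)\<^sup>2)))" using i2 by simp
    show "integrable torus (\<lambda>x. \<Sum>i\<in>UNIV. \<Sum>j\<in>UNIV. w i x * w j x * mgrad m v i j x)"
      using i by simp
    fix x
    show "- (C * (\<Sum>i\<in>UNIV. (w i x)\<^sup>2)) \<le> (\<Sum>i\<in>UNIV. \<Sum>j\<in>UNIV. w i x * w j x * mgrad m v i j x)"
      using mgrad_quadratic_form_ge[OF v, of "\<chi> i. w i x" m x]
      unfolding power2_norm_eq_inner inner_vec_def by (simp add: power2_eq_square)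
  qed
  also have "\<dots> = trilinear m w w v"
    using i by (simp add: trilinear_def)
  finally show ?thesis .
qed

lemma continuous_on_trilinear:
  fixes a b c :: "real \<Rightarrow> 'n \<Rightarrow> real ^ 'n::finite \<Rightarrow> real" and p q r :: "'b::t2_space \<Rightarrow> real"
  assumes a: "\<And>i. L2_continuous_on S (\<lambda>t. a t i)" "continuous_on A p" "p ` A \<subseteq> S"
    and b: "\<And>i. L2_continuous_on S (\<lambda>t. b t i)" "continuous_on A q" "q ` A \<subseteq> S"
    and c: "\<And>i. L2_continuous_on S (\<lambda>t. c t i)" "continuous_on A r" "r ` A \<subseteq> S"
  shows "continuous_on A (\<lambda>z. trilinear m (a (p z)) (b (q z)) (c (r z)))"
  unfolding trilinear_def
proof (intro continuous_on_sum)
  fix i j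
  have eq: "mgrad m (c (r z)) i j = conv (partial_deriv j (mollifier m)) (c (r z) i)" if "z \<in> A" for z
  proof -
    have "r z \<in> S" using that c(3) by auto
    then have "integrable torus (c (r z) i)"
      using L2_continuous_on_sq_integrable[OF c(1)] sq_integrable_imp_integrable by blast
    then show ?thesis unfolding mgrad_def by (rule partial_deriv_conv[OF mollifier_trig_poly])
  qed
  have "continuous_on A (\<lambda>z. \<integral>x. a (p z) i x * b (q z) j x * conv (partial_deriv j (mollifier m)) (c (r z) i) x \<partial>torus)"
    by (rule continuous_on_integral_triple_conv[OF a b c partial_deriv_trig_poly[OF mollifier_trig_poly]])
  then show "continuous_on A (\<lambda>z. \<integral>x. a (p z) i x * b (q z) j x * mgrad m (c (r z)) i j x \<partial>torus)"
    by (rule continuous_on_eq) (simp add: eq)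
qed

text \<open>A product rule for factors without time derivatives. G is a pairing of two curves: A
  accounts for the motion of the first with the second frozen at the later time t, B for the motion
  of the second with the first frozen at s. Continuity on the diagonal makes the difference
  quotients converge.\<close>

lemma diagonal_fundamental_theorem:
  fixes G :: "real \<Rightarrow> real" and A B :: "real \<times> real \<Rightarrow> real"
  assumes A: "continuous_on ({a..b} \<times> {a..b}) A" and B: "continuous_on ({a..b} \<times> {a..b}) B"
    and "a \<le> b"
    and G: "\<And>s t. a \<le> s \<Longrightarrow> s < t \<Longrightarrow> t \<le> b \<Longrightarrow> G t - G s = integral {s..t} (\<lambda>r. A (r, t) + B (r, s))"
  shows "G b - G a = integral {a..b} (\<lambda>r. A (r, r) + B (r, r))"
proof -
  have "(G has_vector_derivative (A (x, x) + B (x, x))) (at x within {a..b})" if x: "x \<in> {a..b}" for x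
    unfolding has_vector_derivative_def has_derivative_within_alt
  proof (intro conjI allI impI)
    show "bounded_linear (\<lambda>h. h *\<^sub>R (A (x, x) + B (x, x)))" by (rule bounded_linear_scaleR_left)
    fix e :: real assume e: "e > 0"
    have xx: "(x, x) \<in> {a..b} \<times> {a..b}" and e2: "e / 2 > 0" using x e by auto
    from A[unfolded continuous_on_iff, rule_format, OF xx e2] obtain d1 where d1: "d1 > 0"
      and A': "\<And>z. z \<in> {a..b} \<times> {a..b} \<Longrightarrow> dist z (x, x) < d1 \<Longrightarrow> dist (A z) (A (x, x)) < e / 2"
      by blast
    from B[unfolded continuous_on_iff, rule_format, OF xx e2] obtain d2 where d2: "d2 > 0"
      and B': "\<And>z. z \<in> {a..b} \<times> {a..b} \<Longrightarrow> dist z (x, x) < d2 \<Longrightarrow> dist (B z) (B (x, x)) < e / 2"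
      by blast
    \<comment> \<open>Half of the minimum, because distances in the time square are estimated by the
      sum of two coordinate distances.\<close>
    define d where "d = min d1 d2 / 2"
    have d0: "d > 0" using d1 d2 by (simp add: d_def)
    have near: "\<bar>A (r, t) + B (r, s) - (A (x, x) + B (x, x))\<bar> \<le> e"
      if "r \<in> {a..b}" "s \<in> {a..b}" "t \<in> {a..b}" "\<bar>r - x\<bar> < d" "\<bar>s - x\<bar> < d" "\<bar>t - x\<bar> < d" for r s t
    proof -
      have "dist (r, y) (x, x) < min d1 d2" if "\<bar>y - x\<bar> < d" for y
      proof -
        have "dist (r, y) (x, x) \<le> \<bar>r - x\<bar> + \<bar>y - x\<bar>"
          unfolding dist_prod_def by (simp add: dist_real_def sqrt_sum_squares_le_sum_abs)
        then show ?thesis using that \<open>\<bar>r - x\<bar> < d\<close> by (simp add: d_def)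
      qed
      then have "dist (r, t) (x, x) < d1" "dist (r, s) (x, x) < d2" using that(5,6) by simp_all
      then have "dist (A (r, t)) (A (x, x)) < e / 2" "dist (B (r, s)) (B (x, x)) < e / 2"
        using that(1-3) by (simp_all only: A' B' mem_Sigma_iff simp_thms)
      then show ?thesis unfolding dist_real_def by linarith
    qed
    have incr: "\<bar>G t - G s - (t - s) * (A (x, x) + B (x, x))\<bar> \<le> e * (t - s)"
      if st: "a \<le> s" "s < t" "t \<le> b" "\<bar>s - x\<bar> < d" "\<bar>t - x\<bar> < d" for s t
    proof -
      let ?D = "A (x, x) + B (x, x)"
      have c: "continuous_on {s..t} (\<lambda>r. A (r, t) + B (r, s))"
        using st by (intro continuous_on_add continuous_on_compose2[OF A] continuous_on_compose2[OF B])
          (auto intro!: continuous_intros)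
      have "((\<lambda>r. A (r, t) + B (r, s) - ?D) has_integral (integral {s..t} (\<lambda>r. A (r, t) + B (r, s)) - (t - s) *\<^sub>R ?D)) {s..t}"
        using has_integral_const_real[of ?D s t] st
        by (intro has_integral_diff integrable_integral integrable_continuous_real c) simp
      then have "norm (integral {s..t} (\<lambda>r. A (r, t) + B (r, s)) - (t - s) *\<^sub>R ?D) \<le> e * measure lborel {s..t}"
        using e st by (intro has_integral_bound_real[where f = "\<lambda>r. A (r, t) + B (r, s) - ?D"]) (auto intro!: near)
      then show ?thesis using G[OF st(1-3)] st by simp
    qed
    show "\<exists>d>0. \<forall>y\<in>{a..b}. norm (y - x) < d \<longrightarrow>
        norm (G y - G x - (y - x) *\<^sub>R (A (x, x) + B (x, x))) \<le> e * norm (y - x)"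
    proof (intro exI[of _ d] conjI d0 ballI impI)
      fix y assume y: "y \<in> {a..b}" "norm (y - x) < d"
      consider "y = x" | "x < y" | "y < x" by linarith
      then show "norm (G y - G x - (y - x) *\<^sub>R (A (x, x) + B (x, x))) \<le> e * norm (y - x)"
      proof cases
        case 2
        then show ?thesis using incr[of x y] x y d0 by simp
      next
        case 3
        then have "\<bar>G x - G y - (x - y) * (A (x, x) + B (x, x))\<bar> \<le> e * (x - y)"
          using incr[of y x] x y d0 by simp
        moreover have "G y - G x - (y - x) * (A (x, x) + B (x, x)) = - (G x - G y - (x - y) * (A (x, x) + B (x, x)))"
          by (simp add: algebra_simps)
        ultimately show ?thesis using 3 by simp
      qed simp
    qed
  qed
  from fundamental_theorem_of_calculus[OF \<open>a \<le> b\<close> this]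
  show ?thesis by (rule integral_unique[symmetric])
qed

definition pairing :: "nat \<Rightarrow> ('n \<Rightarrow> real ^ 'n::finite \<Rightarrow> real) \<Rightarrow> ('n \<Rightarrow> real ^ 'n \<Rightarrow> real) \<Rightarrow> real" where
  "pairing m u v = (\<Sum>i\<in>UNIV. \<integral>x. u i x * mollify m (v i) x \<partial>torus)"

lemma pairing_commute:
  "(\<And>i. sq_integrable (u i)) \<Longrightarrow> (\<And>i. sq_integrable (v i)) \<Longrightarrow> pairing m u v = pairing m v u"
  unfolding pairing_def
  by (intro sum.cong refl integral_conv_symmetric mollifier_trig_poly mollifier_even sq_integrable_imp_integrable)

lemma pairing_tendsto:
  assumes "\<And>i. sq_integrable (u i)" "\<And>i. sq_integrable (v i)"
  shows "(\<lambda>m. pairing m u v) \<longlonglongrightarrow> (\<Sum>i\<in>UNIV. \<integral>x. u i x * v i x \<partial>torus)"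
  unfolding pairing_def by (intro tendsto_sum integral_mult_mollify_tendsto assms)

lemma euler_flow_sq_integrable: "euler_flow T u \<Longrightarrow> t \<in> {0..<T} \<Longrightarrow> sq_integrable (u t i)"
  unfolding euler_flow_def using L2_continuous_on_sq_integrable by blast

text \<open>At the fixed time q the mollification of v is a divergence free trigonometric field,
  hence a stationary test field for u.\<close>

lemma euler_flow_pairing_increment:
  assumes u: "euler_flow T u" and v: "euler_flow T v"
    and st: "0 \<le> s" "s < t" "t < T" and q: "q \<in> {0..<T}"
  shows "pairing m (u t) (v q) - pairing m (u s) (v q) = integral {s..t} (\<lambda>r. trilinear m (u r) (u r) (v q))"
proof -
  note vq = euler_flow_sq_integrable[OF v q]
  have dv: "div_free (v q)" using v q by (simp add: euler_flow_def)
  have "mollify m (v q i) \<in> trig_polys" for i by (rule mollify_trig_poly[OF vq])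
  moreover have "(\<Sum>j\<in>UNIV. partial_deriv j (mollify m (v q j)) x) = 0" for x
    using mgrad_trace[of "v q" m x, OF vq dv] by (simp add: mgrad_def)
  ultimately show ?thesis
    using u[unfolded euler_flow_def, THEN conjunct2, THEN conjunct2, rule_format, of s t "\<lambda>i. mollify m (v q i)"] st
    by (simp add: pairing_def trilinear_def mgrad_def)
qed

text \<open>The increment from s to q is the increment of u paired with v at q plus the increment of
  v paired with u at s. Symmetry of the pairing lets the equation of v be used for the second
  term.\<close>

lemma energy_balance:
  assumes u: "euler_flow T u" and v: "euler_flow T v" and t: "t \<in> {0..<T}"
  shows "pairing m (u t) (v t) - pairing m (u 0) (v 0) =
    integral {0..t} (\<lambda>r. trilinear m (u r) (u r) (v r) + trilinear m (v r) (v r) (u r))"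
proof -
  have cu: "\<And>i. L2_continuous_on {0..<T} (\<lambda>t. u t i)" and cv: "\<And>i. L2_continuous_on {0..<T} (\<lambda>t. v t i)"
    using u v by (auto simp: euler_flow_def)
  let ?A = "\<lambda>z. trilinear m (u (fst z)) (u (fst z)) (v (snd z))"
  let ?B = "\<lambda>z. trilinear m (v (fst z)) (v (fst z)) (u (snd z))"
  let ?X = "{0..t} \<times> {0..t}"
  have sub: "fst ` ?X \<subseteq> {0..<T}" "snd ` ?X \<subseteq> {0..<T}" using t by auto
  have cf: "continuous_on ?X fst" "continuous_on ?X snd" by (auto intro: continuous_intros)
  have cA: "continuous_on ?X ?A"
    by (rule continuous_on_trilinear[OF cu cf(1) sub(1) cu cf(1) sub(1) cv cf(2) sub(2)])
  have cB: "continuous_on ?X ?B"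
    by (rule continuous_on_trilinear[OF cv cf(1) sub(1) cv cf(1) sub(1) cu cf(2) sub(2)])
  have "pairing m (u t) (v t) - pairing m (u 0) (v 0) = integral {0..t} (\<lambda>r. ?A (r, r) + ?B (r, r))"
  proof (rule diagonal_fundamental_theorem[OF cA cB])
    fix s q assume sq: "0 \<le> s" "s < q" "q \<le> t"
    then have m: "s \<in> {0..<T}" "q \<in> {0..<T}" using t by auto
    have i: "(\<lambda>r. trilinear m (u r) (u r) (v q)) integrable_on {s..q}"
      "(\<lambda>r. trilinear m (v r) (v r) (u s)) integrable_on {s..q}"
    proof -
      have "continuous_on {s..q} (\<lambda>r. ?A (r, q))"
        by (rule continuous_on_compose2[OF cA continuous_on_Pair[OF continuous_on_id continuous_on_const]]) (use sq in auto)
      moreover have "continuous_on {s..q} (\<lambda>r. ?B (r, s))"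
        by (rule continuous_on_compose2[OF cB continuous_on_Pair[OF continuous_on_id continuous_on_const]]) (use sq in auto)
      ultimately show "(\<lambda>r. trilinear m (u r) (u r) (v q)) integrable_on {s..q}"
        "(\<lambda>r. trilinear m (v r) (v r) (u s)) integrable_on {s..q}"
        using integrable_continuous_real by auto
    qed
    have c: "pairing m (u s) (v p) = pairing m (v p) (u s)" if "p \<in> {0..<T}" for p
      by (intro pairing_commute euler_flow_sq_integrable[OF u m(1)] euler_flow_sq_integrable[OF v that])
    have "pairing m (u q) (v q) - pairing m (u s) (v s) =
        (pairing m (u q) (v q) - pairing m (u s) (v q)) + (pairing m (v q) (u s) - pairing m (v s) (u s))"
      using c[OF m(1)] c[OF m(2)] by simp
    also have "\<dots> = integral {s..q} (\<lambda>r. trilinear m (u r) (u r) (v q)) + integral {s..q} (\<lambda>r. trilinear m (v r) (v r) (u s))"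
      using euler_flow_pairing_increment[OF u v sq(1,2) _ m(2)] euler_flow_pairing_increment[OF v u sq(1,2) _ m(1)] m
      by simp
    also have "\<dots> = integral {s..q} (\<lambda>r. ?A (r, q) + ?B (r, s))"
      using integral_add[OF i] by simp
    finally show "pairing m (u q) (v q) - pairing m (u s) (v s) = integral {s..q} (\<lambda>r. ?A (r, q) + ?B (r, s))" .
  qed (use t in auto)
  then show ?thesis by simp
qed

section \<open>Relative energy\<close>

text \<open>Nonnegativity makes c absolutely integrable, which permits multiplication by a bounded
  measurable factor.\<close>

lemma continuous_mult_integrable_on:
  fixes c e :: "real \<Rightarrow> real"
  assumes "continuous_on {a..b} e" "c integrable_on {a..b}" "\<And>r. r \<in> {a..b} \<Longrightarrow> c r \<ge> 0"
  shows "(\<lambda>r. c r * e r) integrable_on {a..b}"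
proof -
  have "e \<in> borel_measurable (lebesgue_on {a..b})"
    by (rule continuous_imp_measurable_on_sets_lebesgue[OF assms(1)]) simp
  moreover have "bounded (e ` {a..b})"
    by (rule compact_imp_bounded[OF compact_continuous_image[OF assms(1) compact_Icc]])
  moreover have "c absolutely_integrable_on {a..b}"
    using assms(2,3) by (intro nonnegative_absolutely_integrable_1)
  ultimately have "(\<lambda>r. e r * c r) absolutely_integrable_on {a..b}"
    by (intro absolutely_integrable_bounded_measurable_product_real) auto
  then have "(\<lambda>r. e r * c r) integrable_on {a..b}"
    by (rule set_lebesgue_integral_eq_integral(1))
  then show ?thesis by (simp add: mult.commute)
qed

text \<open>Expand the squared distance: admissibility handles the energy of u, the balance of v
  with itself that of v, and the balance of u with v the cross term. The one-sided bound yields the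
  integral on the right, up to a combination of defects that tends to 0.\<close>

lemma relative_energy_inequality:
  fixes u v :: "real \<Rightarrow> 'n \<Rightarrow> real ^ 'n::finite \<Rightarrow> real"
  assumes u: "euler_flow T u" and v: "euler_flow T v"
    and init: "\<And>i. L2dist (u 0 i) (v 0 i) = 0"
    and energy: "\<And>t. t \<in> {0..<T} \<Longrightarrow> (\<Sum>i\<in>UNIV. (L2norm (u t i))\<^sup>2) \<le> (\<Sum>i\<in>UNIV. (L2norm (u 0 i))\<^sup>2)"
    and os: "\<And>t. t \<in> {0..<T} \<Longrightarrow> one_sided (v t) (C t)"
    and C: "\<And>t. t \<in> {0..<T} \<Longrightarrow> C t \<ge> 0"
    and t: "t \<in> {0..<T}" and Ci: "C integrable_on {0..t}"
  shows "(\<Sum>i\<in>UNIV. (L2dist (u t i) (v t i))\<^sup>2) \<le>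
    integral {0..t} (\<lambda>r. 2 * C r * (\<Sum>i\<in>UNIV. (L2dist (u r i) (v r i))\<^sup>2))"
proof -
  define e where "e r = (\<Sum>i\<in>UNIV. (L2dist (u r i) (v r i))\<^sup>2)" for r
  have sub: "{0..t} \<subseteq> {0..<T}" using t by auto
  have cu: "\<And>i. L2_continuous_on {0..t} (\<lambda>t. u t i)" and cv: "\<And>i. L2_continuous_on {0..t} (\<lambda>t. v t i)"
    using u v L2_continuous_on_subset[OF _ sub] unfolding euler_flow_def by blast+
  note squ = euler_flow_sq_integrable[OF u] and sqv = euler_flow_sq_integrable[OF v]
  have T0: "0 \<in> {0..<T}" using t by auto
  have ec: "continuous_on {0..t} e"
    unfolding e_def
    by (intro continuous_on_sum continuous_on_power continuous_on_L2norm L2_continuous_on_diff cu cv)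
  \<comment> \<open>Half the squared distance with partial mollification: the energy of u is kept as
    it stands because only an inequality is known for it, while the pairings obey exact balances for
    each m.\<close>
  define Z where "Z m r = (1 / 2) * (\<Sum>i\<in>UNIV. (L2norm (u r i))\<^sup>2) + (1 / 2) * pairing m (v r) (v r) - pairing m (u r) (v r)" for m r
  have Zlim: "(\<lambda>m. Z m r) \<longlonglongrightarrow> e r / 2" if r: "r \<in> {0..<T}" for r
  proof -
    have "(L2dist (u r i) (v r i))\<^sup>2 = (L2norm (u r i))\<^sup>2 + (\<integral>x. v r i x * v r i x \<partial>torus) - 2 * (\<integral>x. u r i x * v r i x \<partial>torus)" for i
    proof -
      have "(L2dist (u r i) (v r i))\<^sup>2 = (\<integral>x. (u r i x)\<^sup>2 + v r i x * v r i x - 2 * (u r i x * v r i x) \<partial>torus)"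
        unfolding L2norm_sq by (simp add: power2_eq_square algebra_simps)
      also have "\<dots> = (\<integral>x. (u r i x)\<^sup>2 \<partial>torus) + (\<integral>x. v r i x * v r i x \<partial>torus) - 2 * (\<integral>x. u r i x * v r i x \<partial>torus)"
        using squ[OF r, of i] integrable_mult_sq_integrable[OF sqv[OF r] sqv[OF r], of i i]
          integrable_mult_sq_integrable[OF squ[OF r] sqv[OF r], of i i]
        by (simp add: sq_integrable_def)
      finally show ?thesis by (simp add: L2norm_sq)
    qed
    then have "e r / 2 = (1 / 2) * (\<Sum>i\<in>UNIV. (L2norm (u r i))\<^sup>2) + (1 / 2) * (\<Sum>i\<in>UNIV. \<integral>x. v r i x * v r i x \<partial>torus)
        - (\<Sum>i\<in>UNIV. \<integral>x. u r i x * v r i x \<partial>torus)"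
      by (simp add: e_def sum.distrib sum_subtractf sum_distrib_left[symmetric])
    then show ?thesis
      unfolding Z_def
      by (simp only:) (intro tendsto_intros pairing_tendsto squ[OF r] sqv[OF r])
  qed
  \<comment> \<open>The time derivative of the pairing part of \<open>Z m\<close>. Written as
    \<open>\<rho> m\<close> minus the trilinear term in w, it isolates the term that the one-sided
    condition controls.\<close>
  define R where "R m r = trilinear m (v r) (v r) (v r) - trilinear m (u r) (u r) (v r) - trilinear m (v r) (v r) (u r)" for m r
  define w where "w r i x = u r i x - v r i x" for r i x
  define \<rho> where "\<rho> m r = R m r + trilinear m (w r) (w r) (v r)" for m r
  have cw: "\<And>i. L2_continuous_on {0..t} (\<lambda>t. w t i)"
    unfolding w_def by (intro L2_continuous_on_diff cu cv)
  have tri: "continuous_on {0..t} (\<lambda>r. trilinear m (a r) (b r) (c r))"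
    if "\<And>i. L2_continuous_on {0..t} (\<lambda>t. a t i)" "\<And>i. L2_continuous_on {0..t} (\<lambda>t. b t i)"
      "\<And>i. L2_continuous_on {0..t} (\<lambda>t. c t i)" for m a b c
    using continuous_on_trilinear[OF that(1) continuous_on_id _ that(2) continuous_on_id _ that(3) continuous_on_id, of "{0..t}" m]
    by simp
  have Rc: "continuous_on {0..t} (R m)" for m
    unfolding R_def by (intro continuous_on_diff tri cu cv)
  have \<rho>c: "continuous_on {0..t} (\<rho> m)" for m
    unfolding \<rho>_def by (intro continuous_on_add Rc tri cw cv)
  have Zdiff: "Z m t \<le> Z m 0 + integral {0..t} (R m)" for m
  proof -
    have i: "(\<lambda>r. trilinear m (u r) (u r) (v r) + trilinear m (v r) (v r) (u r)) integrable_on {0..t}"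
      "(\<lambda>r. trilinear m (v r) (v r) (v r)) integrable_on {0..t}"
      by (intro integrable_continuous_real continuous_on_add tri cu cv)+
    have "integral {0..t} (R m) = integral {0..t} (\<lambda>r. trilinear m (v r) (v r) (v r) - (trilinear m (u r) (u r) (v r) + trilinear m (v r) (v r) (u r)))"
      by (simp add: R_def[abs_def] algebra_simps)
    also have "\<dots> = integral {0..t} (\<lambda>r. trilinear m (v r) (v r) (v r)) - (pairing m (u t) (v t) - pairing m (u 0) (v 0))"
      unfolding energy_balance[OF u v t] by (rule integral_diff[OF i(2,1)])
    also have "integral {0..t} (\<lambda>r. trilinear m (v r) (v r) (v r)) = (1 / 2) * (pairing m (v t) (v t) - pairing m (v 0) (v 0))"
      unfolding energy_balance[OF v v t] by simp
    finally show ?thesis using energy[OF t] unfolding Z_def by argo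
  qed
  have sqw: "sq_integrable (w r i)" if "r \<in> {0..<T}" for r i
    unfolding w_def by (intro sq_integrable_diff squ sqv that)
  have Rle: "R m r \<le> C r * e r + \<rho> m r" if r: "r \<in> {0..t}" for m r
  proof -
    have r': "r \<in> {0..<T}" using r sub by auto
    show ?thesis
      using trilinear_ge[of "v r" "C r" "w r" m, OF sqv[OF r'] os[OF r'] sqw[OF r']] unfolding \<rho>_def e_def w_def by linarith
  qed
  have Cei: "(\<lambda>r. C r * e r) integrable_on {0..t}"
    using C sub by (intro continuous_mult_integrable_on ec Ci) auto
  have Rint: "integral {0..t} (R m) \<le> integral {0..t} (\<lambda>r. C r * e r) + integral {0..t} (\<rho> m)" for m
    unfolding integral_add[OF Cei integrable_continuous_real[OF \<rho>c], symmetric]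
    by (intro integral_le integrable_continuous_real Rc integrable_add Cei \<rho>c Rle)
  \<comment> \<open>Continuity on the compact interval bounds these norms by one M, so that the
    dominating function below is a constant times C.\<close>
  define K where "K r = (\<Sum>i\<in>UNIV. L2norm (u r i)) + (\<Sum>i\<in>UNIV. L2norm (v r i))" for r
  have "continuous_on {0..t} K"
    unfolding K_def by (intro continuous_on_add continuous_on_sum continuous_on_L2norm cu cv)
  then have "bounded (K ` {0..t})" by (intro compact_imp_bounded compact_continuous_image) auto
  then obtain M where "\<forall>y\<in>K ` {0..t}. \<bar>y\<bar> \<le> M" unfolding bounded_real by (elim exE)
  then have M: "K r \<le> M" if "r \<in> {0..t}" for r
    using that abs_le_D1[of "K r" M] by simp
  define b where "b r = 2 * (real CARD('n) + 1) * C r" for r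
  \<comment> \<open>Expanding w = u - v leaves 2 T(v,v,v) - T(u,v,v) - T(v,u,v) - T(v,v,u), where T
    is \<open>trilinear m\<close>. The last three terms form the defect of u, and the defect of v
    with itself is 3 T(v,v,v), whence the factor 2/3.\<close>
  have \<rho>eq: "\<rho> m r = 2 / 3 * defect m (v r) (v r) - defect m (v r) (u r)" if r: "r \<in> {0..t}" for m r
  proof -
    have r': "r \<in> {0..<T}" using r sub by auto
    show ?thesis
      unfolding defect_eq_trilinear[of "v r" "v r", OF sqv[OF r'] sqv[OF r']]
        defect_eq_trilinear[of "v r" "u r", OF sqv[OF r'] squ[OF r']]
        \<rho>_def R_def w_def trilinear_diff[of "u r" "v r", OF squ[OF r'] sqv[OF r']]
      by simp
  qed
  have mb: "\<bar>mstrain k (v r) i j x\<bar> \<le> b r" if r: "r \<in> {0..t}" for k r i j x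
  proof -
    have r': "r \<in> {0..<T}" using r sub by auto
    have "div_free (v r)" using v r' by (simp add: euler_flow_def)
    then show ?thesis unfolding b_def by (intro abs_mstrain_le sqv os C r')
  qed
  have "(\<lambda>m. integral {0..t} (\<rho> m)) \<longlonglongrightarrow> integral {0..t} (\<lambda>r. 0)"
  \<comment> \<open>Each defect is at most 2 b M^2 with b = 2 (N + 1) C, and the coefficients
    satisfy 2/3 + 1 \<le> 2; this gives the factor 8.\<close>
  proof (rule dominated_convergence(2)[where h = "\<lambda>r. 8 * (real CARD('n) + 1) * M\<^sup>2 * C r"])
    show "\<rho> m integrable_on {0..t}" for m by (intro integrable_continuous_real \<rho>c)
    show "(\<lambda>r. 8 * (real CARD('n) + 1) * M\<^sup>2 * C r) integrable_on {0..t}"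
      using integrable_on_mult_right[OF Ci, of "8 * (real CARD('n) + 1) * M\<^sup>2"] by simp
    fix r assume r: "r \<in> {0..t}"
    then have r': "r \<in> {0..<T}" using sub by auto
    have dv: "div_free (v r)" "div_free (u r)" using u v r' by (auto simp: euler_flow_def)
    have b0: "b r \<ge> 0" unfolding b_def using C[OF r'] by simp
    have K: "K r \<ge> 0" "(\<Sum>i\<in>UNIV. L2norm (u r i)) \<le> K r" "(\<Sum>i\<in>UNIV. L2norm (v r i)) \<le> K r"
      "(\<Sum>i\<in>UNIV. L2norm (u r i)) \<ge> 0" "(\<Sum>i\<in>UNIV. L2norm (v r i)) \<ge> 0"
      unfolding K_def by (simp_all add: sum_nonneg)
    have db: "\<bar>defect m (v r) z\<bar> \<le> 2 * b r * M\<^sup>2"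
      if z: "\<And>i. sq_integrable (z i)" "div_free z" and le: "(\<Sum>i\<in>UNIV. L2norm (z i)) \<le> K r" for m z
    proof -
      have "\<bar>defect m (v r) z\<bar> \<le> (\<Sum>i\<in>UNIV. \<Sum>j\<in>UNIV. 2 * b r * (L2norm (z i) * L2norm (v r j)))"
        by (rule abs_defect_le[of "v r" z, OF sqv[OF r'] z(1) dv(1) z(2) mb[OF r]])
      also have "\<dots> = 2 * b r * ((\<Sum>i\<in>UNIV. L2norm (z i)) * (\<Sum>j\<in>UNIV. L2norm (v r j)))"
        unfolding sum_product by (simp only: sum_distrib_left)
      also have "\<dots> \<le> 2 * b r * (M * M)"
      proof -
        have "(\<Sum>i\<in>UNIV. L2norm (z i)) \<le> M" "(\<Sum>i\<in>UNIV. L2norm (v r i)) \<le> M" "M \<ge> 0"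
          using K le M[OF r] by linarith+
        then show ?thesis using b0 by (intro mult_left_mono mult_mono) (simp_all add: sum_nonneg)
      qed
      finally show ?thesis by (simp add: power2_eq_square)
    qed
    show "norm (\<rho> m r) \<le> 8 * (real CARD('n) + 1) * M\<^sup>2 * C r" for m
    proof -
      have "norm (\<rho> m r) \<le> 2 * (2 * b r * M\<^sup>2)"
        unfolding \<rho>eq[OF r] real_norm_def
        using db[of "v r" m, OF sqv[OF r'] dv(1) K(3)] db[of "u r" m, OF squ[OF r'] dv(2) K(2)] by linarith
      also have "2 * (2 * b r * M\<^sup>2) = 8 * (real CARD('n) + 1) * M\<^sup>2 * C r" by (simp add: b_def)
      finally show ?thesis .
    qed
    have "(\<lambda>m. 2 / 3 * defect m (v r) (v r) - defect m (v r) (u r)) \<longlonglongrightarrow> 2 / 3 * 0 - 0"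
      by (intro tendsto_diff tendsto_mult tendsto_const
          defect_tendsto_0[of "v r" "v r", OF sqv[OF r'] sqv[OF r'] dv(1) dv(1) mb[OF r]]
          defect_tendsto_0[of "v r" "u r", OF sqv[OF r'] squ[OF r'] dv(1) dv(2) mb[OF r]])
    then show "(\<lambda>m. \<rho> m r) \<longlonglongrightarrow> 0" by (simp add: \<rho>eq[OF r])
  qed
  then have "(\<lambda>m. Z m 0 + (integral {0..t} (\<lambda>r. C r * e r) + integral {0..t} (\<rho> m)))
      \<longlonglongrightarrow> e 0 / 2 + (integral {0..t} (\<lambda>r. C r * e r) + 0)"
    by (intro tendsto_add tendsto_const Zlim T0) simp
  moreover have "Z m t \<le> Z m 0 + (integral {0..t} (\<lambda>r. C r * e r) + integral {0..t} (\<rho> m))" for m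
    using Zdiff[of m] Rint[of m] by linarith
  ultimately have "e t / 2 \<le> e 0 / 2 + (integral {0..t} (\<lambda>r. C r * e r) + 0)"
    by (intro LIMSEQ_le[OF Zlim[OF t]]) auto
  moreover have "e 0 = 0" by (simp add: e_def init)
  moreover have "integral {0..t} (\<lambda>r. 2 * C r * e r) = 2 * integral {0..t} (\<lambda>r. C r * e r)"
    by (simp add: mult.assoc)
  ultimately show ?thesis unfolding e_def by linarith
qed

text \<open>The coefficient is merely integrable, so a continuation argument is used. Let a be the
  last time up to which e vanishes, and b > a so close that c has integral below 1/2 over [a, b].
  The maximum of e on [a, b] is then at most half of itself, so e vanishes up to b, a
  contradiction.\<close>

lemma gronwall_zero:
  fixes e c :: "real \<Rightarrow> real"
  assumes e: "continuous_on {0..<T} e" "\<And>r. r \<in> {0..<T} \<Longrightarrow> e r \<ge> 0"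
    and c: "\<And>r. r \<in> {0..<T} \<Longrightarrow> c r \<ge> 0" "\<And>t. t \<in> {0..<T} \<Longrightarrow> c integrable_on {0..t}"
    and le: "\<And>t. t \<in> {0..<T} \<Longrightarrow> e t \<le> integral {0..t} (\<lambda>r. c r * e r)"
    and t: "t \<in> {0..<T}"
  shows "e t = 0"
proof (rule ccontr)
  assume nz: "e t \<noteq> 0"
  have sub: "{0..t} \<subseteq> {0..<T}" using t by auto
  have ec: "continuous_on {p..q} e" if "0 \<le> p" "q \<le> t" for p q
    by (rule continuous_on_subset[OF e(1)]) (use that t in auto)
  define S where "S = {s \<in> {0..t}. \<forall>r\<in>{0..s}. e r = 0}"
  define a where "a = Sup S"
  have "e 0 = 0" using e(2)[of 0] le[of 0] t by force
  then have S0: "0 \<in> S" using t by (auto simp: S_def)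
  have bdd: "bdd_above S" by (rule bdd_aboveI[of _ t]) (auto simp: S_def)
  have a: "0 \<le> a" "a \<le> t"
    unfolding a_def by (rule cSup_upper[OF S0 bdd], rule cSup_least) (use S0 in \<open>auto simp: S_def\<close>)
  have zero_lt: "e r = 0" if r: "0 \<le> r" "r < a" for r
  proof -
    have "\<exists>s\<in>S. r < s" using r(2) less_cSup_iff[of S r] S0 bdd unfolding a_def by auto
    then show ?thesis using r by (auto simp: S_def)
  qed
  have int_a: "integral {0..x} (\<lambda>r. c r * e r) = integral {a..x} (\<lambda>r. c r * e r)" if "a \<le> x" "x \<le> t" for x
  proof -
    have i: "(\<lambda>r. c r * e r) integrable_on {0..x}"
      using that a t c by (intro continuous_mult_integrable_on ec c(2)) auto
    \<comment> \<open>The endpoint is spiked out because e a = 0 is itself a consequence of this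
      identity.\<close>
    have "integral {0..a} (\<lambda>r. c r * e r) = integral {0..a} (\<lambda>r. 0)"
      by (rule integral_spike[of "{a}"]) (auto simp: zero_lt)
    then show ?thesis
      using Henstock_Kurzweil_Integration.integral_combine[OF a(1) that(1) i] by simp
  qed
  have "e a \<le> 0" using le[of a] int_a[of a] a t by auto
  then have "e a = 0" using e(2)[of a] a t by auto
  then have zero_le: "e r = 0" if "0 \<le> r" "r \<le> a" for r using zero_lt[of r] that by force
  have "a < t" using a nz \<open>e a = 0\<close> by (cases "a = t") auto
  have ci: "c integrable_on {a..t}"
    using c(2)[OF t] by (rule integrable_on_subinterval) (use a in auto)
  have "continuous_on {a..t} (\<lambda>x. integral {a..x} c)"
    by (rule indefinite_integral_continuous_1[OF ci])
  from this[unfolded continuous_on_def, rule_format, of a]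
  have "((\<lambda>x. integral {a..x} c) \<longlongrightarrow> integral {a..a} c) (at a within {a..t})"
    using \<open>a < t\<close> by simp
  then have "((\<lambda>x. integral {a..x} c) \<longlongrightarrow> 0) (at_right a)"
    using at_within_Icc_at_right[OF \<open>a < t\<close>] by simp
  then have "\<forall>\<^sub>F x in at_right a. integral {a..x} c < 1 / 2"
    by (rule order_tendstoD) simp
  moreover have "\<forall>\<^sub>F x in at_right a. x \<in> {a<..<t}"
    using \<open>a < t\<close> by (rule eventually_at_right_real)
  ultimately have "\<forall>\<^sub>F x in at_right a. integral {a..x} c < 1 / 2 \<and> x \<in> {a<..<t}"
    by (rule eventually_conj)
  then obtain b where b: "integral {a..b} c < 1 / 2" "a < b" "b < t"
    using eventually_happens'[OF trivial_limit_at_right_real] by force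
  obtain y where y: "y \<in> {a..b}" "\<And>r. r \<in> {a..b} \<Longrightarrow> e r \<le> e y"
    using continuous_attains_sup[OF compact_Icc[of a b] _ ec[of a b]] a b by auto
  have ii: "c integrable_on {a..x}" if "x \<in> {a..b}" for x
    using ci by (rule integrable_on_subinterval) (use that b in auto)
  have "e y \<le> integral {a..y} (\<lambda>r. c r * e r)"
    using le[of y] int_a[of y] y a b t by auto
  also have "\<dots> \<le> integral {a..y} (\<lambda>r. c r * e y)"
  proof (rule integral_le)
    show "(\<lambda>r. c r * e r) integrable_on {a..y}"
      using y a b t c(1) by (intro continuous_mult_integrable_on ec ii) auto
    show "(\<lambda>r. c r * e y) integrable_on {a..y}"
      by (intro integrable_on_mult_left ii y)
    show "c r * e r \<le> c r * e y" if "r \<in> {a..y}" for r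
      using that y a b t by (intro mult_left_mono y(2) c(1)) auto
  qed
  also have "\<dots> = integral {a..y} c * e y" by simp
  also have "\<dots> \<le> integral {a..b} c * e y"
    using y a b t c(1) e(2)[of y]
    by (intro mult_right_mono integral_subset_le ii) auto
  also have "\<dots> \<le> 1 / 2 * e y"
    using b y a t e(2)[of y] by (intro mult_right_mono) auto
  finally have "e y \<le> 0" by simp
  have "e r = 0" if "r \<in> {0..b}" for r
  proof (cases "r \<le> a")
    case True then show ?thesis using zero_le that by auto
  next
    case False
    then have "e r \<le> 0" using y(2)[of r] \<open>e y \<le> 0\<close> that by auto
    then show ?thesis using e(2)[of r] that b t by auto
  qed
  then have "b \<in> S" using a b by (auto simp: S_def)
  then have "b \<le> a" unfolding a_def using bdd by (rule cSup_upper)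
  then show False using b by simp
qed

section \<open>Weak-strong uniqueness\<close>

lemma sum_L2norm_component_sq:
  fixes f :: "real ^ 'n::finite \<Rightarrow> real ^ 'n"
  assumes "\<And>i. sq_integrable (\<lambda>x. f x $ i)"
  shows "(\<Sum>i\<in>UNIV. (L2norm (\<lambda>x. f x $ i))\<^sup>2) = (\<integral>x. (norm (f x))\<^sup>2 \<partial>torus)"
proof -
  have "(\<Sum>i\<in>UNIV. (L2norm (\<lambda>x. f x $ i))\<^sup>2) = (\<integral>x. (\<Sum>i\<in>UNIV. (f x $ i)\<^sup>2) \<partial>torus)"
    unfolding L2norm_sq
    by (rule Bochner_Integration.integral_sum[symmetric]) (use assms in \<open>simp add: sq_integrable_def\<close>)
  also have "(\<lambda>x. \<Sum>i\<in>UNIV. (f x $ i)\<^sup>2) = (\<lambda>x. (norm (f x))\<^sup>2)"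
    unfolding power2_norm_eq_inner inner_vec_def by (simp add: power2_eq_square)
  finally show ?thesis .
qed

lemma L2norm_eq_0_imp_AE:
  assumes "sq_integrable f" "L2norm f = 0"
  shows "AE x in torus. f x = 0"
proof -
  have "(\<integral>x. (f x)\<^sup>2 \<partial>torus) = 0" using assms(2) by (simp add: L2norm_def)
  moreover have "integrable torus (\<lambda>x. (f x)\<^sup>2)" using assms(1) by (simp add: sq_integrable_def)
  ultimately have "AE x in torus. (f x)\<^sup>2 = 0"
    by (subst (asm) integral_nonneg_eq_0_iff_AE) auto
  then show ?thesis by simp
qed

lemma L2norm_AE_0:
  assumes "AE x in torus. f x = 0"
  shows "L2norm f = 0"
proof -
  have "(\<integral>x. (f x)\<^sup>2 \<partial>torus) = 0"
    using assms by (intro integral_eq_zero_AE) auto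
  then show ?thesis by (simp add: L2norm_def)
qed

text \<open>Nonnegative trigonometric polynomials are among the smooth test functions; expanding
  both scalar products in components and integrating term by term gives the form that the kernels
  can be inserted into.\<close>

lemma one_sided_component:
  fixes w :: "real ^ 'n::finite \<Rightarrow> real ^ 'n"
  assumes sq: "\<And>i. sq_integrable (\<lambda>x. w x $ i)"
    and ineq: "\<And>(\<zeta> :: real ^ 'n) \<phi>. torus_smooth \<phi> \<Longrightarrow> (\<And>x. \<phi> x \<ge> 0) \<Longrightarrow>
        (\<integral>x. - ((\<zeta> \<bullet> w x) * (\<zeta> \<bullet> grad \<phi> x)) + C * (norm \<zeta>)\<^sup>2 * \<phi> x \<partial>torus) \<ge> 0"
  shows "one_sided (\<lambda>i x. w x $ i) C"
  unfolding one_sided_def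
proof (intro allI ballI impI)
  fix \<zeta> :: "real ^ 'n" and P :: "real ^ 'n \<Rightarrow> real"
  assume P: "P \<in> trig_polys" "\<forall>x. P x \<ge> 0"
  have i: "integrable torus (\<lambda>x. w x $ i * partial_deriv j P x)" for i j
    by (rule integrable_mult_trig_poly(1)[OF sq_integrable_imp_integrable[OF sq] partial_deriv_trig_poly[OF P(1)]])
  have exp: "(\<zeta> \<bullet> w x) * (\<zeta> \<bullet> grad P x) =
      (\<Sum>i\<in>UNIV. \<Sum>j\<in>UNIV. \<zeta> $ i * \<zeta> $ j * (w x $ i * partial_deriv j P x))" for x
    unfolding inner_vec_def grad_def sum_product by (intro sum.cong refl) (simp add: mult_ac)
  have "0 \<le> (\<integral>x. - ((\<zeta> \<bullet> w x) * (\<zeta> \<bullet> grad P x)) + C * (norm \<zeta>)\<^sup>2 * P x \<partial>torus)"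
    using ineq[OF torus_smooth_trig_poly[OF P(1)]] P(2) by blast
  also have "\<dots> = - (\<Sum>i\<in>UNIV. \<Sum>j\<in>UNIV. \<zeta> $ i * \<zeta> $ j * (\<integral>x. w x $ i * partial_deriv j P x \<partial>torus))
      + C * (norm \<zeta>)\<^sup>2 * (\<integral>x. P x \<partial>torus)"
    unfolding exp using i integrable_torus_trig_poly[OF P(1)] by simp
  finally show "(\<Sum>i\<in>UNIV. \<Sum>j\<in>UNIV. \<zeta> $ i * \<zeta> $ j * (\<integral>x. w x $ i * partial_deriv j P x \<partial>torus))
      \<le> C * (norm \<zeta>)\<^sup>2 * (\<integral>x. P x \<partial>torus)" by simp
qed

theorem theorem3:
  fixes T :: real
    and u0 :: "real ^ 'n \<Rightarrow> real ^ 'n"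
    and u v :: "real \<Rightarrow> real ^ 'n \<Rightarrow> real ^ 'n"
    and \<alpha> p :: real
    and C :: "real \<Rightarrow> real"
  assumes "CARD('n) \<ge> 2"
    and "T > 0"
    and "torus_Lp 2 u0"
    and "admissible_euler_weak_solution T u0 u"
    and "euler_weak_solution T u0 v"
    and "\<alpha> \<in> {0<..<1}" and "\<alpha> > 1 / 2" and "p \<ge> 2"
    and "L2_time_besov T p \<alpha> v"
    and "integrable (time_measure T) C"
    and "\<And>t. t \<in> {0..<T} \<Longrightarrow> C t \<ge> 0"
    and "\<And>(\<zeta> :: real ^ 'n) \<tau> \<phi>. \<tau> \<in> {0..<T} \<Longrightarrow> torus_smooth \<phi> \<Longrightarrow> (\<And>x. \<phi> x \<ge> 0) \<Longrightarrow>
           (\<integral>x. - ((\<zeta> \<bullet> v \<tau> x) * (\<zeta> \<bullet> grad \<phi> x)) + C \<tau> * (norm \<zeta>)\<^sup>2 * \<phi> x \<partial>torus) \<ge> 0"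
  shows "\<forall>t\<in>{0..<T}. AE x in torus. u t x = v t x"
proof
  fix t assume t: "t \<in> {0..<T}"
  have solu: "euler_weak_solution T u0 u"
    using assms(4) by (simp add: admissible_euler_weak_solution_def)
  define U where "U t i x = u t x $ i" for t i x
  define V where "V t i x = v t x $ i" for t i x
  have U: "euler_flow T U" and V: "euler_flow T V"
    using euler_flow_weak_solution[OF solu] euler_flow_weak_solution[OF assms(5)]
    unfolding U_def[abs_def] V_def[abs_def] by auto
  note squ = euler_flow_sq_integrable[OF U] and sqv = euler_flow_sq_integrable[OF V]
  define e where "e r = (\<Sum>i\<in>UNIV. (L2dist (U r i) (V r i))\<^sup>2)" for r
  have init: "L2dist (U 0 i) (V 0 i) = 0" for i
  proof (rule L2norm_AE_0)
    have "AE x in torus. u 0 x = u0 x" "AE x in torus. v 0 x = u0 x"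
      using solu assms(5) by (simp_all add: euler_weak_solution_def)
    then show "AE x in torus. U 0 i x - V 0 i x = 0"
      by eventually_elim (simp add: U_def V_def)
  qed
  have energy: "(\<Sum>i\<in>UNIV. (L2norm (U r i))\<^sup>2) \<le> (\<Sum>i\<in>UNIV. (L2norm (U 0 i))\<^sup>2)"
    if r: "r \<in> {0..<T}" for r
  \<comment> \<open>Admissibility compares two different times only, so time 0 is treated
    apart.\<close>
  proof (cases "r = 0")
    case False
    have "(\<Sum>i\<in>UNIV. (L2norm (U s i))\<^sup>2) = (\<integral>x. (norm (u s x))\<^sup>2 \<partial>torus)" if "s \<in> {0..<T}" for s
      using sum_L2norm_component_sq[of "u s"] squ[OF that] by (simp add: U_def[abs_def])
    moreover have "(\<integral>x. (norm (u r x))\<^sup>2 \<partial>torus) \<le> (\<integral>x. (norm (u 0 x))\<^sup>2 \<partial>torus)"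
      using assms(4) r False by (simp add: admissible_euler_weak_solution_def)
    ultimately show ?thesis using r assms(2) by simp
  qed simp
  have os: "one_sided (V r) (C r)" if r: "r \<in> {0..<T}" for r
    unfolding V_def[abs_def]
    by (rule one_sided_component[OF _ assms(12)[OF r]])
       (use sqv[OF r] in \<open>simp_all add: V_def[abs_def]\<close>)
  have "C integrable_on {0..<T}"
    using assms(10) unfolding time_measure_def by (rule integrable_on_lebesgue_on) simp
  then have Ci: "C integrable_on {0..r}" if "r \<in> {0..<T}" for r
    by (rule integrable_on_subinterval) (use that in auto)
  have "e t = 0"
  proof (rule gronwall_zero[of T e "\<lambda>r. 2 * C r"])
    show "continuous_on {0..<T} e"
      unfolding e_def using U V
      by (intro continuous_on_sum continuous_on_power continuous_on_L2norm L2_continuous_on_diff)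
         (auto simp: euler_flow_def)
    show "e r \<ge> 0" for r by (simp add: e_def sum_nonneg)
    show "2 * C r \<ge> 0" if "r \<in> {0..<T}" for r using assms(11)[OF that] by simp
    show "(\<lambda>r. 2 * C r) integrable_on {0..r}" if "r \<in> {0..<T}" for r
      using Ci[OF that] by simp
    show "e r \<le> integral {0..r} (\<lambda>r. 2 * C r * e r)" if "r \<in> {0..<T}" for r
      unfolding e_def by (rule relative_energy_inequality[OF U V init energy os assms(11) that Ci[OF that]])
  qed (rule t)
  then have "\<forall>i\<in>UNIV. (L2dist (U t i) (V t i))\<^sup>2 = 0"
    unfolding e_def by (subst (asm) sum_nonneg_eq_0_iff) auto
  then have "AE x in torus. U t i x - V t i x = 0" for i
    by (intro L2norm_eq_0_imp_AE sq_integrable_diff squ[OF t] sqv[OF t]) simp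
  then have "AE x in torus. \<forall>i\<in>UNIV. U t i x - V t i x = 0"
    by (intro AE_finite_allI) auto
  then show "AE x in torus. u t x = v t x"
    by eventually_elim (simp add: U_def V_def vec_eq_iff)
qed

end
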